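(* Let $(R,\mathfrak m,k)$ be a commutative Artinian local ring which is standard graded, and let $M$, $N$ be non-zero finitely generated $R$-modules satisfying $\mathfrak m^2M=\mathfrak m^2N=0$. If $\operatorname{Tor}_i^R(M,N)=0$ for all $i>0$, then $\mathfrak m^3=0$.
   Context: The local ring $R$ with residue field $k$ is called standard graded if it has a decomposition $R=R_0\oplus R_1\oplus\dots\oplus R_h$ such that $R_iR_j\subseteq R_{i+j}$ for all $i,j\in[0,h]$ (with $R_n=0$ for $n>h$), $R_0=k$, and $R=R_0[R_1]$ (that is, $R$ is generated in degree one as a $k$-algebra). The modules $M$ and $N$ are not assumed to be graded. *)

theory Defs
  imports "HOL-Algebra.Module" "HOL-Algebra.QuotRing" "HOL-Algebra.Generated_Rings"
    "HOL-Algebra.Ideal_Product" "HOL-Algebra.Free_Abelian_Groups"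
begin

section \<open>Artinian local rings and standard gradings\<close>

locale local_ring = cring R for R (structure) and \<mm> +
  assumes maximal: "maximalideal \<mm> R"
    and unique_maximal: "maximalideal I R \<Longrightarrow> I = \<mm>"

locale artinian_ring = ring +
  assumes descending_chain:
    "\<lbrakk>\<And>n::nat. ideal (I n) R; \<And>n. I (Suc n) \<subseteq> I n\<rbrakk> \<Longrightarrow> \<exists>n. \<forall>k\<ge>n. I k = I n"

locale artinian_local_ring = local_ring + artinian_ring

text \<open>
  The condition \<open>R\<^sub>0 = k\<close> says that the subring \<open>R\<^sub>0\<close> is mapped isomorphically onto the residue
  field by the projection \<open>R \<rightarrow> R/\<mm>\<close>. The subalgebra \<open>R\<^sub>0[R\<^sub>1]\<close> is the subring generated by
  \<open>R\<^sub>0 \<union> R\<^sub>1\<close>.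
\<close>
definition standard_graded :: "('a, 'r) ring_scheme \<Rightarrow> 'a set \<Rightarrow> bool" where
  "standard_graded R \<mm> \<longleftrightarrow>
    (\<exists>(h :: nat) (G :: nat \<Rightarrow> 'a set).
       (\<forall>i. additive_subgroup (G i) R) \<and>
       (\<forall>i>h. G i = {\<zero>\<^bsub>R\<^esub>}) \<and>
       (\<forall>x\<in>carrier R. \<exists>!f. f \<in> (\<Pi>\<^sub>E i\<in>{..h}. G i) \<and> x = (\<Oplus>\<^bsub>R\<^esub>i\<in>{..h}. f i)) \<and>
       (\<forall>i\<le>h. \<forall>j\<le>h. \<forall>a\<in>G i. \<forall>b\<in>G j. a \<otimes>\<^bsub>R\<^esub> b \<in> G (i + j)) \<and>
       subring (G 0) R \<and>
       (\<lambda>a. \<mm> +>\<^bsub>R\<^esub> a) \<in> ring_iso (R\<lparr>carrier := G 0\<rparr>) (R Quot \<mm>) \<and>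
       generate_ring R (G 0 \<union> G 1) = carrier R)"


section \<open>Modules\<close>

definition submodule_gen ::
    "('a, 'r) ring_scheme \<Rightarrow> ('a, 'm, 'x) module_scheme \<Rightarrow> 'm set \<Rightarrow> 'm set" where
  "submodule_gen R M S = \<Inter>{H. submodule H R M \<and> S \<subseteq> H}"

definition fin_gen_module ::
    "('a, 'r) ring_scheme \<Rightarrow> ('a, 'm, 'x) module_scheme \<Rightarrow> bool" where
  "fin_gen_module R M \<longleftrightarrow> module R M \<and>
    (\<exists>S. finite S \<and> S \<subseteq> carrier M \<and> submodule_gen R M S = carrier M)"

definition zero_module :: "('a, 'm, 'x) module_scheme \<Rightarrow> bool" where
  "zero_module M \<longleftrightarrow> carrier M = {\<zero>\<^bsub>M\<^esub>}"

definition ideal_smult ::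
    "('a, 'r) ring_scheme \<Rightarrow> 'a set \<Rightarrow> ('a, 'm, 'x) module_scheme \<Rightarrow> 'm set" where
  "ideal_smult R I M = submodule_gen R M {a \<odot>\<^bsub>M\<^esub> x | a x. a \<in> I \<and> x \<in> carrier M}"

definition mod_hom ::
    "('a, 'r) ring_scheme \<Rightarrow> ('a, 'm, 'x) module_scheme \<Rightarrow> ('a, 'n, 'y) module_scheme \<Rightarrow>
     ('m \<Rightarrow> 'n) set" where
  "mod_hom R M N = {h \<in> carrier M \<rightarrow> carrier N.
     (\<forall>x\<in>carrier M. \<forall>y\<in>carrier M. h (x \<oplus>\<^bsub>M\<^esub> y) = h x \<oplus>\<^bsub>N\<^esub> h y) \<and>
     (\<forall>a\<in>carrier R. \<forall>x\<in>carrier M. h (a \<odot>\<^bsub>M\<^esub> x) = a \<odot>\<^bsub>N\<^esub> h x)}"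

text \<open>The fields \<open>mult\<close> and \<open>one\<close> of a module record carry no meaning.\<close>

definition quot_module :: "('a, 'm, 'x) module_scheme \<Rightarrow> 'm set \<Rightarrow> ('a, 'm set) module" where
  "quot_module M K =
    \<lparr>carrier = a_rcosets\<^bsub>M\<^esub> K, mult = undefined, one = undefined, ring.zero = K, add = set_add M,
     smult = (\<lambda>a C. \<Union>x\<in>C. K +>\<^bsub>M\<^esub> (a \<odot>\<^bsub>M\<^esub> x))\<rparr>"

definition free_module :: "('a, 'r) ring_scheme \<Rightarrow> 'b set \<Rightarrow> ('a, 'b \<Rightarrow> 'a) module" where
  "free_module R B =
    \<lparr>carrier = {u. (\<forall>b\<in>B. u b \<in> carrier R) \<and> (\<forall>b. b \<notin> B \<longrightarrow> u b = \<zero>\<^bsub>R\<^esub>) \<and>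
                   finite {b. u b \<noteq> \<zero>\<^bsub>R\<^esub>}},
     mult = undefined, one = undefined,
     ring.zero = (\<lambda>b. \<zero>\<^bsub>R\<^esub>), add = (\<lambda>u v b. u b \<oplus>\<^bsub>R\<^esub> v b), smult = (\<lambda>a u b. a \<otimes>\<^bsub>R\<^esub> u b)\<rparr>"

definition free_basis :: "('a, 'r) ring_scheme \<Rightarrow> 'b \<Rightarrow> 'b \<Rightarrow> 'a" where
  "free_basis R b = (\<lambda>c. if c = b then \<one>\<^bsub>R\<^esub> else \<zero>\<^bsub>R\<^esub>)"


section \<open>Tensor products\<close>

definition tensor_rels ::
    "('a, 'r) ring_scheme \<Rightarrow> ('a, 'm, 'x) module_scheme \<Rightarrow> ('a, 'n, 'y) module_scheme \<Rightarrow>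
     ('m \<times> 'n \<Rightarrow> 'a) set" where
  "tensor_rels R M N =
    (let F = free_module R (carrier M \<times> carrier N); e = free_basis R in
      {e (x \<oplus>\<^bsub>M\<^esub> x', y) \<ominus>\<^bsub>F\<^esub> (e (x, y) \<oplus>\<^bsub>F\<^esub> e (x', y)) | x x' y.
         x \<in> carrier M \<and> x' \<in> carrier M \<and> y \<in> carrier N} \<union>
      {e (x, y \<oplus>\<^bsub>N\<^esub> y') \<ominus>\<^bsub>F\<^esub> (e (x, y) \<oplus>\<^bsub>F\<^esub> e (x, y')) | x y y'.
         x \<in> carrier M \<and> y \<in> carrier N \<and> y' \<in> carrier N} \<union>
      {e (a \<odot>\<^bsub>M\<^esub> x, y) \<ominus>\<^bsub>F\<^esub> (a \<odot>\<^bsub>F\<^esub> e (x, y)) | a x y.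
         a \<in> carrier R \<and> x \<in> carrier M \<and> y \<in> carrier N} \<union>
      {e (x, a \<odot>\<^bsub>N\<^esub> y) \<ominus>\<^bsub>F\<^esub> (a \<odot>\<^bsub>F\<^esub> e (x, y)) | a x y.
         a \<in> carrier R \<and> x \<in> carrier M \<and> y \<in> carrier N})"

definition tensor_kernel ::
    "('a, 'r) ring_scheme \<Rightarrow> ('a, 'm, 'x) module_scheme \<Rightarrow> ('a, 'n, 'y) module_scheme \<Rightarrow>
     ('m \<times> 'n \<Rightarrow> 'a) set" where
  "tensor_kernel R M N =
     submodule_gen R (free_module R (carrier M \<times> carrier N)) (tensor_rels R M N)"

definition tensor ::
    "('a, 'r) ring_scheme \<Rightarrow> ('a, 'm, 'x) module_scheme \<Rightarrow> ('a, 'n, 'y) module_scheme \<Rightarrow>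
     ('a, ('m \<times> 'n \<Rightarrow> 'a) set) module" where
  "tensor R M N =
     quot_module (free_module R (carrier M \<times> carrier N)) (tensor_kernel R M N)"

definition pure_tensor ::
    "('a, 'r) ring_scheme \<Rightarrow> ('a, 'm, 'x) module_scheme \<Rightarrow> ('a, 'n, 'y) module_scheme \<Rightarrow>
     'm \<Rightarrow> 'n \<Rightarrow> ('m \<times> 'n \<Rightarrow> 'a) set" where
  "pure_tensor R M N x y =
     tensor_kernel R M N +>\<^bsub>free_module R (carrier M \<times> carrier N)\<^esub> free_basis R (x, y)"

text \<open>
  The map \<open>f \<otimes> N\<close>. Existence is lemma \<open>tensor_map\<close> below; since the elements
  \<open>x \<otimes> y\<close> generate \<open>M \<otimes> N\<close>, the choice is unique on the carrier.
\<close>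
definition tensor_map ::
    "('a, 'r) ring_scheme \<Rightarrow> ('a, 'm, 'x) module_scheme \<Rightarrow> ('a, 'm', 'z) module_scheme \<Rightarrow>
     ('a, 'n, 'y) module_scheme \<Rightarrow> ('m \<Rightarrow> 'm') \<Rightarrow>
     ('m \<times> 'n \<Rightarrow> 'a) set \<Rightarrow> ('m' \<times> 'n \<Rightarrow> 'a) set" where
  "tensor_map R M M' N f =
    (SOME h. h \<in> mod_hom R (tensor R M N) (tensor R M' N) \<and>
       (\<forall>x\<in>carrier M. \<forall>y\<in>carrier N.
          h (pure_tensor R M N x y) = pure_tensor R M' N (f x) y))"


section \<open>Free resolutions and Tor\<close>

text \<open>
  A free resolution
  \<open>\<dots> \<rightarrow> F\<^sub>2 \<rightarrow> F\<^sub>1 \<rightarrow> F\<^sub>0 \<rightarrow> M \<rightarrow> 0\<close>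
  with \<open>F\<^sub>n\<close> free on \<open>B n\<close>, differentials \<open>d n : F\<^sub>n\<^sub>+\<^sub>1 \<rightarrow> F\<^sub>n\<close> and augmentation \<open>\<epsilon>\<close>.
\<close>
definition free_resolution ::
    "('a, 'r) ring_scheme \<Rightarrow> ('a, 'm, 'x) module_scheme \<Rightarrow>
     (nat \<Rightarrow> 'b set) \<Rightarrow> (nat \<Rightarrow> ('b \<Rightarrow> 'a) \<Rightarrow> ('b \<Rightarrow> 'a)) \<Rightarrow> (('b \<Rightarrow> 'a) \<Rightarrow> 'm) \<Rightarrow> bool" where
  "free_resolution R M B d \<epsilon> \<longleftrightarrow>
    (let F = (\<lambda>n. free_module R (B n)) in
      \<epsilon> \<in> mod_hom R (F 0) M \<and>
      (\<forall>n. d n \<in> mod_hom R (F (Suc n)) (F n)) \<and>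
      \<epsilon> ` carrier (F 0) = carrier M \<and>
      a_kernel (F 0) M \<epsilon> = d 0 ` carrier (F (Suc 0)) \<and>
      (\<forall>n. a_kernel (F (Suc n)) (F n) (d n) = d (Suc n) ` carrier (F (Suc (Suc n)))))"

text \<open>
  \<open>tor_of R B d N i\<close> is the homology in degree \<open>i\<close> of the complex
  \<open>\<dots> \<rightarrow> F\<^sub>1 \<otimes> N \<rightarrow> F\<^sub>0 \<otimes> N \<rightarrow> 0\<close>.
\<close>
definition tor_of ::
    "('a, 'r) ring_scheme \<Rightarrow> (nat \<Rightarrow> 'b set) \<Rightarrow> (nat \<Rightarrow> ('b \<Rightarrow> 'a) \<Rightarrow> ('b \<Rightarrow> 'a)) \<Rightarrow>
     ('a, 'n, 'y) module_scheme \<Rightarrow> nat \<Rightarrow> ('a, (('b \<Rightarrow> 'a) \<times> 'n \<Rightarrow> 'a) set set) module" where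
  "tor_of R B d N i =
    (let F = (\<lambda>n. free_module R (B n));
         T = (\<lambda>n. tensor R (F n) N);
         \<delta> = (\<lambda>n. tensor_map R (F (Suc n)) (F n) N (d n));
         Z = (case i of 0 \<Rightarrow> carrier (T 0) | Suc j \<Rightarrow> a_kernel (T (Suc j)) (T j) (\<delta> j))
     in quot_module ((T i)\<lparr>carrier := Z\<rparr>) (\<delta> i ` carrier (T (Suc i))))"

text \<open>
  \<open>Tor\<^sub>i(M, N)\<close> is computed from a chosen free resolution of \<open>M\<close>. HOL requires one type for the
  bases of all the \<open>F\<^sub>n\<close>; with lists over \<open>'m + 'a\<close> a free resolution exists for every
  module, see lemma \<open>free_resolution_exists\<close> below.
\<close>
definition Tor ::
    "('a, 'r) ring_scheme \<Rightarrow> ('a, 'm, 'x) module_scheme \<Rightarrow> ('a, 'n, 'y) module_scheme \<Rightarrow> nat \<Rightarrow>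
     ('a, ((('m + 'a) list \<Rightarrow> 'a) \<times> 'n \<Rightarrow> 'a) set set) module" where
  "Tor R M N i =
    (let (B, d) = (SOME (B, d). \<exists>\<epsilon>. free_resolution R M B d \<epsilon>) in tor_of R B d N i)"


section \<open>The choices made above exist\<close>

lemma mod_hom_closed: "h \<in> mod_hom R M N \<Longrightarrow> x \<in> carrier M \<Longrightarrow> h x \<in> carrier N"
  and mod_hom_add: "h \<in> mod_hom R M N \<Longrightarrow> x \<in> carrier M \<Longrightarrow> y \<in> carrier M \<Longrightarrow>
    h (x \<oplus>\<^bsub>M\<^esub> y) = h x \<oplus>\<^bsub>N\<^esub> h y"
  and mod_hom_smult: "h \<in> mod_hom R M N \<Longrightarrow> a \<in> carrier R \<Longrightarrow> x \<in> carrier M \<Longrightarrow>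
    h (a \<odot>\<^bsub>M\<^esub> x) = a \<odot>\<^bsub>N\<^esub> h x"
  by (auto simp: mod_hom_def)

lemma mod_hom_zero:
  assumes "module R M" "module R N" "h \<in> mod_hom R M N"
  shows "h \<zero>\<^bsub>M\<^esub> = \<zero>\<^bsub>N\<^esub>"
proof -
  interpret M: module R M by fact
  interpret N: module R N by fact
  have "h (\<zero>\<^bsub>R\<^esub> \<odot>\<^bsub>M\<^esub> \<zero>\<^bsub>M\<^esub>) = \<zero>\<^bsub>R\<^esub> \<odot>\<^bsub>N\<^esub> h \<zero>\<^bsub>M\<^esub>"
    using mod_hom_smult[OF assms(3)] by blast
  then show ?thesis
    using mod_hom_closed[OF assms(3)] by (simp add: M.smult_l_null N.smult_l_null)
qed

lemma mod_hom_minus: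
  assumes "module R M" "module R N" "h \<in> mod_hom R M N" "x \<in> carrier M"
  shows "h (\<ominus>\<^bsub>M\<^esub> x) = \<ominus>\<^bsub>N\<^esub> h x"
proof -
  interpret M: module R M by fact
  interpret N: module R N by fact
  have "h (\<ominus>\<^bsub>M\<^esub> x) \<oplus>\<^bsub>N\<^esub> h x = h (\<ominus>\<^bsub>M\<^esub> x \<oplus>\<^bsub>M\<^esub> x)"
    using mod_hom_add[OF assms(3)] assms(4) by simp
  also have "\<dots> = \<zero>\<^bsub>N\<^esub>"
    using assms(4) mod_hom_zero[OF assms(1-3)] by (simp add: M.l_neg)
  finally have e: "h (\<ominus>\<^bsub>M\<^esub> x) \<oplus>\<^bsub>N\<^esub> h x = \<zero>\<^bsub>N\<^esub>" .
  have "h x \<in> carrier N" "h (\<ominus>\<^bsub>M\<^esub> x) \<in> carrier N"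
    using mod_hom_closed[OF assms(3)] assms(4) by auto
  with e show ?thesis
    by (simp add: N.minus_equality)
qed

lemma kernel_submodule:
  assumes "module R M" "module R N" "h \<in> mod_hom R M N"
  shows "submodule (a_kernel M N h) R M"
proof -
  interpret M: module R M by fact
  interpret N: module R N by fact
  show ?thesis
    by (rule M.submoduleI)
      (auto simp: a_kernel_def kernel_def mod_hom_zero[OF assms] mod_hom_minus[OF assms]
        mod_hom_add[OF assms(3)] mod_hom_smult[OF assms(3)])
qed

lemma free_module_simps:
  "u \<in> carrier (free_module R B) \<longleftrightarrow> (\<forall>b\<in>B. u b \<in> carrier R) \<and>
     (\<forall>b. b \<notin> B \<longrightarrow> u b = \<zero>\<^bsub>R\<^esub>) \<and> finite {b. u b \<noteq> \<zero>\<^bsub>R\<^esub>}"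
  "\<zero>\<^bsub>free_module R B\<^esub> = (\<lambda>b. \<zero>\<^bsub>R\<^esub>)"
  "u \<oplus>\<^bsub>free_module R B\<^esub> v = (\<lambda>b. u b \<oplus>\<^bsub>R\<^esub> v b)"
  "a \<odot>\<^bsub>free_module R B\<^esub> u = (\<lambda>b. a \<otimes>\<^bsub>R\<^esub> u b)"
  by (simp_all add: free_module_def)

lemma (in cring) free_module_coeff:
  "u \<in> carrier (free_module R B) \<Longrightarrow> u b \<in> carrier R"
  by (cases "b \<in> B") (auto simp: free_module_simps)

lemma (in cring) free_module_add_closed:
  assumes "u \<in> carrier (free_module R B)" "v \<in> carrier (free_module R B)"
  shows "u \<oplus>\<^bsub>free_module R B\<^esub> v \<in> carrier (free_module R B)"
proof -
  have "{b. u b \<oplus> v b \<noteq> \<zero>} \<subseteq> {b. u b \<noteq> \<zero>} \<union> {b. v b \<noteq> \<zero>}"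
    by auto
  then have "finite {b. u b \<oplus> v b \<noteq> \<zero>}"
    using assms by (auto simp: free_module_simps intro: finite_subset)
  then show ?thesis
    using assms by (auto simp: free_module_simps)
qed

lemma (in cring) free_module_smult_closed:
  assumes "a \<in> carrier R" "u \<in> carrier (free_module R B)"
  shows "a \<odot>\<^bsub>free_module R B\<^esub> u \<in> carrier (free_module R B)"
proof -
  have "{b. a \<otimes> u b \<noteq> \<zero>} \<subseteq> {b. u b \<noteq> \<zero>}"
    using assms by auto
  then have "finite {b. a \<otimes> u b \<noteq> \<zero>}"
    using assms by (auto simp: free_module_simps intro: finite_subset)
  then show ?thesis
    using assms by (auto simp: free_module_simps)
qed

lemma (in cring) free_module_module: "module R (free_module R B)"
proof (rule moduleI)
  show "abelian_group (free_module R B)"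
  proof (rule abelian_groupI)
    fix u assume u: "u \<in> carrier (free_module R B)"
    have "(\<ominus> \<one>) \<odot>\<^bsub>free_module R B\<^esub> u \<in> carrier (free_module R B)"
      using u by (intro free_module_smult_closed) auto
    moreover have "((\<ominus> \<one>) \<odot>\<^bsub>free_module R B\<^esub> u) \<oplus>\<^bsub>free_module R B\<^esub> u = \<zero>\<^bsub>free_module R B\<^esub>"
      using free_module_coeff[OF u] by (auto simp: free_module_simps l_minus l_neg)
    ultimately show "\<exists>v\<in>carrier (free_module R B). v \<oplus>\<^bsub>free_module R B\<^esub> u = \<zero>\<^bsub>free_module R B\<^esub>"
      by blast
  next
    fix u v w assume "u \<in> carrier (free_module R B)" "v \<in> carrier (free_module R B)"
      "w \<in> carrier (free_module R B)"
    note c = this[THEN free_module_coeff]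
    show "u \<oplus>\<^bsub>free_module R B\<^esub> v \<oplus>\<^bsub>free_module R B\<^esub> w =
        u \<oplus>\<^bsub>free_module R B\<^esub> (v \<oplus>\<^bsub>free_module R B\<^esub> w)"
      using c by (simp add: free_module_simps a_assoc)
  next
    fix u v assume "u \<in> carrier (free_module R B)" "v \<in> carrier (free_module R B)"
    note c = this[THEN free_module_coeff]
    show "u \<oplus>\<^bsub>free_module R B\<^esub> v = v \<oplus>\<^bsub>free_module R B\<^esub> u"
      using c by (simp add: free_module_simps a_comm)
  next
    fix u assume "u \<in> carrier (free_module R B)"
    note c = this[THEN free_module_coeff]
    show "\<zero>\<^bsub>free_module R B\<^esub> \<oplus>\<^bsub>free_module R B\<^esub> u = u"
      using c by (simp add: free_module_simps)
  next
    show "\<zero>\<^bsub>free_module R B\<^esub> \<in> carrier (free_module R B)"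
      by (simp add: free_module_simps)
  qed (rule free_module_add_closed)
next
  fix a b u v
  assume ab: "a \<in> carrier R" "b \<in> carrier R" and "u \<in> carrier (free_module R B)"
  note c = this(3)[THEN free_module_coeff]
  show "(a \<oplus> b) \<odot>\<^bsub>free_module R B\<^esub> u = a \<odot>\<^bsub>free_module R B\<^esub> u \<oplus>\<^bsub>free_module R B\<^esub> b \<odot>\<^bsub>free_module R B\<^esub> u"
    using ab c by (simp add: free_module_simps l_distr)
  show "a \<otimes> b \<odot>\<^bsub>free_module R B\<^esub> u = a \<odot>\<^bsub>free_module R B\<^esub> (b \<odot>\<^bsub>free_module R B\<^esub> u)"
    using ab c by (simp add: free_module_simps m_assoc)
next
  fix a u v
  assume ab: "a \<in> carrier R" and "u \<in> carrier (free_module R B)" "v \<in> carrier (free_module R B)"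
  note c = this(2,3)[THEN free_module_coeff]
  show "a \<odot>\<^bsub>free_module R B\<^esub> (u \<oplus>\<^bsub>free_module R B\<^esub> v) = a \<odot>\<^bsub>free_module R B\<^esub> u \<oplus>\<^bsub>free_module R B\<^esub> a \<odot>\<^bsub>free_module R B\<^esub> v"
    using ab c by (simp add: free_module_simps r_distr)
next
  fix u assume "u \<in> carrier (free_module R B)"
  note c = this[THEN free_module_coeff]
  show "\<one> \<odot>\<^bsub>free_module R B\<^esub> u = u"
    using c by (simp add: free_module_simps)
qed (auto intro: cring_axioms free_module_smult_closed)

lemma (in cring) free_basis_closed: "b \<in> B \<Longrightarrow> free_basis R b \<in> carrier (free_module R B)"
proof -
  assume "b \<in> B"
  moreover have "{c. free_basis R b c \<noteq> \<zero>} \<subseteq> {b}"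
    by (auto simp: free_basis_def)
  ultimately show ?thesis
    by (auto simp: free_module_simps free_basis_def intro: finite_subset)
qed

definition lin_ext ::
    "('a, 'r) ring_scheme \<Rightarrow> ('a, 'm, 'x) module_scheme \<Rightarrow> ('b \<Rightarrow> 'm) \<Rightarrow> ('b \<Rightarrow> 'a) \<Rightarrow> 'm" where
  "lin_ext R M g u = (\<Oplus>\<^bsub>M\<^esub>b\<in>{b. u b \<noteq> \<zero>\<^bsub>R\<^esub>}. u b \<odot>\<^bsub>M\<^esub> g b)"

lemma lin_ext_superset:
  assumes "module R M" "g \<in> B \<rightarrow> carrier M" "u \<in> carrier (free_module R B)"
    and "finite A" "{b. u b \<noteq> \<zero>\<^bsub>R\<^esub>} \<subseteq> A" "A \<subseteq> B"
  shows "lin_ext R M g u = (\<Oplus>\<^bsub>M\<^esub>b\<in>A. u b \<odot>\<^bsub>M\<^esub> g b)"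
proof -
  interpret M: module R M by fact
  show ?thesis
    unfolding lin_ext_def
    using assms(2-)
    by (intro M.add.finprod_mono_neutral_cong_left)
      (auto simp: free_module_simps Pi_iff subset_iff M.smult_l_null)
qed

lemma lin_ext_hom:
  assumes "module R M" "g \<in> B \<rightarrow> carrier M"
  shows "lin_ext R M g \<in> mod_hom R (free_module R B) M"
proof -
  interpret M: module R M by fact
  have supp: "{b. u b \<noteq> \<zero>\<^bsub>R\<^esub>} \<subseteq> B" "finite {b. u b \<noteq> \<zero>\<^bsub>R\<^esub>}"
    if "u \<in> carrier (free_module R B)" for u
    using that by (auto simp: free_module_simps)
  have g: "g b \<in> carrier M" if "b \<in> B" for b
    using that assms(2) by auto
  show ?thesis
    unfolding mod_hom_def
  proof (intro CollectI conjI ballI funcsetI)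
    fix u assume u: "u \<in> carrier (free_module R B)"
    show "lin_ext R M g u \<in> carrier M"
      unfolding lin_ext_def using M.free_module_coeff[OF u] supp(1)[OF u] g
      by (intro M.finsum_closed) auto
  next
    fix u v assume u: "u \<in> carrier (free_module R B)" and v: "v \<in> carrier (free_module R B)"
    define A where "A = {b. u b \<noteq> \<zero>\<^bsub>R\<^esub>} \<union> {b. v b \<noteq> \<zero>\<^bsub>R\<^esub>}"
    have A: "finite A" "A \<subseteq> B"
      using supp[OF u] supp[OF v] by (auto simp: A_def)
    have eq: "lin_ext R M g w = (\<Oplus>\<^bsub>M\<^esub>b\<in>A. w b \<odot>\<^bsub>M\<^esub> g b)"
      if "w \<in> carrier (free_module R B)" "{b. w b \<noteq> \<zero>\<^bsub>R\<^esub>} \<subseteq> A" for w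
      using lin_ext_superset[OF assms that(1) A(1) that(2) A(2)] .
    have "lin_ext R M g (u \<oplus>\<^bsub>free_module R B\<^esub> v) = (\<Oplus>\<^bsub>M\<^esub>b\<in>A. (u b \<oplus>\<^bsub>R\<^esub> v b) \<odot>\<^bsub>M\<^esub> g b)"
    proof -
      have "{b. u b \<oplus>\<^bsub>R\<^esub> v b \<noteq> \<zero>\<^bsub>R\<^esub>} \<subseteq> A"
        by (auto simp: A_def)
      then show ?thesis
        using eq[OF M.free_module_add_closed[OF u v]] by (simp add: free_module_simps(3))
    qed
    also have "\<dots> = (\<Oplus>\<^bsub>M\<^esub>b\<in>A. u b \<odot>\<^bsub>M\<^esub> g b \<oplus>\<^bsub>M\<^esub> v b \<odot>\<^bsub>M\<^esub> g b)"
      using M.free_module_coeff[OF u] M.free_module_coeff[OF v] A(2) g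
      by (intro M.finsum_cong') (auto simp: M.smult_l_distr subset_iff)
    also have "\<dots> = (\<Oplus>\<^bsub>M\<^esub>b\<in>A. u b \<odot>\<^bsub>M\<^esub> g b) \<oplus>\<^bsub>M\<^esub> (\<Oplus>\<^bsub>M\<^esub>b\<in>A. v b \<odot>\<^bsub>M\<^esub> g b)"
      using M.free_module_coeff[OF u] M.free_module_coeff[OF v] A(2) g
      by (intro M.finsum_addf) (auto simp: subset_iff)
    also have "\<dots> = lin_ext R M g u \<oplus>\<^bsub>M\<^esub> lin_ext R M g v"
      using eq[OF u] eq[OF v] by (auto simp: A_def)
    finally show "lin_ext R M g (u \<oplus>\<^bsub>free_module R B\<^esub> v) = lin_ext R M g u \<oplus>\<^bsub>M\<^esub> lin_ext R M g v" .
  next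
    fix a u assume a: "a \<in> carrier R" and u: "u \<in> carrier (free_module R B)"
    define A where "A = {b. u b \<noteq> \<zero>\<^bsub>R\<^esub>}"
    have A: "finite A" "A \<subseteq> B"
      using supp[OF u] by (auto simp: A_def)
    have "lin_ext R M g (a \<odot>\<^bsub>free_module R B\<^esub> u) = (\<Oplus>\<^bsub>M\<^esub>b\<in>A. (a \<otimes>\<^bsub>R\<^esub> u b) \<odot>\<^bsub>M\<^esub> g b)"
    proof -
      have "{b. a \<otimes>\<^bsub>R\<^esub> u b \<noteq> \<zero>\<^bsub>R\<^esub>} \<subseteq> A"
        using a by (auto simp: A_def)
      then show ?thesis
        using lin_ext_superset[OF assms M.free_module_smult_closed[OF a u] A(1) _ A(2)]
        by (simp add: free_module_simps(4))
    qed
    also have "\<dots> = (\<Oplus>\<^bsub>M\<^esub>b\<in>A. a \<odot>\<^bsub>M\<^esub> (u b \<odot>\<^bsub>M\<^esub> g b))"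
      using M.free_module_coeff[OF u] a A(2) g
      by (intro M.finsum_cong') (auto simp: M.smult_assoc1 subset_iff)
    also have "\<dots> = a \<odot>\<^bsub>M\<^esub> lin_ext R M g u"
      unfolding lin_ext_def A_def[symmetric]
      using M.free_module_coeff[OF u] a A g
      by (intro M.finsum_smult_ldistr[symmetric]) (auto simp: subset_iff)
    finally show "lin_ext R M g (a \<odot>\<^bsub>free_module R B\<^esub> u) = a \<odot>\<^bsub>M\<^esub> lin_ext R M g u" .
  qed
qed

lemma lin_ext_basis:
  assumes "module R M" "g \<in> B \<rightarrow> carrier M" "b \<in> B"
  shows "lin_ext R M g (free_basis R b) = g b"
proof -
  interpret M: module R M by fact
  have "lin_ext R M g (free_basis R b) = (\<Oplus>\<^bsub>M\<^esub>c\<in>{b}. free_basis R b c \<odot>\<^bsub>M\<^esub> g c)"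
    using assms
    by (intro lin_ext_superset M.free_basis_closed) (auto simp: free_basis_def)
  also have "\<dots> = g b"
    using assms(2,3) by (auto simp: free_basis_def Pi_iff)
  finally show ?thesis .
qed

lemma lin_ext_onto:
  assumes "module R M" "submodule K R M" "g ` B = K"
  shows "lin_ext R M g ` carrier (free_module R B) = K"
proof -
  interpret M: module R M by fact
  interpret K: submodule K R M by fact
  have g: "g \<in> B \<rightarrow> carrier M"
    using assms(3) K.subset by auto
  have "finsum M f A \<in> K" if "finite A" "f \<in> A \<rightarrow> K" for f A
    using that
  proof (induction A)
    case empty
    then show ?case using K.one_closed by (simp add: M.finsum_empty)
  next
    case (insert x A)
    have "f \<in> A \<rightarrow> carrier M" "f x \<in> carrier M"
      using insert.prems K.subset by (auto simp: Pi_iff)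
    then show ?case
      using insert K.m_closed[of "f x" "finsum M f A"] by (auto simp: M.finsum_insert)
  qed
  note fs = this
  have "lin_ext R M g u \<in> K" if u: "u \<in> carrier (free_module R B)" for u
    unfolding lin_ext_def
  proof (rule fs)
    show "finite {b. u b \<noteq> \<zero>\<^bsub>R\<^esub>}"
      using u unfolding free_module_simps(1) by blast
    show "(\<lambda>b. u b \<odot>\<^bsub>M\<^esub> g b) \<in> {b. u b \<noteq> \<zero>\<^bsub>R\<^esub>} \<rightarrow> K"
    proof (intro funcsetI)
      fix b assume "b \<in> {b. u b \<noteq> \<zero>\<^bsub>R\<^esub>}"
      then have "b \<in> B"
        using u by (auto simp: free_module_simps)
      have "u b \<in> carrier R"
        by (rule M.free_module_coeff[OF u])
      have "g b \<in> K"
        using \<open>b \<in> B\<close> imageI[of b B g] unfolding assms(3) by simp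
      with \<open>u b \<in> carrier R\<close> show "u b \<odot>\<^bsub>M\<^esub> g b \<in> K"
        by (rule M.submoduleE(4)[OF assms(2)])
    qed
  qed
  moreover have "K \<subseteq> lin_ext R M g ` carrier (free_module R B)"
  proof
    fix x assume "x \<in> K"
    then obtain b where "b \<in> B" "x = g b"
      unfolding assms(3)[symmetric] by blast
    then show "x \<in> lin_ext R M g ` carrier (free_module R B)"
      by (intro image_eqI[of _ _ "free_basis R b"])
        (simp_all add: lin_ext_basis[OF assms(1) g] M.free_basis_closed)
  qed
  ultimately show ?thesis
    by (intro equalityI subsetI) (elim imageE, simp_all, blast)
qed

lemma surj_free_module:
  fixes R :: "('a, 'r) ring_scheme" and K :: "('x \<Rightarrow> 'a) set"
  assumes "infinite (UNIV :: 'x set)" "|UNIV :: 'a set| \<le>o |UNIV :: 'x set|"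
    and "K \<subseteq> carrier (free_module R B)" "K \<noteq> {}"
  shows "\<exists>g. g ` (UNIV :: 'x set) = K"
proof -
  define G :: "('x \<Rightarrow> 'a) \<Rightarrow> ('x \<times> 'a) set"
    where "G u = {(x, u x) | x. u x \<noteq> \<zero>\<^bsub>R\<^esub>}" for u
  have G: "(x, a) \<in> G u \<longleftrightarrow> a = u x \<and> u x \<noteq> \<zero>\<^bsub>R\<^esub>" for x a u
    by (auto simp: G_def)
  have "u x = v x" if "G u = G v" for u v x
  proof (cases "u x = \<zero>\<^bsub>R\<^esub>")
    case True
    then show ?thesis using G[of x "v x" v] G[of x "v x" u] that by metis
  next
    case False
    then show ?thesis using G[of x "u x" v] G[of x "u x" u] that by metis
  qed
  then have inj: "inj_on G K"
    by (auto intro!: inj_onI)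
  have "finite (G u)" if "u \<in> K" for u
  proof -
    have "G u = (\<lambda>x. (x, u x)) ` {x. u x \<noteq> \<zero>\<^bsub>R\<^esub>}"
      by (auto simp: G_def)
    then show ?thesis
      using that assms(3) by (auto simp: free_module_simps)
  qed
  then have "G ` K \<subseteq> Fpow (UNIV :: ('x \<times> 'a) set)"
    by (auto simp: Fpow_def)
  with inj have 1: "|K| \<le>o |Fpow (UNIV :: ('x \<times> 'a) set)|"
    by (meson card_of_ordLeq)
  have inf: "infinite (UNIV :: ('x \<times> 'a) set)"
    using assms(1) by (simp add: finite_prod)
  have "|UNIV \<times> UNIV :: ('x \<times> 'a) set| \<le>o |UNIV \<times> UNIV :: ('x \<times> 'x) set|"
    using assms(2) by (rule card_of_Times_mono2)
  also have "|UNIV \<times> UNIV :: ('x \<times> 'x) set| =o |UNIV :: 'x set|"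
    using assms(1) by (rule card_of_Times_same_infinite)
  finally have "|UNIV :: ('x \<times> 'a) set| \<le>o |UNIV :: 'x set|"
    by simp
  then have "|K| \<le>o |UNIV :: 'x set|"
    using 1 card_of_Fpow_infinite[OF inf] by (meson ordLeq_ordIso_trans ordLeq_transitive)
  then show ?thesis
    using assms(4) by (metis card_of_ordLeq2)
qed

lemma free_resolution_exists:
  fixes R :: "('a, 'r) ring_scheme" and M :: "('a, 'm, 'x) module_scheme"
  assumes "module R M"
  shows "\<exists>B d \<epsilon>. free_resolution R M (B :: nat \<Rightarrow> ('m + 'a) list set) d \<epsilon>"
proof -
  interpret M: module R M by fact
  define F where "F = free_module R (UNIV :: ('m + 'a) list set)"
  have F: "module R F"
    unfolding F_def by (rule M.free_module_module)
  have inf: "infinite (UNIV :: ('m + 'a) list set)"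
    by (rule infinite_UNIV_listI)
  have card: "|UNIV :: 'a set| \<le>o |UNIV :: ('m + 'a) list set|"
  proof -
    have "inj (\<lambda>a :: 'a. [Inr a :: 'm + 'a])"
      by (auto intro: injI)
    then show ?thesis
      by (meson card_of_ordLeq subset_UNIV)
  qed
  have cover: "\<exists>\<delta>. \<delta> \<in> mod_hom R F F \<and> \<delta> ` carrier F = K" if K: "submodule K R F" for K
  proof -
    interpret K: submodule K R F by fact
    obtain g where g: "g ` (UNIV :: ('m + 'a) list set) = K"
      using surj_free_module[OF inf card, of K R UNIV] K.subset K.one_closed
      by (auto simp: F_def)
    have "lin_ext R F g \<in> mod_hom R F F"
      unfolding F_def
      using g K.subset by (intro lin_ext_hom M.free_module_module) (auto simp: F_def)
    moreover have "lin_ext R F g ` carrier F = K"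
      using lin_ext_onto[OF F K g] by (simp add: F_def)
    ultimately show ?thesis by blast
  qed
  define g :: "('m + 'a) list \<Rightarrow> 'm"
    where "g l = (if hd l \<in> Inl ` carrier M then projl (hd l) else \<zero>\<^bsub>M\<^esub>)" for l
  have "x \<in> range g" if "x \<in> carrier M" for x
    using that by (intro image_eqI[of _ _ "[Inl x]"]) (auto simp: g_def)
  then have g: "range g = carrier M"
    by (auto simp: g_def)
  define \<epsilon> where "\<epsilon> = lin_ext R M g"
  have \<epsilon>: "\<epsilon> \<in> mod_hom R F M"
    unfolding \<epsilon>_def F_def using g by (intro lin_ext_hom assms) auto
  have \<epsilon>_onto: "\<epsilon> ` carrier F = carrier M"
    unfolding \<epsilon>_def F_def using g by (intro lin_ext_onto assms M.carrier_is_submodule)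
  obtain d0 where d0: "d0 \<in> mod_hom R F F" "d0 ` carrier F = a_kernel F M \<epsilon>"
    using cover[OF kernel_submodule[OF F assms \<epsilon>]] by blast
  have "\<exists>d. \<forall>n. (d n \<in> mod_hom R F F \<and> (n = 0 \<longrightarrow> d n = d0)) \<and>
      d (Suc n) ` carrier F = a_kernel F F (d n)"
    using cover[OF kernel_submodule[OF F F]] d0(1)
    by (intro dependent_nat_choice) auto
  then obtain d where d': "\<forall>n. (d n \<in> mod_hom R F F \<and> (n = 0 \<longrightarrow> d n = d0)) \<and>
      d (Suc n) ` carrier F = a_kernel F F (d n)" ..
  have d: "d n \<in> mod_hom R F F" "d (Suc n) ` carrier F = a_kernel F F (d n)" for n
    using d'[rule_format, of n] by blast+
  have "d 0 = d0"
    using d'[rule_format, of 0] by blast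
  have "free_resolution R M (\<lambda>_. UNIV :: ('m + 'a) list set) d \<epsilon>"
    using \<epsilon> \<epsilon>_onto d d0 \<open>d 0 = d0\<close>
    by (simp add: free_resolution_def Let_def flip: F_def)
  then show ?thesis by blast
qed


lemma submodule_gen_submodule:
  assumes "module R M" "S \<subseteq> carrier M"
  shows "submodule (submodule_gen R M S) R M"
proof -
  interpret M: module R M by fact
  have *: "carrier M \<in> {H. submodule H R M \<and> S \<subseteq> H}"
    using assms(2) M.carrier_is_submodule by blast
  have sub: "subgroup H (add_monoid M)" if "submodule H R M" for H
    using that by (simp add: submodule_def)
  show ?thesis
  proof (rule M.submoduleI)
    show "submodule_gen R M S \<subseteq> carrier M"
      using * by (auto simp: submodule_gen_def)
    show "\<zero>\<^bsub>M\<^esub> \<in> submodule_gen R M S"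
      using subgroup.one_closed[OF sub] by (auto simp: submodule_gen_def)
  qed (auto simp: submodule_gen_def M.submoduleE)
qed

lemma submodule_gen_least:
  "submodule H R M \<Longrightarrow> S \<subseteq> H \<Longrightarrow> submodule_gen R M S \<subseteq> H"
  by (auto simp: submodule_gen_def)

lemma submodule_gen_incl: "S \<subseteq> submodule_gen R M S"
  by (auto simp: submodule_gen_def)

context
  fixes R :: "('a, 'r) ring_scheme" and M :: "('a, 'm, 'x) module_scheme" and K
  assumes M: "module R M" and K: "submodule K R M"
begin

interpretation M: module R M by (rule M)
interpretation K: submodule K R M by (rule K)
interpretation KA: abelian_subgroup K M
  by (intro abelian_subgroupI3 additive_subgroup.intro K.subgroup_axioms M.abelian_group_axioms)

lemma quot_module_carrier:
  "carrier (quot_module M K) = (\<lambda>x. K +>\<^bsub>M\<^esub> x) ` carrier M"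
  by (auto simp: quot_module_def A_RCOSETS_def RCOSETS_def a_r_coset_def)

lemma quot_module_zero: "\<zero>\<^bsub>quot_module M K\<^esub> = K +>\<^bsub>M\<^esub> \<zero>\<^bsub>M\<^esub>"
  using K.subset by (simp add: quot_module_def)

lemma quot_module_add:
  "x \<in> carrier M \<Longrightarrow> y \<in> carrier M \<Longrightarrow>
    (K +>\<^bsub>M\<^esub> x) \<oplus>\<^bsub>quot_module M K\<^esub> (K +>\<^bsub>M\<^esub> y) = K +>\<^bsub>M\<^esub> (x \<oplus>\<^bsub>M\<^esub> y)"
  by (simp add: quot_module_def KA.a_rcos_sum)

lemma quot_module_eqI:
  assumes "x \<in> carrier M" "y \<in> carrier M" "x \<ominus>\<^bsub>M\<^esub> y \<in> K"
  shows "K +>\<^bsub>M\<^esub> x = K +>\<^bsub>M\<^esub> y"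
  using assms K.subset M.a_coset_add_inv1[of K x y] M.a_coset_join2[of "x \<ominus>\<^bsub>M\<^esub> y" K] K.subgroup_axioms
  by (simp add: a_minus_def)

lemma quot_module_mem:
  assumes "x \<in> carrier M" "y \<in> K +>\<^bsub>M\<^esub> x"
  shows "\<exists>k\<in>K. y = k \<oplus>\<^bsub>M\<^esub> x"
  using assms by (auto simp: a_r_coset_def r_coset_def)

lemma quot_module_smult:
  assumes a: "a \<in> carrier R" and x: "x \<in> carrier M"
  shows "a \<odot>\<^bsub>quot_module M K\<^esub> (K +>\<^bsub>M\<^esub> x) = K +>\<^bsub>M\<^esub> (a \<odot>\<^bsub>M\<^esub> x)"
proof -
  have "K +>\<^bsub>M\<^esub> (a \<odot>\<^bsub>M\<^esub> y) = K +>\<^bsub>M\<^esub> (a \<odot>\<^bsub>M\<^esub> x)" if y: "y \<in> K +>\<^bsub>M\<^esub> x" for y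
  proof -
    obtain k where k: "k \<in> K" "y = k \<oplus>\<^bsub>M\<^esub> x"
      using quot_module_mem[OF x y] by blast
    then have kc: "k \<in> carrier M" using K.subset by auto
    have "a \<odot>\<^bsub>M\<^esub> y \<ominus>\<^bsub>M\<^esub> a \<odot>\<^bsub>M\<^esub> x = a \<odot>\<^bsub>M\<^esub> k"
      using a x k kc by (simp add: M.smult_r_distr a_minus_def M.a_assoc M.r_neg)
    then show ?thesis
      using a x k kc K.smult_closed by (intro quot_module_eqI) auto
  qed
  moreover have "x \<in> K +>\<^bsub>M\<^esub> x"
    using x by (rule KA.a_rcos_self)
  ultimately have "(\<Union>y\<in>K +>\<^bsub>M\<^esub> x. K +>\<^bsub>M\<^esub> (a \<odot>\<^bsub>M\<^esub> y)) = K +>\<^bsub>M\<^esub> (a \<odot>\<^bsub>M\<^esub> x)"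
    by blast
  then show ?thesis
    by (simp add: quot_module_def)
qed

lemma quot_module_module: "module R (quot_module M K)"
proof -
  have cl: "K +>\<^bsub>M\<^esub> x \<in> carrier (quot_module M K)" if "x \<in> carrier M" for x
    using that by (simp add: quot_module_carrier)
  have neg: "\<exists>Y\<in>carrier (quot_module M K). Y \<oplus>\<^bsub>quot_module M K\<^esub> (K +>\<^bsub>M\<^esub> x) = \<zero>\<^bsub>quot_module M K\<^esub>"
    if "x \<in> carrier M" for x
    using that cl[of "\<ominus>\<^bsub>M\<^esub> x"]
    by (intro bexI[of _ "K +>\<^bsub>M\<^esub> (\<ominus>\<^bsub>M\<^esub> x)"]) (auto simp: quot_module_add quot_module_zero M.l_neg)
  show ?thesis
  proof (rule moduleI)
    show "abelian_group (quot_module M K)"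
    proof (rule abelian_groupI)
      fix C D E
      assume "C \<in> carrier (quot_module M K)" "D \<in> carrier (quot_module M K)"
        "E \<in> carrier (quot_module M K)"
      then obtain x y z where "x \<in> carrier M" "C = K +>\<^bsub>M\<^esub> x" "y \<in> carrier M" "D = K +>\<^bsub>M\<^esub> y"
        "z \<in> carrier M" "E = K +>\<^bsub>M\<^esub> z"
        unfolding quot_module_carrier by blast
      then show "C \<oplus>\<^bsub>quot_module M K\<^esub> D \<oplus>\<^bsub>quot_module M K\<^esub> E =
          C \<oplus>\<^bsub>quot_module M K\<^esub> (D \<oplus>\<^bsub>quot_module M K\<^esub> E)"
        by (simp add: quot_module_add M.a_assoc)
    next
      fix C D assume "C \<in> carrier (quot_module M K)" "D \<in> carrier (quot_module M K)"
      then obtain x y where "x \<in> carrier M" "C = K +>\<^bsub>M\<^esub> x" "y \<in> carrier M" "D = K +>\<^bsub>M\<^esub> y"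
        unfolding quot_module_carrier by blast
      then show "C \<oplus>\<^bsub>quot_module M K\<^esub> D \<in> carrier (quot_module M K)"
        and "C \<oplus>\<^bsub>quot_module M K\<^esub> D = D \<oplus>\<^bsub>quot_module M K\<^esub> C"
        using cl by (simp_all add: quot_module_add M.a_comm)
    next
      fix C assume "C \<in> carrier (quot_module M K)"
      then obtain x where "x \<in> carrier M" "C = K +>\<^bsub>M\<^esub> x"
        unfolding quot_module_carrier by blast
      then show "\<zero>\<^bsub>quot_module M K\<^esub> \<oplus>\<^bsub>quot_module M K\<^esub> C = C"
        and "\<exists>Y\<in>carrier (quot_module M K). Y \<oplus>\<^bsub>quot_module M K\<^esub> C = \<zero>\<^bsub>quot_module M K\<^esub>"
        using neg by (simp_all add: quot_module_add quot_module_zero del: M.a_coset_add_zero)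
    next
      show "\<zero>\<^bsub>quot_module M K\<^esub> \<in> carrier (quot_module M K)"
        unfolding quot_module_zero by (rule cl) simp
    qed
  next
    fix a b C assume ab: "a \<in> carrier R" "b \<in> carrier R" and "C \<in> carrier (quot_module M K)"
    then obtain x where "x \<in> carrier M" "C = K +>\<^bsub>M\<^esub> x"
      unfolding quot_module_carrier by blast
    with ab show "(a \<oplus>\<^bsub>R\<^esub> b) \<odot>\<^bsub>quot_module M K\<^esub> C =
        a \<odot>\<^bsub>quot_module M K\<^esub> C \<oplus>\<^bsub>quot_module M K\<^esub> b \<odot>\<^bsub>quot_module M K\<^esub> C"
      and "a \<otimes>\<^bsub>R\<^esub> b \<odot>\<^bsub>quot_module M K\<^esub> C = a \<odot>\<^bsub>quot_module M K\<^esub> (b \<odot>\<^bsub>quot_module M K\<^esub> C)"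
      by (simp_all add: quot_module_add quot_module_smult M.smult_l_distr M.smult_assoc1)
  next
    fix a C D assume a: "a \<in> carrier R" and "C \<in> carrier (quot_module M K)" "D \<in> carrier (quot_module M K)"
    then obtain x y where "x \<in> carrier M" "C = K +>\<^bsub>M\<^esub> x" "y \<in> carrier M" "D = K +>\<^bsub>M\<^esub> y"
      unfolding quot_module_carrier by blast
    with a show "a \<odot>\<^bsub>quot_module M K\<^esub> (C \<oplus>\<^bsub>quot_module M K\<^esub> D) =
        a \<odot>\<^bsub>quot_module M K\<^esub> C \<oplus>\<^bsub>quot_module M K\<^esub> a \<odot>\<^bsub>quot_module M K\<^esub> D"
      by (simp add: quot_module_add quot_module_smult M.smult_r_distr)
  next
    fix a C assume a: "a \<in> carrier R" and "C \<in> carrier (quot_module M K)"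
    then obtain x where "x \<in> carrier M" "C = K +>\<^bsub>M\<^esub> x"
      unfolding quot_module_carrier by blast
    with a cl show "a \<odot>\<^bsub>quot_module M K\<^esub> C \<in> carrier (quot_module M K)"
      by (simp add: quot_module_smult)
  next
    fix C assume "C \<in> carrier (quot_module M K)"
    then obtain x where "x \<in> carrier M" "C = K +>\<^bsub>M\<^esub> x"
      unfolding quot_module_carrier by blast
    then show "\<one>\<^bsub>R\<^esub> \<odot>\<^bsub>quot_module M K\<^esub> C = C"
      by (simp add: quot_module_smult)
  qed (rule M.R.cring_axioms)
qed

lemma quot_module_hom_exists:
  assumes N: "module R N" and \<phi>: "\<phi> \<in> mod_hom R M N" "K \<subseteq> a_kernel M N \<phi>"
  shows "\<exists>h. h \<in> mod_hom R (quot_module M K) N \<and> (\<forall>x\<in>carrier M. h (K +>\<^bsub>M\<^esub> x) = \<phi> x)"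
proof -
  interpret N: module R N by fact
  define h where "h C = \<phi> (SOME x. x \<in> C)" for C
  have h: "h (K +>\<^bsub>M\<^esub> x) = \<phi> x" if x: "x \<in> carrier M" for x
  proof -
    have "(SOME y. y \<in> K +>\<^bsub>M\<^esub> x) \<in> K +>\<^bsub>M\<^esub> x"
      using KA.a_rcos_self[OF x] by (rule someI)
    from quot_module_mem[OF x this] obtain k
      where k: "k \<in> K" "(SOME y. y \<in> K +>\<^bsub>M\<^esub> x) = k \<oplus>\<^bsub>M\<^esub> x" by blast
    then have "k \<in> carrier M" "\<phi> k = \<zero>\<^bsub>N\<^esub>"
      using \<phi>(2) by (auto simp: a_kernel_def kernel_def)
    then show ?thesis
      using k x mod_hom_add[OF \<phi>(1)] mod_hom_closed[OF \<phi>(1)] by (simp add: h_def)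
  qed
  have "h \<in> mod_hom R (quot_module M K) N"
    using mod_hom_closed[OF \<phi>(1)] mod_hom_add[OF \<phi>(1)] mod_hom_smult[OF \<phi>(1)]
    by (auto simp: mod_hom_def quot_module_carrier quot_module_add quot_module_smult h)
  with h show ?thesis by blast
qed

end

lemma tensor_rels_closed:
  assumes "module R M" "module R N"
  shows "tensor_rels R M N \<subseteq> carrier (free_module R (carrier M \<times> carrier N))"
proof -
  interpret M: module R M by fact
  interpret N: module R N by fact
  interpret F: module R "free_module R (carrier M \<times> carrier N)"
    by (rule M.free_module_module)
  show ?thesis
    by (auto simp: tensor_rels_def Let_def intro!: F.minus_closed M.free_basis_closed)
qed

lemma tensor_kernel_submodule:
  assumes "module R M" "module R N"
  shows "submodule (tensor_kernel R M N) R (free_module R (carrier M \<times> carrier N))"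
proof -
  interpret M: module R M by fact
  show ?thesis
    unfolding tensor_kernel_def
    by (intro submodule_gen_submodule M.free_module_module tensor_rels_closed assms)
qed

lemma tensor_module:
  assumes "module R M" "module R N"
  shows "module R (tensor R M N)"
proof -
  interpret M: module R M by fact
  show ?thesis
    unfolding tensor_def
    by (intro quot_module_module M.free_module_module tensor_kernel_submodule assms)
qed

lemma pure_tensor_closed:
  assumes "module R M" "module R N" "x \<in> carrier M" "y \<in> carrier N"
  shows "pure_tensor R M N x y \<in> carrier (tensor R M N)"
proof -
  interpret M: module R M by fact
  show ?thesis
    unfolding tensor_def pure_tensor_def
      quot_module_carrier[OF M.free_module_module tensor_kernel_submodule[OF assms(1,2)]]
    using assms(3,4) by (intro imageI M.free_basis_closed) auto
qed

lemma pure_tensor_bilinear: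
  assumes "module R M" "module R N"
  shows "\<lbrakk>x \<in> carrier M; x' \<in> carrier M; y \<in> carrier N\<rbrakk> \<Longrightarrow>
      pure_tensor R M N (x \<oplus>\<^bsub>M\<^esub> x') y =
        pure_tensor R M N x y \<oplus>\<^bsub>tensor R M N\<^esub> pure_tensor R M N x' y"
    and "\<lbrakk>x \<in> carrier M; y \<in> carrier N; y' \<in> carrier N\<rbrakk> \<Longrightarrow>
      pure_tensor R M N x (y \<oplus>\<^bsub>N\<^esub> y') =
        pure_tensor R M N x y \<oplus>\<^bsub>tensor R M N\<^esub> pure_tensor R M N x y'"
    and "\<lbrakk>a \<in> carrier R; x \<in> carrier M; y \<in> carrier N\<rbrakk> \<Longrightarrow>
      pure_tensor R M N (a \<odot>\<^bsub>M\<^esub> x) y = a \<odot>\<^bsub>tensor R M N\<^esub> pure_tensor R M N x y"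
    and "\<lbrakk>a \<in> carrier R; x \<in> carrier M; y \<in> carrier N\<rbrakk> \<Longrightarrow>
      pure_tensor R M N x (a \<odot>\<^bsub>N\<^esub> y) = a \<odot>\<^bsub>tensor R M N\<^esub> pure_tensor R M N x y"
proof -
  interpret M: module R M by fact
  interpret N: module R N by fact
  let ?F = "free_module R (carrier M \<times> carrier N)"
  interpret F: module R ?F by (rule M.free_module_module)
  note K = tensor_kernel_submodule[OF assms]
  note b = M.free_basis_closed
  have eq: "u \<in> carrier ?F \<Longrightarrow> v \<in> carrier ?F \<Longrightarrow> u \<ominus>\<^bsub>?F\<^esub> v \<in> tensor_rels R M N \<Longrightarrow>
      tensor_kernel R M N +>\<^bsub>?F\<^esub> u = tensor_kernel R M N +>\<^bsub>?F\<^esub> v" for u v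
    by (rule quot_module_eqI[OF F.module_axioms K])
      (unfold tensor_kernel_def, assumption+, rule submodule_gen_incl[THEN subsetD])
  have c: "free_basis R (x, y) \<in> carrier ?F" if "x \<in> carrier M" "y \<in> carrier N" for x y
    using that by (intro b SigmaI)
  have add: "pure_tensor R M N x y \<oplus>\<^bsub>tensor R M N\<^esub> pure_tensor R M N x' y' =
      tensor_kernel R M N +>\<^bsub>?F\<^esub> (free_basis R (x, y) \<oplus>\<^bsub>?F\<^esub> free_basis R (x', y'))"
    if "x \<in> carrier M" "x' \<in> carrier M" "y \<in> carrier N" "y' \<in> carrier N" for x x' y y'
    unfolding pure_tensor_def tensor_def
    by (rule quot_module_add[OF F.module_axioms K c c]) (rule that)+
  have smult: "a \<odot>\<^bsub>tensor R M N\<^esub> pure_tensor R M N x y =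
      tensor_kernel R M N +>\<^bsub>?F\<^esub> (a \<odot>\<^bsub>?F\<^esub> free_basis R (x, y))"
    if "a \<in> carrier R" "x \<in> carrier M" "y \<in> carrier N" for a x y
    unfolding pure_tensor_def tensor_def
    by (rule quot_module_smult[OF F.module_axioms K that(1) c]) (rule that)+
  show "pure_tensor R M N (x \<oplus>\<^bsub>M\<^esub> x') y =
        pure_tensor R M N x y \<oplus>\<^bsub>tensor R M N\<^esub> pure_tensor R M N x' y"
    if that: "x \<in> carrier M" "x' \<in> carrier M" "y \<in> carrier N"
    unfolding add[OF that(1,2,3,3)] unfolding pure_tensor_def
  proof (rule eq)
    show "free_basis R (x \<oplus>\<^bsub>M\<^esub> x', y) \<ominus>\<^bsub>?F\<^esub> (free_basis R (x, y) \<oplus>\<^bsub>?F\<^esub> free_basis R (x', y))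
        \<in> tensor_rels R M N"
      unfolding tensor_rels_def Let_def using that by blast
  qed (intro c F.M.a_closed M.a_closed that)+
  show "pure_tensor R M N x (y \<oplus>\<^bsub>N\<^esub> y') =
        pure_tensor R M N x y \<oplus>\<^bsub>tensor R M N\<^esub> pure_tensor R M N x y'"
    if that: "x \<in> carrier M" "y \<in> carrier N" "y' \<in> carrier N"
    unfolding add[OF that(1,1,2,3)] unfolding pure_tensor_def
  proof (rule eq)
    show "free_basis R (x, y \<oplus>\<^bsub>N\<^esub> y') \<ominus>\<^bsub>?F\<^esub> (free_basis R (x, y) \<oplus>\<^bsub>?F\<^esub> free_basis R (x, y'))
        \<in> tensor_rels R M N"
      unfolding tensor_rels_def Let_def using that by blast
  qed (intro c F.M.a_closed N.a_closed that)+
  show "pure_tensor R M N (a \<odot>\<^bsub>M\<^esub> x) y = a \<odot>\<^bsub>tensor R M N\<^esub> pure_tensor R M N x y"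
    if that: "a \<in> carrier R" "x \<in> carrier M" "y \<in> carrier N"
    unfolding smult[OF that] unfolding pure_tensor_def
  proof (rule eq)
    show "free_basis R (a \<odot>\<^bsub>M\<^esub> x, y) \<ominus>\<^bsub>?F\<^esub> (a \<odot>\<^bsub>?F\<^esub> free_basis R (x, y)) \<in> tensor_rels R M N"
      unfolding tensor_rels_def Let_def using that by blast
  qed (intro c F.smult_closed M.smult_closed that)+
  show "pure_tensor R M N x (a \<odot>\<^bsub>N\<^esub> y) = a \<odot>\<^bsub>tensor R M N\<^esub> pure_tensor R M N x y"
    if that: "a \<in> carrier R" "x \<in> carrier M" "y \<in> carrier N"
    unfolding smult[OF that] unfolding pure_tensor_def
  proof (rule eq)
    show "free_basis R (x, a \<odot>\<^bsub>N\<^esub> y) \<ominus>\<^bsub>?F\<^esub> (a \<odot>\<^bsub>?F\<^esub> free_basis R (x, y)) \<in> tensor_rels R M N"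
      unfolding tensor_rels_def Let_def using that by blast
  qed (intro c F.smult_closed N.smult_closed that)+
qed

lemma tensor_lift_exists:
  assumes M: "module R M" and N: "module R N" and P: "module R P"
    and \<beta>: "\<And>x y. x \<in> carrier M \<Longrightarrow> y \<in> carrier N \<Longrightarrow> \<beta> x y \<in> carrier P"
    and add1: "\<And>x x' y. \<lbrakk>x \<in> carrier M; x' \<in> carrier M; y \<in> carrier N\<rbrakk> \<Longrightarrow>
      \<beta> (x \<oplus>\<^bsub>M\<^esub> x') y = \<beta> x y \<oplus>\<^bsub>P\<^esub> \<beta> x' y"
    and add2: "\<And>x y y'. \<lbrakk>x \<in> carrier M; y \<in> carrier N; y' \<in> carrier N\<rbrakk> \<Longrightarrow>
      \<beta> x (y \<oplus>\<^bsub>N\<^esub> y') = \<beta> x y \<oplus>\<^bsub>P\<^esub> \<beta> x y'"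
    and smult1: "\<And>a x y. \<lbrakk>a \<in> carrier R; x \<in> carrier M; y \<in> carrier N\<rbrakk> \<Longrightarrow>
      \<beta> (a \<odot>\<^bsub>M\<^esub> x) y = a \<odot>\<^bsub>P\<^esub> \<beta> x y"
    and smult2: "\<And>a x y. \<lbrakk>a \<in> carrier R; x \<in> carrier M; y \<in> carrier N\<rbrakk> \<Longrightarrow>
      \<beta> x (a \<odot>\<^bsub>N\<^esub> y) = a \<odot>\<^bsub>P\<^esub> \<beta> x y"
  shows "\<exists>h. h \<in> mod_hom R (tensor R M N) P \<and>
    (\<forall>x\<in>carrier M. \<forall>y\<in>carrier N. h (pure_tensor R M N x y) = \<beta> x y)"
proof -
  interpret M: module R M by fact
  interpret N: module R N by fact
  interpret P: module R P by fact
  let ?F = "free_module R (carrier M \<times> carrier N)"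
  interpret F: module R ?F by (rule M.free_module_module)
  define \<phi> where "\<phi> = lin_ext R P (\<lambda>(x, y). \<beta> x y)"
  have g: "(\<lambda>(x, y). \<beta> x y) \<in> carrier M \<times> carrier N \<rightarrow> carrier P"
    using \<beta> by auto
  have \<phi>: "\<phi> \<in> mod_hom R ?F P"
    unfolding \<phi>_def by (rule lin_ext_hom[OF P g])
  have \<phi>b: "\<phi> (free_basis R (x, y)) = \<beta> x y" if "x \<in> carrier M" "y \<in> carrier N" for x y
    unfolding \<phi>_def using lin_ext_basis[OF P g, of "(x, y)"] that by simp
  have minus: "\<phi> (u \<ominus>\<^bsub>?F\<^esub> v) = \<zero>\<^bsub>P\<^esub>" if "u \<in> carrier ?F" "v \<in> carrier ?F" "\<phi> u = \<phi> v" for u v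
    using that mod_hom_closed[OF \<phi>, of v]
    by (simp add: a_minus_def mod_hom_add[OF \<phi>] mod_hom_minus[OF F.module_axioms P \<phi>] P.r_neg)
  note b = M.free_basis_closed
  have "tensor_rels R M N \<subseteq> a_kernel ?F P \<phi>"
    unfolding tensor_rels_def Let_def a_kernel_def kernel_def
    by (auto intro!: F.minus_closed minus b
      simp: b \<phi>b mod_hom_add[OF \<phi>] mod_hom_smult[OF \<phi>] add1 add2 smult1 smult2)
  then have "tensor_kernel R M N \<subseteq> a_kernel ?F P \<phi>"
    unfolding tensor_kernel_def
    by (intro submodule_gen_least kernel_submodule[OF F.module_axioms P \<phi>])
  from quot_module_hom_exists[OF F.module_axioms tensor_kernel_submodule[OF M N] P \<phi> this]
  obtain h where h: "h \<in> mod_hom R (tensor R M N) P"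
    "\<And>u. u \<in> carrier ?F \<Longrightarrow> h (tensor_kernel R M N +>\<^bsub>?F\<^esub> u) = \<phi> u"
    by (auto simp: tensor_def)
  then show ?thesis
    by (intro exI[of _ h]) (auto simp: pure_tensor_def b \<phi>b)
qed

lemma tensor_map:
  assumes M: "module R M" and M': "module R M'" and N: "module R N" and f: "f \<in> mod_hom R M M'"
  shows "tensor_map R M M' N f \<in> mod_hom R (tensor R M N) (tensor R M' N)"
    and "\<lbrakk>x \<in> carrier M; y \<in> carrier N\<rbrakk> \<Longrightarrow>
      tensor_map R M M' N f (pure_tensor R M N x y) = pure_tensor R M' N (f x) y"
proof -
  have "\<exists>h. h \<in> mod_hom R (tensor R M N) (tensor R M' N) \<and>
      (\<forall>x\<in>carrier M. \<forall>y\<in>carrier N. h (pure_tensor R M N x y) = pure_tensor R M' N (f x) y)"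
    using mod_hom_closed[OF f] mod_hom_add[OF f] mod_hom_smult[OF f]
    by (intro tensor_lift_exists M N tensor_module M')
      (auto simp: pure_tensor_closed[OF M' N] pure_tensor_bilinear[OF M' N])
  from someI_ex[OF this]
  show "tensor_map R M M' N f \<in> mod_hom R (tensor R M N) (tensor R M' N)"
    and "\<lbrakk>x \<in> carrier M; y \<in> carrier N\<rbrakk> \<Longrightarrow>
      tensor_map R M M' N f (pure_tensor R M N x y) = pure_tensor R M' N (f x) y"
    by (auto simp: tensor_map_def)
qed

end

theory Submission
  imports Defs
begin

text \<open>
  The grading makes \<open>R\<close> a finite-dimensional algebra over \<open>k = R\<^sub>0\<close>; write \<open>h\<^sub>j = dim R\<^sub>j\<close>,
  \<open>p = dim \<mm>N\<close> and \<open>q = dim N/\<mm>N > 0\<close>, and let \<open>F\<close> be a minimal free resolution of \<open>M\<close> with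
  ranks \<open>g\<^sub>i\<close> and syzygies \<open>K\<^sub>i \<subseteq> \<mm>F\<^sub>i\<^sub>-\<^sub>1\<close>. Since \<open>\<mm>\<^sup>2N = 0\<close>, the differentials of \<open>F \<otimes> N\<close> kill
  \<open>\<mm>(F\<^sub>i \<otimes> N)\<close> and take values in \<open>\<mm>(F\<^sub>i\<^sub>-\<^sub>1 \<otimes> N)\<close>, so exactness in positive degrees gives
  \<open>g\<^sub>1q \<le> g\<^sub>0p\<close>, \<open>g\<^sub>1p \<le> g\<^sub>2q\<close> and \<open>g\<^sub>3q \<le> g\<^sub>2p\<close>. Moreover, if \<open>x = \<Sum>r\<^sub>bv\<^sub>b \<in> K\<^sub>i\<close> has all coordinates
  in \<open>\<mm>\<^sup>2\<close>, then \<open>(r\<^sub>bn)\<^sub>b\<close> is a cycle for every \<open>n \<in> N\<close>, which forces \<open>r\<^sub>b \<in> \<mm>\<close>: thus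
  \<open>K\<^sub>i \<inter> \<mm>\<^sup>2F\<^sub>i\<^sub>-\<^sub>1 \<subseteq> \<mm>K\<^sub>i\<close>. As \<open>\<mm>\<^sup>2F\<^sub>0 \<subseteq> K\<^sub>1\<close>, the syzygies are graded, and by
  Nakayama the linear parts of minimal generators generate again. Counting dimensions in the linear
  strands of degrees two and three yields \<open>g\<^sub>2 = g\<^sub>1h\<^sub>1 - g\<^sub>0h\<^sub>2\<close> and
  \<open>g\<^sub>0h\<^sub>3 \<le> g\<^sub>1h\<^sub>2 - g\<^sub>2h\<^sub>1 + g\<^sub>3\<close>. Hence
  \<open>g\<^sub>0h\<^sub>3q \<le> (g\<^sub>1q - g\<^sub>0p)h\<^sub>2 + (g\<^sub>1p - g\<^sub>2q)h\<^sub>1 \<le> 0\<close>, so \<open>R\<^sub>3 = 0\<close>.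
\<close>

section \<open>Dimension of subspaces\<close>

text \<open>\<open>M\<close> and \<open>N\<close> carry no grading. With all basis elements placed
  in degree zero, the first syzygy module is closed under linear parts because it contains
  everything of order two; once its generators are linear forms, the next one is graded outright.
  \<open>Tor\<close> comes from an unspecified resolution with bases of lists, while the counts need
  finite minimal matrices: the comparison theorem moves acyclicity to any other resolution, and a
  finite stretch of chosen syzygies is completed to a resolution by arbitrary finite generators. The
  Artinian condition enters through strictly descending chains of subspaces of some
  \<open>R\<^sub>j\<close>, which become chains of ideals after adding all higher degrees.
  Degree-wise nilpotence takes the place of Nakayama. The final combination weights the strand
  identities by \<open>p\<close> and \<open>q\<close>, for which the rank inequalities absorb every
  term except \<open>g\<^sub>0h\<^sub>3q\<close>. Passing from \<open>R\<^sub>3 = 0\<close> to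
  \<open>\<mm>\<^sup>3 = 0\<close> uses generation in degree one, through annihilators.\<close>

lemma (in module) submodule_zero: "submodule H R M \<Longrightarrow> \<zero>\<^bsub>M\<^esub> \<in> H"
  using submodule.axioms(1) subgroup.one_closed by force

lemma (in module) submodule_diff:
  "submodule H R M \<Longrightarrow> x \<in> H \<Longrightarrow> y \<in> H \<Longrightarrow> x \<ominus>\<^bsub>M\<^esub> y \<in> H"
  by (simp add: a_minus_def submoduleE(3,5))

lemma (in module) smult_r_diff:
  "a \<in> carrier R \<Longrightarrow> x \<in> carrier M \<Longrightarrow> y \<in> carrier M \<Longrightarrow>
    a \<odot>\<^bsub>M\<^esub> (x \<ominus>\<^bsub>M\<^esub> y) = a \<odot>\<^bsub>M\<^esub> x \<ominus>\<^bsub>M\<^esub> a \<odot>\<^bsub>M\<^esub> y"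
  by (simp add: a_minus_def smult_r_distr smult_r_minus)

lemma mod_hom_diff:
  assumes "module R M" "module R N" "h \<in> mod_hom R M N" "x \<in> carrier M" "y \<in> carrier M"
  shows "h (x \<ominus>\<^bsub>M\<^esub> y) = h x \<ominus>\<^bsub>N\<^esub> h y"
proof -
  interpret M: module R M by fact
  show ?thesis
    using assms(4,5) by (simp add: a_minus_def mod_hom_add[OF assms(3)] mod_hom_minus[OF assms(1-3)])
qed

lemma image_submodule:
  assumes "module R M" "module R N" "h \<in> mod_hom R M N" "submodule A R M"
  shows "submodule (h ` A) R N"
proof -
  interpret M: module R M by fact
  interpret N: module R N by fact
  note A = M.submoduleE[OF assms(4)]
  have c: "x \<in> carrier M" if "x \<in> A" for x
    using A(1) that by blast
  show ?thesis
  proof (rule N.submoduleI)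
    show "h ` A \<subseteq> carrier N"
      using c mod_hom_closed[OF assms(3)] by auto
    show "\<zero>\<^bsub>N\<^esub> \<in> h ` A"
      using M.submodule_zero[OF assms(4)] mod_hom_zero[OF assms(1-3)] by (metis imageI)
    show "\<ominus>\<^bsub>N\<^esub> a \<in> h ` A" if a: "a \<in> h ` A" for a
      using a A(3) c by (auto simp: mod_hom_minus[OF assms(1-3), symmetric])
    show "a \<oplus>\<^bsub>N\<^esub> b \<in> h ` A" if "a \<in> h ` A" "b \<in> h ` A" for a b
      using that A(5) c by (auto simp: mod_hom_add[OF assms(3), symmetric])
    show "a \<odot>\<^bsub>N\<^esub> b \<in> h ` A" if "a \<in> carrier R" "b \<in> h ` A" for a b
      using that A(4) c by (auto simp: mod_hom_smult[OF assms(3), symmetric])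
  qed
qed

lemma preimage_submodule:
  assumes "module R M" "module R N" "h \<in> mod_hom R M N" "submodule A R M" "submodule C R N"
  shows "submodule {x \<in> A. h x \<in> C} R M"
proof -
  interpret M: module R M by fact
  interpret N: module R N by fact
  note A = M.submoduleE[OF assms(4)] and C = N.submoduleE[OF assms(5)]
  have c: "x \<in> carrier M" if "x \<in> A" for x
    using A(1) that by blast
  show ?thesis
    using A C c M.submodule_zero[OF assms(4)] N.submodule_zero[OF assms(5)]
    by (intro M.submoduleI)
      (auto simp: mod_hom_zero[OF assms(1-3)] mod_hom_minus[OF assms(1-3)]
        mod_hom_add[OF assms(3)] mod_hom_smult[OF assms(3)])
qed

lemma zero_submodule:
  assumes "module R M"
  shows "submodule {\<zero>\<^bsub>M\<^esub>} R M"
proof -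
  interpret M: module R M by fact
  show ?thesis by (rule M.submoduleI) auto
qed

lemma ker_submodule:
  assumes "module R M" "module R N" "h \<in> mod_hom R M N" "submodule A R M"
  shows "submodule {x \<in> A. h x = \<zero>\<^bsub>N\<^esub>} R M"
  using preimage_submodule[OF assms zero_submodule[OF assms(2)]] by simp

lemma Int_submodule:
  assumes "module R M" "submodule A R M" "submodule B R M"
  shows "submodule (A \<inter> B) R M"
proof -
  interpret M: module R M by fact
  show ?thesis
    using M.submoduleE[OF assms(2)] M.submoduleE[OF assms(3)]
      M.submodule_zero[OF assms(2)] M.submodule_zero[OF assms(3)]
    by (intro M.submoduleI) auto
qed

text \<open>This is \<open>A + Kv\<close>, described by \<open>x - cv\<close> lying in
  \<open>A\<close>: a linear map applied to this difference tells directly how kernels, images and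
  preimages of the sum grow.\<close>

definition adjoin ::
    "('a, 'r) ring_scheme \<Rightarrow> ('a, 'm, 'x) module_scheme \<Rightarrow> 'm set \<Rightarrow> 'm \<Rightarrow> 'm set" where
  "adjoin K V A v = {x \<in> carrier V. \<exists>c\<in>carrier K. x \<ominus>\<^bsub>V\<^esub> c \<odot>\<^bsub>V\<^esub> v \<in> A}"

context
  fixes K :: "('a, 'r) ring_scheme" and V :: "('a, 'm, 'x) module_scheme" (structure)
  assumes V: "module K V"
begin

interpretation V: module K V by (rule V)

lemma module_minus_zero: "\<ominus> \<zero> = \<zero>"
  by (rule V.minus_equality) simp_all

lemma adjoin_submodule:
  assumes A: "submodule A K V" and v: "v \<in> carrier V"
  shows "submodule (adjoin K V A v) K V"
proof -
  note AE = V.submoduleE[OF A]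
  have c: "x \<in> carrier V" if "x \<in> A" for x
    using AE(1) that by blast
  show ?thesis
  proof (rule V.submoduleI)
    show "adjoin K V A v \<subseteq> carrier V"
      by (auto simp: adjoin_def)
    show "\<zero> \<in> adjoin K V A v"
      using v V.submodule_zero[OF A] by (auto simp: adjoin_def a_minus_def module_minus_zero intro!: bexI[of _ "\<zero>\<^bsub>K\<^esub>"])
  next
    fix x assume "x \<in> adjoin K V A v"
    then obtain d where d: "x \<in> carrier V" "d \<in> carrier K" "x \<ominus> d \<odot> v \<in> A"
      by (auto simp: adjoin_def)
    have "\<ominus> x \<ominus> (\<ominus>\<^bsub>K\<^esub> d) \<odot> v = \<ominus> (x \<ominus> d \<odot> v)"
      using d v by (simp add: V.smult_l_minus a_minus_def V.minus_add)
    then show "\<ominus> x \<in> adjoin K V A v"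
      using d AE(3) by (auto simp: adjoin_def intro!: bexI[of _ "\<ominus>\<^bsub>K\<^esub> d"])
  next
    fix x y assume "x \<in> adjoin K V A v" "y \<in> adjoin K V A v"
    then obtain d e where d: "x \<in> carrier V" "d \<in> carrier K" "x \<ominus> d \<odot> v \<in> A"
      and e: "y \<in> carrier V" "e \<in> carrier K" "y \<ominus> e \<odot> v \<in> A"
      by (auto simp: adjoin_def)
    have "x \<oplus> y \<ominus> (d \<oplus>\<^bsub>K\<^esub> e) \<odot> v = (x \<ominus> d \<odot> v) \<oplus> (y \<ominus> e \<odot> v)"
      using d e v by (simp add: V.smult_l_distr a_minus_def V.minus_add V.a_ac)
    then show "x \<oplus> y \<in> adjoin K V A v"
      using d e AE(5) by (auto simp: adjoin_def intro!: bexI[of _ "d \<oplus>\<^bsub>K\<^esub> e"])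
  next
    fix a x assume a: "a \<in> carrier K" and "x \<in> adjoin K V A v"
    then obtain d where d: "x \<in> carrier V" "d \<in> carrier K" "x \<ominus> d \<odot> v \<in> A"
      by (auto simp: adjoin_def)
    have "a \<odot> x \<ominus> (a \<otimes>\<^bsub>K\<^esub> d) \<odot> v = a \<odot> (x \<ominus> d \<odot> v)"
      using d v a by (simp add: V.smult_r_diff V.smult_assoc1)
    then show "a \<odot> x \<in> adjoin K V A v"
      using d a AE(4) by (auto simp: adjoin_def intro!: bexI[of _ "a \<otimes>\<^bsub>K\<^esub> d"])
  qed
qed

lemma adjoin_supset: "submodule A K V \<Longrightarrow> v \<in> carrier V \<Longrightarrow> A \<subseteq> adjoin K V A v"
  using V.submoduleE(1)[of A]
  by (auto simp: adjoin_def a_minus_def module_minus_zero intro!: bexI[of _ "\<zero>\<^bsub>K\<^esub>"])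

lemma adjoin_self: "submodule A K V \<Longrightarrow> v \<in> carrier V \<Longrightarrow> v \<in> adjoin K V A v"
  using V.submodule_zero[of A]
  by (auto simp: adjoin_def a_minus_def V.r_neg intro!: bexI[of _ "\<one>\<^bsub>K\<^esub>"])

lemma adjoin_least:
  assumes H: "submodule H K V" and "A \<subseteq> H" and v: "v \<in> H"
  shows "adjoin K V A v \<subseteq> H"
proof
  note HE = V.submoduleE[OF H]
  fix x assume "x \<in> adjoin K V A v"
  then obtain c where c: "x \<in> carrier V" "c \<in> carrier K" "x \<ominus> c \<odot> v \<in> A"
    by (auto simp: adjoin_def)
  have "v \<in> carrier V" using HE(1) v by blast
  then have "x = (x \<ominus> c \<odot> v) \<oplus> c \<odot> v"
    using c by (simp add: a_minus_def V.a_assoc V.l_neg)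
  then show "x \<in> H"
    using c assms(2) HE(4)[OF c(2) v] HE(5) by (metis subsetD)
qed

end

text \<open>Dimension as the length of a chain from zero in which each step adjoins one vector
  outside the previous subspace. No basis has to be carried along, and rank-nullity becomes an
  induction over the chain. That the length depends on \<open>A\<close> alone is
  \<open>sdim_unique\<close>.\<close>

inductive sdim ::
    "('a, 'r) ring_scheme \<Rightarrow> ('a, 'm, 'x) module_scheme \<Rightarrow> 'm set \<Rightarrow> nat \<Rightarrow> bool"
  for K V where
  zero: "sdim K V {\<zero>\<^bsub>V\<^esub>} 0"
| step: "sdim K V A n \<Longrightarrow> v \<in> carrier V \<Longrightarrow> v \<notin> A \<Longrightarrow> sdim K V (adjoin K V A v) (Suc n)"

lemma sdim_submodule: "module K V \<Longrightarrow> sdim K V A n \<Longrightarrow> submodule A K V"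
  by (rotate_tac, induction rule: sdim.induct) (auto intro: zero_submodule adjoin_submodule)

text \<open>Each adjoined \<open>v\<close> lengthens either the kernel chain or the image chain. If
  \<open>f v\<close> already lies in the image of \<open>A\<close>, an element of \<open>A\<close>
  corrects \<open>v\<close> to a kernel vector; otherwise the image grows and the kernel
  stays.\<close>

lemma sdim_rank_nullity:
  fixes V (structure)
  assumes "field K" "module K V" "module K W" "f \<in> mod_hom K V W" "sdim K V A n"
  shows "\<exists>a c. sdim K V {x \<in> A. f x = \<zero>\<^bsub>W\<^esub>} a \<and> sdim K W (f ` A) c \<and> a + c = n"
  using assms(5)
proof (induction rule: sdim.induct)
  case zero
  have "{x \<in> {\<zero>}. f x = \<zero>\<^bsub>W\<^esub>} = {\<zero>}" "f ` {\<zero>} = {\<zero>\<^bsub>W\<^esub>}"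
    using mod_hom_zero[OF assms(2-4)] by auto
  then show ?case by (auto intro: sdim.zero)
next
  case (step A n v)
  interpret K: field K by fact
  interpret V: module K V by fact
  interpret W: module K W by fact
  note f = mod_hom_closed[OF assms(4)] mod_hom_add[OF assms(4)] mod_hom_smult[OF assms(4)]
    mod_hom_diff[OF assms(2-4)]
  have A: "submodule A K V"
    using sdim_submodule[OF assms(2) step.hyps(1)] .
  note AE = V.submoduleE[OF A]
  have c: "x \<in> carrier V" if "x \<in> A" for x
    using AE(1) that by blast
  have fA: "submodule (f ` A) K W"
    by (rule image_submodule[OF assms(2-4) A])
  obtain a d where ad: "sdim K V {x \<in> A. f x = \<zero>\<^bsub>W\<^esub>} a" "sdim K W (f ` A) d" "a + d = n"
    using step.IH by blast
  have v: "v \<in> carrier V" by fact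
  show ?case
  proof (cases "f v \<in> f ` A")
    case True
    then obtain u where u: "u \<in> A" "f v = f u" by auto
    have uc: "u \<in> carrier V" using c u by blast
    \<comment> \<open>Modulo \<open>A\<close> this is the same vector, so it adjoins the same
      subspace, but it lies in the kernel.\<close>
    define w where "w = v \<ominus> u"
    have wc: "w \<in> carrier V" using uc v by (simp add: w_def)
    have vw: "v = w \<oplus> u" using uc v by (simp add: w_def a_minus_def V.a_assoc V.l_neg)
    have wA: "w \<notin> A" using AE(5)[OF _ u(1)] vw step.hyps(3) by metis
    have fw: "f w = \<zero>\<^bsub>W\<^esub>"
      unfolding w_def using uc v u(2) f by (simp add: W.r_neg a_minus_def)
    have eq: "adjoin K V A v = adjoin K V A w"
    proof (rule equalityI)
      note sub = adjoin_submodule[OF assms(2) A] adjoin_supset[OF assms(2) A] adjoin_self[OF assms(2) A]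
      have "v \<in> adjoin K V A w"
        unfolding vw using sub[OF wc] u(1) by (intro V.submoduleE(5)[OF sub(1)[OF wc]]) auto
      then show "adjoin K V A v \<subseteq> adjoin K V A w"
        by (intro adjoin_least[OF assms(2) sub(1,2)[OF wc]])
      have "w \<in> adjoin K V A v"
        unfolding w_def using sub[OF v] u(1) by (intro V.submodule_diff[OF sub(1)[OF v]]) auto
      then show "adjoin K V A w \<subseteq> adjoin K V A v"
        by (intro adjoin_least[OF assms(2) sub(1,2)[OF v]])
    qed
    have fe: "f (x \<ominus> e \<odot> w) = f x" if "x \<in> carrier V" "e \<in> carrier K" for x e
      using that wc f fw by (simp add: a_minus_def module_minus_zero[OF assms(3)])
    have im: "f ` adjoin K V A v = f ` A"
    proof
      show "f ` A \<subseteq> f ` adjoin K V A v"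
        using adjoin_supset[OF assms(2) A v] by auto
      show "f ` adjoin K V A v \<subseteq> f ` A"
        unfolding eq using fe by (auto simp: adjoin_def) (metis imageI)
    qed
    have ker: "{x \<in> adjoin K V A v. f x = \<zero>\<^bsub>W\<^esub>} = adjoin K V {x \<in> A. f x = \<zero>\<^bsub>W\<^esub>} w"
      unfolding eq using fe by (auto simp: adjoin_def)
    have "sdim K V (adjoin K V {x \<in> A. f x = \<zero>\<^bsub>W\<^esub>} w) (Suc a)"
      using ad(1) wc wA by (intro sdim.step) auto
    then show ?thesis
      using ad unfolding ker im by (metis add_Suc)
  next
    case False
    have im: "f ` adjoin K V A v = adjoin K W (f ` A) (f v)"
    proof (intro equalityI subsetI)
      fix y assume "y \<in> f ` adjoin K V A v"
      then obtain x e where x: "y = f x" "x \<in> carrier V" "e \<in> carrier K" "x \<ominus> e \<odot> v \<in> A"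
        by (auto simp: adjoin_def)
      have "y \<ominus>\<^bsub>W\<^esub> e \<odot>\<^bsub>W\<^esub> f v = f (x \<ominus> e \<odot> v)"
        using x v f by simp
      then show "y \<in> adjoin K W (f ` A) (f v)"
        using x f by (auto simp: adjoin_def)
    next
      fix y assume "y \<in> adjoin K W (f ` A) (f v)"
      then obtain e x where x: "y \<in> carrier W" "e \<in> carrier K" "y \<ominus>\<^bsub>W\<^esub> e \<odot>\<^bsub>W\<^esub> f v = f x" "x \<in> A"
        by (auto simp: adjoin_def)
      have y: "y = f (x \<oplus> e \<odot> v)"
        using x v f c x(3)[symmetric] by (simp add: a_minus_def W.a_assoc W.l_neg)
      have "x \<oplus> e \<odot> v \<ominus> e \<odot> v = x"
        using x v c by (simp add: a_minus_def V.a_assoc V.r_neg)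
      then show "y \<in> f ` adjoin K V A v"
        using x y v c by (auto simp: adjoin_def intro!: image_eqI[of _ _ "x \<oplus> e \<odot> v"] bexI[of _ e])
    qed
    have ker: "{x \<in> adjoin K V A v. f x = \<zero>\<^bsub>W\<^esub>} = {x \<in> A. f x = \<zero>\<^bsub>W\<^esub>}"
    proof (intro equalityI subsetI)
      fix x assume "x \<in> {x \<in> adjoin K V A v. f x = \<zero>\<^bsub>W\<^esub>}"
      then obtain e where x: "f x = \<zero>\<^bsub>W\<^esub>" "x \<in> carrier V" "e \<in> carrier K" "x \<ominus> e \<odot> v \<in> A"
        by (auto simp: adjoin_def)
      \<comment> \<open>A nonzero \<open>e\<close> would be invertible, and
        \<open>f (x - ev) = -e f v\<close> would then put \<open>f v\<close> into the image of
        \<open>A\<close>, against the case assumption.\<close>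
      have "e = \<zero>\<^bsub>K\<^esub>"
      proof (rule ccontr)
        assume e0: "e \<noteq> \<zero>\<^bsub>K\<^esub>"
        then have e: "e \<in> Units K" using K.field_Units x by blast
        have "\<ominus>\<^bsub>W\<^esub> (e \<odot>\<^bsub>W\<^esub> f v) \<in> f ` A"
          using f x v by (auto simp: a_minus_def intro!: image_eqI[OF _ x(4)])
        then have "e \<odot>\<^bsub>W\<^esub> f v \<in> f ` A"
          using W.submoduleE(3)[OF fA] W.minus_minus f(1)[OF v] x(3) W.smult_closed by metis
        then have "inv\<^bsub>K\<^esub> e \<odot>\<^bsub>W\<^esub> (e \<odot>\<^bsub>W\<^esub> f v) \<in> f ` A"
          using W.submoduleE(4)[OF fA] e by simp
        then show False
          using False e f(1)[OF v] by (simp add: K.Units_closed flip: W.smult_assoc1)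
      qed
      then show "x \<in> {x \<in> A. f x = \<zero>\<^bsub>W\<^esub>}"
        using x v by (simp add: a_minus_def module_minus_zero[OF assms(2)])
    qed (use adjoin_supset[OF assms(2) A v] in auto)
    have "sdim K W (adjoin K W (f ` A) (f v)) (Suc d)"
      using ad(2) f(1)[OF v] False by (rule sdim.step)
    then show ?thesis
      using ad unfolding ker im by (metis add_Suc_right)
  qed
qed

text \<open>A chain in the image pulls back to the chain of preimages
  \<open>{x \<in> A. f x \<in> C}\<close>, which starts at the kernel. In contrast to rank-nullity,
  this produces the finite dimension of \<open>A\<close> from kernel and image.\<close>

lemma sdim_extension:
  fixes V (structure)
  assumes "module K V" "module K W" "f \<in> mod_hom K V W" and A: "submodule A K V"
    and a: "sdim K V {x \<in> A. f x = \<zero>\<^bsub>W\<^esub>} a" and c: "sdim K W (f ` A) c"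
  shows "sdim K V A (a + c)"
proof -
  interpret V: module K V by fact
  interpret W: module K W by fact
  note f = mod_hom_closed[OF assms(3)] mod_hom_add[OF assms(3)] mod_hom_smult[OF assms(3)]
    mod_hom_diff[OF assms(1-3)]
  note AE = V.submoduleE[OF A]
  have Ac: "x \<in> carrier V" if "x \<in> A" for x
    using AE(1) that by blast
  have "sdim K V {x \<in> A. f x \<in> C} (a + c)" if "sdim K W C c" "C \<subseteq> f ` A" for C c
    using that
  proof (induction rule: sdim.induct)
    case zero
    then show ?case using a by simp
  next
    case (step C n w)
    have C: "submodule C K W"
      using sdim_submodule[OF assms(2) step.hyps(1)] .
    have "w \<in> f ` A" "C \<subseteq> f ` A"
      using adjoin_self[OF assms(2) C step.hyps(2)] adjoin_supset[OF assms(2) C step.hyps(2)] step.prems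
      by auto
    then obtain v where v: "v \<in> A" "w = f v" by auto
    have vc: "v \<in> carrier V" using v Ac by blast
    have "{x \<in> A. f x \<in> adjoin K W C w} = adjoin K V {x \<in> A. f x \<in> C} v"
    proof (intro equalityI subsetI)
      fix x assume "x \<in> {x \<in> A. f x \<in> adjoin K W C w}"
      then obtain e where x: "x \<in> A" "e \<in> carrier K" "f x \<ominus>\<^bsub>W\<^esub> e \<odot>\<^bsub>W\<^esub> w \<in> C"
        by (auto simp: adjoin_def)
      have "f x \<ominus>\<^bsub>W\<^esub> e \<odot>\<^bsub>W\<^esub> w = f (x \<ominus> e \<odot> v)"
        using x v vc Ac f by simp
      then show "x \<in> adjoin K V {x \<in> A. f x \<in> C} v"
        using x v Ac V.submodule_diff[OF A x(1) AE(4)[OF x(2) v(1)]] by (auto simp: adjoin_def)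
    next
      fix x assume "x \<in> adjoin K V {x \<in> A. f x \<in> C} v"
      then obtain e where x: "x \<in> carrier V" "e \<in> carrier K" "x \<ominus> e \<odot> v \<in> A"
        "f (x \<ominus> e \<odot> v) \<in> C"
        by (auto simp: adjoin_def)
      have "x = (x \<ominus> e \<odot> v) \<oplus> e \<odot> v"
        using x vc by (simp add: a_minus_def V.a_assoc V.l_neg)
      then have "x \<in> A"
        using AE(5)[OF x(3) AE(4)[OF x(2) v(1)]] by simp
      then show "x \<in> {x \<in> A. f x \<in> adjoin K W C w}"
        using x f vc v(2) by (auto simp: adjoin_def)
    qed
    then show ?case
      using sdim.step[OF step.IH[OF \<open>C \<subseteq> f ` A\<close>] vc] step.hyps(3) v(2) by simp
  qed
  from this[OF c] show ?thesis by (simp cong: conj_cong)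
qed

lemma quot_module_proj:
  assumes "module R M" "submodule A R M"
  shows "(\<lambda>x. A +>\<^bsub>M\<^esub> x) \<in> mod_hom R M (quot_module M A)"
    and "x \<in> carrier M \<Longrightarrow> A +>\<^bsub>M\<^esub> x = \<zero>\<^bsub>quot_module M A\<^esub> \<longleftrightarrow> x \<in> A"
proof -
  interpret M: module R M by fact
  interpret A: submodule A R M by fact
  interpret KA: abelian_subgroup A M
    by (intro abelian_subgroupI3 additive_subgroup.intro A.subgroup_axioms M.abelian_group_axioms)
  show "(\<lambda>x. A +>\<^bsub>M\<^esub> x) \<in> mod_hom R M (quot_module M A)"
    by (auto simp: mod_hom_def quot_module_carrier[OF assms] quot_module_add[OF assms]
        quot_module_smult[OF assms])
  show "A +>\<^bsub>M\<^esub> x = \<zero>\<^bsub>quot_module M A\<^esub> \<longleftrightarrow> x \<in> A" if "x \<in> carrier M"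
    using that KA.a_rcos_self[OF that] M.a_coset_join2[OF that A.subgroup_axioms]
    by (auto simp: quot_module_def)
qed

text \<open>Rank-nullity for the projection modulo \<open>B\<close>, whose kernel on
  \<open>A\<close> is \<open>B\<close>.\<close>

lemma sdim_subspace:
  assumes "field K" "module K V" "sdim K V A n" "submodule B K V" "B \<subseteq> A"
  shows "\<exists>b c. sdim K V B b \<and> sdim K (quot_module V B) ((\<lambda>x. B +>\<^bsub>V\<^esub> x) ` A) c \<and> b + c = n"
proof -
  note q = quot_module_proj[OF assms(2,4)]
  have "{x \<in> A. B +>\<^bsub>V\<^esub> x = \<zero>\<^bsub>quot_module V B\<^esub>} = B"
    using assms(5) q(2) module.submoduleE(1)[OF assms(2) sdim_submodule[OF assms(2,3)]] by blast
  with sdim_rank_nullity[OF assms(1,2) quot_module_module[OF assms(2,4)] q(1) assms(3)]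
  show ?thesis by simp
qed

text \<open>Uniqueness of dimension in the one-dimensional case: scaling by an inverse recovers
  \<open>v\<close> from any nonzero vector on its line, so a chain for the line has exactly one
  step.\<close>

lemma sdim_line:
  fixes V (structure)
  assumes "field K" "module K V" "sdim K V A n" "v \<in> carrier V" "v \<noteq> \<zero>"
    and A: "A = adjoin K V {\<zero>} v"
  shows "n = 1"
proof -
  interpret K: field K by fact
  interpret V: module K V by fact
  have Z: "submodule {\<zero>} K V" by (rule zero_submodule[OF assms(2)])
  have vA: "v \<in> A" using adjoin_self[OF assms(2) Z assms(4)] A by simp
  have line: "v \<in> H" if H: "submodule H K V" and u: "u \<in> H" "u \<noteq> \<zero>" "u \<in> A" for H u
  proof -
    obtain e where e: "e \<in> carrier K" "u \<in> carrier V" "u \<ominus> e \<odot> v = \<zero>"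
      using u(3) A by (auto simp: adjoin_def)
    then have ue: "u = e \<odot> v"
      using assms(4) by (simp add: V.minus_equality a_minus_def V.minus_minus V.add.inv_solve_right')
    with u(2) assms(4) have "e \<noteq> \<zero>\<^bsub>K\<^esub>" by auto
    then have eu: "e \<in> Units K" using e K.field_Units by blast
    then have "inv\<^bsub>K\<^esub> e \<odot> u \<in> H"
      using V.submoduleE(4)[OF H] u by simp
    moreover have "inv\<^bsub>K\<^esub> e \<odot> u = v"
      using ue eu assms(4) by (simp add: K.Units_closed flip: V.smult_assoc1)
    ultimately show "v \<in> H" by simp
  qed
  from assms(3) show ?thesis
  proof cases
    case zero
    then show ?thesis using vA assms(5) by simp
  next
    case (step B m w)
    have B: "submodule B K V" using sdim_submodule[OF assms(2) step(3)] .
    have BA: "B \<subseteq> A" "w \<in> A"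
      using adjoin_supset[OF assms(2) B step(4)] adjoin_self[OF assms(2) B step(4)] step(1) by auto
    have "u = \<zero>" if "u \<in> B" for u
    proof (rule ccontr)
      assume "u \<noteq> \<zero>"
      then have "v \<in> B" using line[OF B that] BA that by blast
      then have "A \<subseteq> B"
        unfolding A using V.submodule_zero[OF B] by (intro adjoin_least[OF assms(2) B]) auto
      then show False using BA step(5) by blast
    qed
    then have "B = {\<zero>}" using V.submodule_zero[OF B] by blast
    with step(3) have "sdim K V {\<zero>} m" by simp
    then have "m = 0"
    proof cases
      case (step C l x)
      have C: "submodule C K V" using sdim_submodule[OF assms(2) step(3)] .
      show ?thesis
        using adjoin_self[OF assms(2) C step(4)] step(1,5) V.submodule_zero[OF C] by (metis singletonD)
    qed
    then show ?thesis using step(2) by simp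
  qed
qed

text \<open>Modulo \<open>A\<close>, the space \<open>A + Kv\<close> becomes a line. A second chain
  for \<open>A + Kv\<close> splits into one for \<open>A\<close>, of length \<open>n\<close> by
  induction, and one for this line, of length one.\<close>

lemma sdim_unique:
  fixes V (structure)
  assumes "field K" "module K V" "sdim K V A n" "sdim K V A m"
  shows "n = m"
  using assms(3,4)
proof (induction arbitrary: m rule: sdim.induct)
  case zero
  then show ?case
  proof cases
    case zero
    then show ?thesis by simp
  next
    case (step C l x)
    have C: "submodule C K V" using sdim_submodule[OF assms(2) step(3)] .
    show ?thesis
      using adjoin_self[OF assms(2) C step(4)] step(1,5) module.submodule_zero[OF assms(2) C] by (metis singletonD)
  qed
next
  case (step A n v)
  interpret V: module K V by fact
  have A: "submodule A K V" using sdim_submodule[OF assms(2) step.hyps(1)] .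
  note q = quot_module_proj[OF assms(2) A]
  let ?q = "\<lambda>x. A +> x"
  let ?Q = "quot_module V A"
  have Q: "module K ?Q" by (rule quot_module_module[OF assms(2) A])
  note f = mod_hom_closed[OF q(1)] mod_hom_add[OF q(1)] mod_hom_smult[OF q(1)]
    mod_hom_diff[OF assms(2) Q q(1)]
  obtain b c where bc: "sdim K V A b" "sdim K ?Q (?q ` adjoin K V A v) c" "b + c = m"
    using sdim_subspace[OF assms(1,2) step.prems A adjoin_supset[OF assms(2) A step.hyps(2)]] by blast
  have "?q ` adjoin K V A v = adjoin K ?Q {\<zero>\<^bsub>?Q\<^esub>} (?q v)"
  proof (intro equalityI subsetI)
    fix y assume "y \<in> ?q ` adjoin K V A v"
    then obtain x e where x: "y = ?q x" "x \<in> carrier V" "e \<in> carrier K" "x \<ominus> e \<odot> v \<in> A"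
      by (auto simp: adjoin_def)
    have "?q x \<ominus>\<^bsub>?Q\<^esub> e \<odot>\<^bsub>?Q\<^esub> ?q v = ?q (x \<ominus> e \<odot> v)"
      using x step.hyps(2) f by simp
    also have "\<dots> = \<zero>\<^bsub>?Q\<^esub>"
      using x step.hyps(2) by (subst q(2)) auto
    finally show "y \<in> adjoin K ?Q {\<zero>\<^bsub>?Q\<^esub>} (?q v)"
      using x f by (auto simp: adjoin_def)
  next
    fix y assume "y \<in> adjoin K ?Q {\<zero>\<^bsub>?Q\<^esub>} (?q v)"
    then obtain x e where x: "y = ?q x" "x \<in> carrier V" "e \<in> carrier K"
      "?q x \<ominus>\<^bsub>?Q\<^esub> e \<odot>\<^bsub>?Q\<^esub> ?q v = \<zero>\<^bsub>?Q\<^esub>"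
      by (auto simp: adjoin_def quot_module_carrier[OF assms(2) A])
    have "?q (x \<ominus> e \<odot> v) = \<zero>\<^bsub>?Q\<^esub>"
      using x step.hyps(2) f by simp
    then have "x \<ominus> e \<odot> v \<in> A"
      using x step.hyps(2) by (subst (asm) q(2)) auto
    then show "y \<in> ?q ` adjoin K V A v"
      using x by (auto simp: adjoin_def)
  qed
  moreover have "?q v \<noteq> \<zero>\<^bsub>?Q\<^esub>"
    using q(2)[OF step.hyps(2)] step.hyps(3) by simp
  ultimately have "c = 1"
    using sdim_line[OF assms(1) Q bc(2) f(1)[OF step.hyps(2)]] by simp
  then show ?case
    using step.IH[OF bc(1)] bc(3) by simp
qed

definition fin_dim :: "('a, 'r) ring_scheme \<Rightarrow> ('a, 'm, 'x) module_scheme \<Rightarrow> 'm set \<Rightarrow> bool" where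
  "fin_dim K V A \<longleftrightarrow> (\<exists>n. sdim K V A n)"

text \<open>Meaningful under \<open>fin_dim\<close>, where \<open>sdim_unique\<close> makes the
  description proper.\<close>

definition vdim :: "('a, 'r) ring_scheme \<Rightarrow> ('a, 'm, 'x) module_scheme \<Rightarrow> 'm set \<Rightarrow> nat" where
  "vdim K V A = (THE n. sdim K V A n)"

lemma vdim_eqI:
  assumes "field K" "module K V" "sdim K V A n"
  shows "vdim K V A = n"
  unfolding vdim_def using assms sdim_unique by blast

lemma sdim_vdim:
  assumes "field K" "module K V" "fin_dim K V A"
  shows "sdim K V A (vdim K V A)"
  using assms vdim_eqI unfolding fin_dim_def by metis

lemma fin_dim_submodule: "module K V \<Longrightarrow> fin_dim K V A \<Longrightarrow> submodule A K V"
  unfolding fin_dim_def using sdim_submodule by blast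

lemma rank_nullity:
  assumes "field K" "module K V" "module K W" "f \<in> mod_hom K V W" "fin_dim K V A"
  shows "fin_dim K W (f ` A)"
    and "vdim K V A = vdim K V {x \<in> A. f x = \<zero>\<^bsub>W\<^esub>} + vdim K W (f ` A)"
proof -
  obtain a c where *: "sdim K V {x \<in> A. f x = \<zero>\<^bsub>W\<^esub>} a" "sdim K W (f ` A) c" "a + c = vdim K V A"
    using sdim_rank_nullity[OF assms(1-4) sdim_vdim[OF assms(1,2,5)]] by blast
  show "fin_dim K W (f ` A)"
    unfolding fin_dim_def using *(2) by blast
  show "vdim K V A = vdim K V {x \<in> A. f x = \<zero>\<^bsub>W\<^esub>} + vdim K W (f ` A)"
    using * vdim_eqI[OF assms(1,2) *(1)] vdim_eqI[OF assms(1,3) *(2)] by simp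
qed

lemma fin_dim_subspace:
  assumes "field K" "module K V" "fin_dim K V A" "submodule B K V" "B \<subseteq> A"
  shows "fin_dim K V B" and "vdim K V B \<le> vdim K V A"
proof -
  obtain b c where "sdim K V B b" "b + c = vdim K V A"
    using sdim_subspace[OF assms(1,2) sdim_vdim[OF assms(1-3)] assms(4,5)] by blast
  then show "fin_dim K V B" "vdim K V B \<le> vdim K V A"
    using vdim_eqI[OF assms(1,2)] by (auto simp: fin_dim_def)
qed

lemma fin_dim_extension:
  assumes "field K" "module K V" "module K W" "f \<in> mod_hom K V W" "submodule A K V"
    and "fin_dim K V {x \<in> A. f x = \<zero>\<^bsub>W\<^esub>}" "fin_dim K W (f ` A)"
  shows "fin_dim K V A"
  using sdim_extension[OF assms(2-5)] assms(6,7) unfolding fin_dim_def by blast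

lemma vdim_zero:
  assumes "field K" "module K V"
  shows "fin_dim K V {\<zero>\<^bsub>V\<^esub>}" and "vdim K V {\<zero>\<^bsub>V\<^esub>} = 0"
  using vdim_eqI[OF assms sdim.zero] sdim.zero unfolding fin_dim_def by metis+

lemma vdim_eq_0:
  assumes "field K" "module K V" "fin_dim K V A" "vdim K V A = 0"
  shows "A = {\<zero>\<^bsub>V\<^esub>}"
proof -
  have "sdim K V A 0" using sdim_vdim[OF assms(1-3)] assms(4) by simp
  then show ?thesis by cases auto
qed

section \<open>Homomorphisms of free modules and tensor products\<close>

text \<open>\<open>R\<close> as a module over itself, so that coordinate functions on free modules
  and, later, homogeneous components become homomorphisms in the sense of
  \<open>mod_hom\<close>.\<close>

definition regular_module :: "('a, 'r) ring_scheme \<Rightarrow> ('a, 'a) module" where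
  "regular_module R = \<lparr>carrier = carrier R, mult = mult R, one = one R, ring.zero = ring.zero R,
     add = add R, smult = mult R\<rparr>"

lemma regular_module_simps [simp]:
  "carrier (regular_module R) = carrier R"
  "\<zero>\<^bsub>regular_module R\<^esub> = \<zero>\<^bsub>R\<^esub>"
  "x \<oplus>\<^bsub>regular_module R\<^esub> y = x \<oplus>\<^bsub>R\<^esub> y"
  "x \<odot>\<^bsub>regular_module R\<^esub> y = x \<otimes>\<^bsub>R\<^esub> y"
  by (simp_all add: regular_module_def)

lemma regular_module_finsum: "finsum (regular_module R) f A = finsum R f A"
  by (simp add: finsum_def finprod_def regular_module_def)

lemma (in cring) regular_module_module: "module R (regular_module R)"
proof (rule moduleI)
  show "abelian_group (regular_module R)"
    by (rule abelian_groupI) (auto simp: a_ac intro!: bexI[of _ "\<ominus> _"] l_neg)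
qed (auto simp: cring_axioms l_distr r_distr m_assoc)

lemma mod_hom_comp:
  "f \<in> mod_hom R L M \<Longrightarrow> g \<in> mod_hom R M N \<Longrightarrow> (\<lambda>x. g (f x)) \<in> mod_hom R L N"
  by (auto simp: mod_hom_def Pi_iff)

lemma mod_hom_id: "(\<lambda>x. x) \<in> mod_hom R M M"
  by (auto simp: mod_hom_def)

lemma mod_hom_const_zero:
  assumes "module R N"
  shows "(\<lambda>x. \<zero>\<^bsub>N\<^esub>) \<in> mod_hom R M N"
proof -
  interpret N: module R N by fact
  show ?thesis by (auto simp: mod_hom_def)
qed

lemma mod_hom_plus:
  assumes "module R M" "module R N" "f \<in> mod_hom R M N" "g \<in> mod_hom R M N"
  shows "(\<lambda>x. f x \<oplus>\<^bsub>N\<^esub> g x) \<in> mod_hom R M N"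
proof -
  interpret M: module R M by fact
  interpret N: module R N by fact
  note c = mod_hom_closed[OF assms(3)] mod_hom_closed[OF assms(4)]
  show ?thesis
    using c by (auto simp: mod_hom_def mod_hom_add[OF assms(3)] mod_hom_add[OF assms(4)]
      mod_hom_smult[OF assms(3)] mod_hom_smult[OF assms(4)] N.smult_r_distr N.a_ac)
qed

lemma mod_hom_scale:
  assumes "module R M" "module R N" "f \<in> mod_hom R M N" "a \<in> carrier R"
  shows "(\<lambda>x. a \<odot>\<^bsub>N\<^esub> f x) \<in> mod_hom R M N"
proof -
  interpret M: module R M by fact
  interpret N: module R N by fact
  note c = mod_hom_closed[OF assms(3)]
  have "a \<odot>\<^bsub>N\<^esub> (b \<odot>\<^bsub>N\<^esub> y) = b \<odot>\<^bsub>N\<^esub> (a \<odot>\<^bsub>N\<^esub> y)" if "b \<in> carrier R" "y \<in> carrier N" for b y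
    using that assms(4) by (simp add: M.m_comm flip: N.smult_assoc1)
  then show ?thesis
    using c assms(4) by (auto simp: mod_hom_def mod_hom_add[OF assms(3)]
      mod_hom_smult[OF assms(3)] N.smult_r_distr)
qed

lemma mod_hom_minus_fun:
  assumes "module R M" "module R N" "f \<in> mod_hom R M N" "g \<in> mod_hom R M N"
  shows "(\<lambda>x. f x \<ominus>\<^bsub>N\<^esub> g x) \<in> mod_hom R M N"
proof -
  interpret M: module R M by fact
  interpret N: module R N by fact
  have "(\<lambda>x. f x \<oplus>\<^bsub>N\<^esub> (\<ominus>\<^bsub>R\<^esub> \<one>\<^bsub>R\<^esub>) \<odot>\<^bsub>N\<^esub> g x) \<in> mod_hom R M N"
    by (intro mod_hom_plus mod_hom_scale assms) auto
  then show ?thesis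
    by (rule rev_iffD1) (auto simp: mod_hom_def N.smult_l_minus a_minus_def Pi_iff mod_hom_closed[OF assms(4)])
qed

lemma mod_hom_finsum:
  assumes "module R M" "module R N" "h \<in> mod_hom R M N" "finite A" "f \<in> A \<rightarrow> carrier M"
  shows "h (finsum M f A) = (\<Oplus>\<^bsub>N\<^esub>a\<in>A. h (f a))"
proof -
  interpret M: module R M by fact
  interpret N: module R N by fact
  show ?thesis
    using assms(4,5)
  proof (induction A)
    case empty
    then show ?case by (simp add: mod_hom_zero[OF assms(1-3)])
  next
    case (insert x A)
    then have "f \<in> A \<rightarrow> carrier M" "f x \<in> carrier M" by auto
    with insert show ?case
      using mod_hom_closed[OF assms(3)]
      by (simp add: mod_hom_add[OF assms(3)] M.finsum_closed Pi_iff)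
  qed
qed

lemma mod_hom_sum_fun:
  assumes "module R M" "module R N" "finite A" "\<And>a. a \<in> A \<Longrightarrow> f a \<in> mod_hom R M N"
  shows "(\<lambda>x. \<Oplus>\<^bsub>N\<^esub>a\<in>A. f a x) \<in> mod_hom R M N"
proof -
  interpret M: module R M by fact
  interpret N: module R N by fact
  have c: "a \<in> A \<Longrightarrow> x \<in> carrier M \<Longrightarrow> f a x \<in> carrier N" for a x
    using assms(4) mod_hom_closed by metis
  show ?thesis
    unfolding mod_hom_def
  proof (intro CollectI conjI ballI funcsetI)
    fix x y assume xy: "x \<in> carrier M" "y \<in> carrier M"
    have "(\<Oplus>\<^bsub>N\<^esub>a\<in>A. f a (x \<oplus>\<^bsub>M\<^esub> y)) = (\<Oplus>\<^bsub>N\<^esub>a\<in>A. f a x \<oplus>\<^bsub>N\<^esub> f a y)"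
      using xy c by (intro N.finsum_cong') (auto simp: mod_hom_add[OF assms(4)])
    also have "\<dots> = (\<Oplus>\<^bsub>N\<^esub>a\<in>A. f a x) \<oplus>\<^bsub>N\<^esub> (\<Oplus>\<^bsub>N\<^esub>a\<in>A. f a y)"
      using xy c by (intro N.finsum_addf) auto
    finally show "(\<Oplus>\<^bsub>N\<^esub>a\<in>A. f a (x \<oplus>\<^bsub>M\<^esub> y)) = (\<Oplus>\<^bsub>N\<^esub>a\<in>A. f a x) \<oplus>\<^bsub>N\<^esub> (\<Oplus>\<^bsub>N\<^esub>a\<in>A. f a y)" .
  next
    fix r x assume "r \<in> carrier R" "x \<in> carrier M"
    then show "(\<Oplus>\<^bsub>N\<^esub>a\<in>A. f a (r \<odot>\<^bsub>M\<^esub> x)) = r \<odot>\<^bsub>N\<^esub> (\<Oplus>\<^bsub>N\<^esub>a\<in>A. f a x)"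
      using c assms(3,4)
      by (subst N.finsum_smult_ldistr) (auto intro!: N.finsum_cong' simp: mod_hom_smult[OF assms(4)])
  qed (use c in \<open>auto intro!: N.finsum_closed\<close>)
qed

lemma finsum_smult_rdistr:
  assumes "module R M" "finite A" "f \<in> A \<rightarrow> carrier R" "x \<in> carrier M"
  shows "finsum R f A \<odot>\<^bsub>M\<^esub> x = (\<Oplus>\<^bsub>M\<^esub>a\<in>A. f a \<odot>\<^bsub>M\<^esub> x)"
proof -
  interpret M: module R M by fact
  have "(\<lambda>a. a \<odot>\<^bsub>M\<^esub> x) \<in> mod_hom R (regular_module R) M"
    using assms(4) by (auto simp: mod_hom_def M.smult_l_distr M.smult_assoc1)
  from mod_hom_finsum[OF M.regular_module_module assms(1) this assms(2)] assms(3)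
  show ?thesis by (simp add: regular_module_finsum)
qed

context
  fixes R :: "('a, 'r) ring_scheme" (structure)
  assumes R: "cring R"
begin

interpretation R: cring R by (rule R)

lemma free_eval_hom: "(\<lambda>u. u c) \<in> mod_hom R (free_module R B) (regular_module R)"
  by (auto simp: mod_hom_def free_module_simps(3,4) R.free_module_coeff)

text \<open>Induction over a finite set containing the support: subtracting \<open>u a\<close> times
  a basis vector removes \<open>a\<close> from the support. The basis may be infinite, as in the
  resolutions behind \<open>Tor\<close>.\<close>

lemma free_hom_eq:
  assumes V: "module R V" and h: "h \<in> mod_hom R (free_module R B) V" "h' \<in> mod_hom R (free_module R B) V"
    and eq: "\<And>b. b \<in> B \<Longrightarrow> h (free_basis R b) = h' (free_basis R b)"
    and u: "u \<in> carrier (free_module R B)"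
  shows "h u = h' u"
proof -
  interpret V: module R V by fact
  interpret F: module R "free_module R B" by (rule R.free_module_module)
  let ?F = "free_module R B"
  have "h u = h' u" if "finite A" "u \<in> carrier ?F" "{b. u b \<noteq> \<zero>} \<subseteq> A" for A u
    using that
  proof (induction A arbitrary: u)
    case empty
    then have "u = \<zero>\<^bsub>?F\<^esub>" by (auto simp: free_module_simps)
    then show ?case
      by (simp add: mod_hom_zero[OF F.module_axioms V h(1)] mod_hom_zero[OF F.module_axioms V h(2)])
  next
    case (insert a A)
    show ?case
    proof (cases "a \<in> B")
      case True
      define w where "w = u \<ominus>\<^bsub>?F\<^esub> u a \<odot>\<^bsub>?F\<^esub> free_basis R a"
      have c: "u a \<in> carrier R" "free_basis R a \<in> carrier ?F"
        using R.free_module_coeff[OF insert.prems(1)] R.free_basis_closed[OF True] by auto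
      then have m: "u a \<odot>\<^bsub>?F\<^esub> free_basis R a \<in> carrier ?F"
        by simp
      have w: "w \<in> carrier ?F"
        unfolding w_def using insert.prems(1) m by simp
      have uw: "u = w \<oplus>\<^bsub>?F\<^esub> u a \<odot>\<^bsub>?F\<^esub> free_basis R a"
        unfolding w_def using insert.prems(1) m by (simp add: a_minus_def F.M.a_assoc F.M.l_neg)
      have wb: "w b = u b \<oplus> \<ominus> (u a \<otimes> free_basis R a b)" for b
      proof -
        have "w = u \<oplus>\<^bsub>?F\<^esub> (\<ominus> \<one>) \<odot>\<^bsub>?F\<^esub> (u a \<odot>\<^bsub>?F\<^esub> free_basis R a)"
          unfolding w_def using m by (simp add: a_minus_def F.smult_l_minus)
        then show ?thesis
          using c(1) by (simp add: free_module_simps(3,4) R.free_module_coeff[OF c(2)] R.l_minus)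
      qed
      have "w a = \<zero>" "\<And>b. b \<noteq> a \<Longrightarrow> w b = u b"
        using c(1) R.free_module_coeff[OF insert.prems(1)]
        by (simp_all add: wb free_basis_def R.r_neg)
      then have "{b. w b \<noteq> \<zero>} \<subseteq> A"
        using insert.prems(2) by force
      then have "h w = h' w" using insert.IH[OF w] by simp
      then show ?thesis
        using eq[OF True] mod_hom_add[OF h(1) w m] mod_hom_add[OF h(2) w m] c uw
          mod_hom_smult[OF h(1) c] mod_hom_smult[OF h(2) c] by simp
    next
      case False
      then have "u a = \<zero>" using insert.prems(1) by (auto simp: free_module_simps)
      then show ?thesis using insert by (intro insert.IH) auto
    qed
  qed
  from this[of "{b. u b \<noteq> \<zero>}" u] u show ?thesis
    by (auto simp: free_module_simps)
qed

lemma free_hom_lin_ext: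
  assumes V: "module R V" and h: "h \<in> mod_hom R (free_module R B) V"
    and u: "u \<in> carrier (free_module R B)"
  shows "h u = lin_ext R V (\<lambda>b. h (free_basis R b)) u"
proof -
  have g: "(\<lambda>b. h (free_basis R b)) \<in> B \<rightarrow> carrier V"
    by (intro funcsetI mod_hom_closed[OF h] R.free_basis_closed)
  show ?thesis
    using lin_ext_basis[OF V g] by (intro free_hom_eq[OF V h lin_ext_hom[OF V g] _ u]) simp
qed

lemma lin_ext_finite:
  assumes "module R V" "finite B" "g \<in> B \<rightarrow> carrier V" "u \<in> carrier (free_module R B)"
  shows "lin_ext R V g u = (\<Oplus>\<^bsub>V\<^esub>b\<in>B. u b \<odot>\<^bsub>V\<^esub> g b)"
  using assms(4) by (intro lin_ext_superset[OF assms(1,3,4,2)]) (auto simp: free_module_simps)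

lemma lin_ext_coord:
  assumes "finite B" "g \<in> B \<rightarrow> carrier (free_module R C)" "u \<in> carrier (free_module R B)"
  shows "lin_ext R (free_module R C) g u c = (\<Oplus>b\<in>B. u b \<otimes> g b c)"
proof -
  interpret F: module R "free_module R C" by (rule R.free_module_module)
  have "(\<lambda>b. u b \<odot>\<^bsub>free_module R C\<^esub> g b) \<in> B \<rightarrow> carrier (free_module R C)"
    using assms(2) R.free_module_coeff[OF assms(3)] by auto
  from mod_hom_finsum[OF F.module_axioms R.regular_module_module free_eval_hom assms(1) this]
  show ?thesis
    unfolding lin_ext_finite[OF F.module_axioms assms] regular_module_finsum
    by (simp only: free_module_simps(4))
qed

lemma free_hom_coord:
  assumes "finite B" "h \<in> mod_hom R (free_module R B) (free_module R C)" "u \<in> carrier (free_module R B)"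
  shows "h u c = (\<Oplus>b\<in>B. u b \<otimes> h (free_basis R b) c)"
proof -
  have "(\<lambda>b. h (free_basis R b)) \<in> B \<rightarrow> carrier (free_module R C)"
    by (intro funcsetI mod_hom_closed[OF assms(2)] R.free_basis_closed)
  then show ?thesis
    using free_hom_lin_ext[OF R.free_module_module assms(2,3)] lin_ext_coord[OF assms(1) _ assms(3)]
    by simp
qed

text \<open>Projectivity of free modules, with surjectivity of \<open>p\<close> relaxed to its image
  containing that of \<open>h\<close>; in a resolution this inclusion comes from exactness.\<close>

lemma free_lift:
  assumes X: "module R X" and Y: "module R Y" and p: "p \<in> mod_hom R X Y"
    and h: "h \<in> mod_hom R (free_module R B) Y"
    and im: "\<And>u. u \<in> carrier (free_module R B) \<Longrightarrow> h u \<in> p ` carrier X"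
  shows "\<exists>k\<in>mod_hom R (free_module R B) X. \<forall>u\<in>carrier (free_module R B). p (k u) = h u"
proof -
  have "\<forall>b\<in>B. \<exists>x\<in>carrier X. p x = h (free_basis R b)"
  proof
    fix b assume "b \<in> B"
    then have "h (free_basis R b) \<in> p ` carrier X"
      by (intro im R.free_basis_closed)
    then show "\<exists>x\<in>carrier X. p x = h (free_basis R b)"
      by (elim imageE) (simp add: bexI)
  qed
  then obtain g where g: "\<And>b. b \<in> B \<Longrightarrow> g b \<in> carrier X \<and> p (g b) = h (free_basis R b)"
    by metis
  then have gc: "g \<in> B \<rightarrow> carrier X" by auto
  note k = lin_ext_hom[OF X gc]
  have "p (lin_ext R X g u) = h u" if "u \<in> carrier (free_module R B)" for u
    using g lin_ext_basis[OF X gc] by (intro free_hom_eq[OF Y mod_hom_comp[OF k p] h _ that]) auto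
  with k show ?thesis by blast
qed

end

text \<open>The pure tensors are the images of the basis of the free module that presents
  \<open>tensor R M N\<close>, so composing with the projection reduces the claim to
  \<open>free_hom_eq\<close>.\<close>

lemma tensor_hom_eq:
  assumes M: "module R M" and N: "module R N" and P: "module R P"
    and h: "h \<in> mod_hom R (tensor R M N) P" "h' \<in> mod_hom R (tensor R M N) P"
    and eq: "\<And>x y. x \<in> carrier M \<Longrightarrow> y \<in> carrier N \<Longrightarrow>
      h (pure_tensor R M N x y) = h' (pure_tensor R M N x y)"
    and z: "z \<in> carrier (tensor R M N)"
  shows "h z = h' z"
proof -
  interpret M: module R M by fact
  let ?F = "free_module R (carrier M \<times> carrier N)"
  note F = M.free_module_module[of "carrier M \<times> carrier N"]
  note K = tensor_kernel_submodule[OF M N]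
  note q = quot_module_proj(1)[OF F K, folded tensor_def]
  obtain u where u: "u \<in> carrier ?F" "z = tensor_kernel R M N +>\<^bsub>?F\<^esub> u"
    using z quot_module_carrier[OF F K] by (auto simp: tensor_def)
  show ?thesis
    unfolding u(2)
    by (rule free_hom_eq[OF M.R.cring_axioms P mod_hom_comp[OF q h(1)] mod_hom_comp[OF q h(2)] _ u(1)])
      (use eq in \<open>auto simp: pure_tensor_def\<close>)
qed

context
  fixes R :: "('a, 'r) ring_scheme" and N :: "('a, 'n, 'y) module_scheme"
  assumes N: "module R N"
begin

text \<open>\<open>tensor_map\<close> is a choice pinned down on the carrier only. Functoriality and
  additivity are therefore stated at elements \<open>z\<close> and checked on pure tensors.\<close>

lemma tensor_map_comp:
  assumes X: "module R X" "module R Y" "module R Z" and f: "f \<in> mod_hom R X Y" and g: "g \<in> mod_hom R Y Z"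
    and z: "z \<in> carrier (tensor R X N)"
  shows "tensor_map R X Z N (\<lambda>x. g (f x)) z = tensor_map R Y Z N g (tensor_map R X Y N f z)"
  by (rule tensor_hom_eq[OF X(1) N tensor_module[OF X(3) N]
        tensor_map(1)[OF X(1,3) N mod_hom_comp[OF f g]]
        mod_hom_comp[OF tensor_map(1)[OF X(1,2) N f] tensor_map(1)[OF X(2,3) N g]] _ z])
    (simp add: tensor_map(2)[OF X(1,3) N mod_hom_comp[OF f g]] tensor_map(2)[OF X(1,2) N f]
      tensor_map(2)[OF X(2,3) N g] mod_hom_closed[OF f])

lemma tensor_map_plus:
  assumes X: "module R X" "module R Y" and f: "f \<in> mod_hom R X Y" and g: "g \<in> mod_hom R X Y"
    and z: "z \<in> carrier (tensor R X N)"
  shows "tensor_map R X Y N (\<lambda>x. f x \<oplus>\<^bsub>Y\<^esub> g x) z =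
    tensor_map R X Y N f z \<oplus>\<^bsub>tensor R Y N\<^esub> tensor_map R X Y N g z"
proof -
  note T = tensor_module[OF X(2) N] tensor_module[OF X(1) N]
  note h = mod_hom_plus[OF X f g]
  show ?thesis
    by (rule tensor_hom_eq[OF X(1) N T(1) tensor_map(1)[OF X N h]
          mod_hom_plus[OF T(2,1) tensor_map(1)[OF X N f] tensor_map(1)[OF X N g]] _ z])
      (simp add: tensor_map(2)[OF X N h] tensor_map(2)[OF X N f] tensor_map(2)[OF X N g]
        pure_tensor_bilinear(1)[OF X(2) N] mod_hom_closed[OF f] mod_hom_closed[OF g])
qed

lemma tensor_map_cong:
  assumes X: "module R X" "module R Y" and f: "f \<in> mod_hom R X Y" and g: "g \<in> mod_hom R X Y"
    and eq: "\<And>x. x \<in> carrier X \<Longrightarrow> f x = g x" and z: "z \<in> carrier (tensor R X N)"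
  shows "tensor_map R X Y N f z = tensor_map R X Y N g z"
  by (rule tensor_hom_eq[OF X(1) N tensor_module[OF X(2) N] tensor_map(1)[OF X N f]
        tensor_map(1)[OF X N g] _ z])
    (simp add: tensor_map(2)[OF X N f] tensor_map(2)[OF X N g] eq)

lemma tensor_map_id:
  assumes X: "module R X" and z: "z \<in> carrier (tensor R X N)"
  shows "tensor_map R X X N (\<lambda>x. x) z = z"
  by (rule tensor_hom_eq[OF X N tensor_module[OF X N] tensor_map(1)[OF X X N mod_hom_id]
        mod_hom_id _ z])
    (simp add: tensor_map(2)[OF X X N mod_hom_id])

end

section \<open>Independence of the resolution\<close>

text \<open>The rearrangement that turns a homotopy step, which lifts
  \<open>(p u - u) - s (e u)\<close>, into the identity
  \<open>p u = u + (e (s u) + s (e u))\<close>.\<close>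

lemma (in abelian_group) cancel_minus_twice:
  assumes "a \<in> carrier G" "b \<in> carrier G" "c \<in> carrier G"
  shows "a = b \<oplus> (((a \<ominus> b) \<ominus> c) \<oplus> c)"
proof -
  have "((a \<ominus> b) \<ominus> c) \<oplus> c = a \<ominus> b"
    using assms by (simp add: a_minus_def a_assoc l_neg)
  also have "\<dots> = \<ominus> b \<oplus> a"
    using assms by (simp add: a_minus_def a_comm)
  finally show ?thesis
    using assms by (simp add: r_neg2)
qed

text \<open>Vanishing of homology in degree \<open>Suc n\<close> after tensoring with
  \<open>N\<close>, written with elements so that it can be compared between resolutions with
  different index types.\<close>

definition acyclic_with ::
    "('a, 'r) ring_scheme \<Rightarrow> ('a, 'n, 'y) module_scheme \<Rightarrow> (nat \<Rightarrow> 'b set) \<Rightarrow> (nat \<Rightarrow> ('b \<Rightarrow> 'a) \<Rightarrow> ('b \<Rightarrow> 'a)) \<Rightarrow> nat \<Rightarrow> bool" where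
  "acyclic_with R N B d n \<longleftrightarrow>
    (\<forall>z\<in>carrier (tensor R (free_module R (B (Suc n))) N).
      tensor_map R (free_module R (B (Suc n))) (free_module R (B n)) N (d n) z =
        \<zero>\<^bsub>tensor R (free_module R (B n)) N\<^esub> \<longrightarrow>
      z \<in> tensor_map R (free_module R (B (Suc (Suc n)))) (free_module R (B (Suc n))) N (d (Suc n)) `
        carrier (tensor R (free_module R (B (Suc (Suc n)))) N))"

context
  fixes R :: "('a, 'r) ring_scheme" and M :: "('a, 'm, 'x) module_scheme"
  assumes M: "module R M"
begin

interpretation M: module R M by (rule M)

lemma free_resolutionD:
  assumes "free_resolution R M B d \<epsilon>"
  shows "\<epsilon> \<in> mod_hom R (free_module R (B 0)) M"
    and "d n \<in> mod_hom R (free_module R (B (Suc n))) (free_module R (B n))"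
    and "\<epsilon> ` carrier (free_module R (B 0)) = carrier M"
    and "u \<in> carrier (free_module R (B 0)) \<Longrightarrow> \<epsilon> u = \<zero>\<^bsub>M\<^esub> \<longleftrightarrow>
      u \<in> d 0 ` carrier (free_module R (B (Suc 0)))"
    and "w \<in> carrier (free_module R (B (Suc n))) \<Longrightarrow> d n w = \<zero>\<^bsub>free_module R (B n)\<^esub> \<longleftrightarrow>
      w \<in> d (Suc n) ` carrier (free_module R (B (Suc (Suc n))))"
proof -
  have *: "\<epsilon> \<in> mod_hom R (free_module R (B 0)) M"
    "d n \<in> mod_hom R (free_module R (B (Suc n))) (free_module R (B n))"
    "\<epsilon> ` carrier (free_module R (B 0)) = carrier M"
    "{u \<in> carrier (free_module R (B 0)). \<epsilon> u = \<zero>\<^bsub>M\<^esub>} = d 0 ` carrier (free_module R (B (Suc 0)))"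
    "{w \<in> carrier (free_module R (B (Suc n))). d n w = \<zero>\<^bsub>free_module R (B n)\<^esub>} =
      d (Suc n) ` carrier (free_module R (B (Suc (Suc n))))" for n
    using assms by (simp_all add: free_resolution_def Let_def a_kernel_def kernel_def)
  show "\<epsilon> \<in> mod_hom R (free_module R (B 0)) M"
    "d n \<in> mod_hom R (free_module R (B (Suc n))) (free_module R (B n))"
    "\<epsilon> ` carrier (free_module R (B 0)) = carrier M"
    by (rule *)+
  show "u \<in> carrier (free_module R (B 0)) \<Longrightarrow> \<epsilon> u = \<zero>\<^bsub>M\<^esub> \<longleftrightarrow>
      u \<in> d 0 ` carrier (free_module R (B (Suc 0)))"
    using *(4) by blast
  show "w \<in> carrier (free_module R (B (Suc n))) \<Longrightarrow> d n w = \<zero>\<^bsub>free_module R (B n)\<^esub> \<longleftrightarrow>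
      w \<in> d (Suc n) ` carrier (free_module R (B (Suc (Suc n))))"
    using *(5)[of n] by blast
qed

lemma free_resolution_zero:
  assumes "free_resolution R M B d \<epsilon>"
  shows "u \<in> carrier (free_module R (B (Suc 0))) \<Longrightarrow> \<epsilon> (d 0 u) = \<zero>\<^bsub>M\<^esub>"
    and "w \<in> carrier (free_module R (B (Suc (Suc n)))) \<Longrightarrow> d n (d (Suc n) w) = \<zero>\<^bsub>free_module R (B n)\<^esub>"
proof -
  note c = mod_hom_closed[OF free_resolutionD(2)[OF assms]]
  show "u \<in> carrier (free_module R (B (Suc 0))) \<Longrightarrow> \<epsilon> (d 0 u) = \<zero>\<^bsub>M\<^esub>"
    using free_resolutionD(4)[OF assms c] by simp
  show "w \<in> carrier (free_module R (B (Suc (Suc n)))) \<Longrightarrow> d n (d (Suc n) w) = \<zero>\<^bsub>free_module R (B n)\<^esub>"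
    using free_resolutionD(5)[OF assms c] by simp
qed

text \<open>Comparison theorem: freeness of the source and exactness of the target permit lifting
  degree by degree.\<close>

lemma chain_map_exists:
  assumes B: "free_resolution R M B d \<epsilon>" and C: "free_resolution R M C e \<eta>"
  shows "\<exists>f. (\<forall>n. f n \<in> mod_hom R (free_module R (C n)) (free_module R (B n))) \<and>
    (\<forall>u\<in>carrier (free_module R (C 0)). \<epsilon> (f 0 u) = \<eta> u) \<and>
    (\<forall>n. \<forall>u\<in>carrier (free_module R (C (Suc n))). d n (f (Suc n) u) = f n (e n u))"
proof -
  let ?F = "\<lambda>n. free_module R (B n)" and ?E = "\<lambda>n. free_module R (C n)"
  note F = M.free_module_module
  note Bd = free_resolutionD[OF B] and Cd = free_resolutionD[OF C]
  \<comment> \<open>The map in degree \<open>n\<close> must send boundaries of \<open>C\<close> into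
    the image of \<open>d n\<close>, since this permits the next lift. The clause for
    \<open>n = 0\<close> keeps compatibility with the augmentations through the dependent
    choice.\<close>
  define P where "P n f \<longleftrightarrow> f \<in> mod_hom R (?E n) (?F n) \<and>
      (\<forall>u\<in>carrier (?E (Suc n)). f (e n u) \<in> d n ` carrier (?F (Suc n))) \<and>
      (n = 0 \<longrightarrow> (\<forall>u\<in>carrier (?E 0). \<epsilon> (f u) = \<eta> u))" for n f
  have "\<exists>f. \<forall>n. P n (f n) \<and> (\<forall>u\<in>carrier (?E (Suc n)). d n (f (Suc n) u) = f n (e n u))"
  proof (rule dependent_nat_choice)
    have "\<exists>f\<in>mod_hom R (?E 0) (?F 0). \<forall>u\<in>carrier (?E 0). \<epsilon> (f u) = \<eta> u"
      by (rule free_lift[OF M.R.cring_axioms F M Bd(1) Cd(1)])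
        (simp add: Bd(3) mod_hom_closed[OF Cd(1)])
    then obtain f where f: "f \<in> mod_hom R (?E 0) (?F 0)" "\<forall>u\<in>carrier (?E 0). \<epsilon> (f u) = \<eta> u" ..
    have "f (e 0 u) \<in> d 0 ` carrier (?F (Suc 0))" if "u \<in> carrier (?E (Suc 0))" for u
    proof -
      have u: "e 0 u \<in> carrier (?E 0)" by (rule mod_hom_closed[OF Cd(2) that])
      then have "\<epsilon> (f (e 0 u)) = \<zero>\<^bsub>M\<^esub>"
        using f(2) free_resolution_zero(1)[OF C that] by simp
      then show ?thesis
        using Bd(4)[OF mod_hom_closed[OF f(1) u]] by simp
    qed
    with f show "\<exists>f. P 0 f" by (auto simp: P_def)
  next
    fix f n assume "P n f"
    then have f: "f \<in> mod_hom R (?E n) (?F n)"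
      "\<And>u. u \<in> carrier (?E (Suc n)) \<Longrightarrow> f (e n u) \<in> d n ` carrier (?F (Suc n))"
      by (auto simp: P_def)
    obtain k where k: "k \<in> mod_hom R (?E (Suc n)) (?F (Suc n))"
      "\<And>u. u \<in> carrier (?E (Suc n)) \<Longrightarrow> d n (k u) = f (e n u)"
      using free_lift[OF M.R.cring_axioms F F Bd(2) mod_hom_comp[OF Cd(2) f(1)] f(2)] by blast
    have "k (e (Suc n) u) \<in> d (Suc n) ` carrier (?F (Suc (Suc n)))" if "u \<in> carrier (?E (Suc (Suc n)))" for u
    proof -
      have "d n (k (e (Suc n) u)) = f (e n (e (Suc n) u))"
        using k(2) mod_hom_closed[OF Cd(2) that] by simp
      also have "\<dots> = \<zero>\<^bsub>?F n\<^esub>"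
        using free_resolution_zero(2)[OF C that] mod_hom_zero[OF F F f(1)] by simp
      finally show ?thesis
        using Bd(5) mod_hom_closed[OF k(1) mod_hom_closed[OF Cd(2) that]] by blast
    qed
    with k show "\<exists>k. P (Suc n) k \<and> (\<forall>u\<in>carrier (?E (Suc n)). d n (k u) = f (e n u))"
      by (auto simp: P_def)
  qed
  then obtain f where "\<forall>n. P n (f n) \<and> (\<forall>u\<in>carrier (?E (Suc n)). d n (f (Suc n) u) = f n (e n u))" ..
  then show ?thesis by (intro exI[of _ f]) (auto simp: P_def)
qed

text \<open>Since \<open>p\<close> and the identity both cover the identity of \<open>M\<close>,
  their difference is null-homotopic. The identity is recorded in the degrees \<open>Suc n\<close>,
  those that concern higher \<open>Tor\<close>.\<close>

lemma homotopy_exists: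
  assumes C: "free_resolution R M C e \<eta>"
    and p: "\<And>n. p n \<in> mod_hom R (free_module R (C n)) (free_module R (C n))"
    and p0: "\<And>u. u \<in> carrier (free_module R (C 0)) \<Longrightarrow> \<eta> (p 0 u) = \<eta> u"
    and pn: "\<And>n u. u \<in> carrier (free_module R (C (Suc n))) \<Longrightarrow> e n (p (Suc n) u) = p n (e n u)"
  shows "\<exists>s. (\<forall>n. s n \<in> mod_hom R (free_module R (C n)) (free_module R (C (Suc n)))) \<and>
    (\<forall>n. \<forall>u\<in>carrier (free_module R (C (Suc n))).
      p (Suc n) u = u \<oplus>\<^bsub>free_module R (C (Suc n))\<^esub>
        (e (Suc n) (s (Suc n) u) \<oplus>\<^bsub>free_module R (C (Suc n))\<^esub> s n (e n u)))"
proof -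
  let ?E = "\<lambda>n. free_module R (C n)"
  note F = M.free_module_module
  note Cd = free_resolutionD[OF C]
  note ec = mod_hom_closed[OF Cd(2)] and pc = mod_hom_closed[OF p]
  \<comment> \<open>\<open>t n s u\<close> is what the next homotopy map must lift along
    \<open>e (Suc n)\<close>. It is a cycle as soon as \<open>e n\<close> after \<open>s\<close>
    agrees with \<open>p n\<close> minus the identity on the image of \<open>e n\<close>.\<close>
  define t where "t n s u = (p (Suc n) u \<ominus>\<^bsub>?E (Suc n)\<^esub> u) \<ominus>\<^bsub>?E (Suc n)\<^esub> s (e n u)" for n s u
  define P where "P n s \<longleftrightarrow> s \<in> mod_hom R (?E n) (?E (Suc n)) \<and>
      (\<forall>u\<in>carrier (?E (Suc n)). t n s u \<in> e (Suc n) ` carrier (?E (Suc (Suc n))))" for n s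
  have t_hom: "t n s \<in> mod_hom R (?E (Suc n)) (?E (Suc n))" if "s \<in> mod_hom R (?E n) (?E (Suc n))" for n s
    unfolding t_def by (intro mod_hom_minus_fun F p mod_hom_id mod_hom_comp[OF Cd(2) that])
  have aux: "P n s" if s: "s \<in> mod_hom R (?E n) (?E (Suc n))"
    and eq: "\<And>u. u \<in> carrier (?E (Suc n)) \<Longrightarrow> e n (s (e n u)) = p n (e n u) \<ominus>\<^bsub>?E n\<^esub> e n u" for n s
  proof -
    interpret E: module R "?E n" by (rule F)
    interpret E': module R "?E (Suc n)" by (rule F)
    have "e n (t n s u) = \<zero>\<^bsub>?E n\<^esub>" if u: "u \<in> carrier (?E (Suc n))" for u
    proof -
      have "e n (t n s u) = (e n (p (Suc n) u) \<ominus>\<^bsub>?E n\<^esub> e n u) \<ominus>\<^bsub>?E n\<^esub> e n (s (e n u))"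
        unfolding t_def using u ec pc mod_hom_closed[OF s]
        by (simp add: mod_hom_diff[OF F F Cd(2)])
      also have "\<dots> = \<zero>\<^bsub>?E n\<^esub>"
        unfolding pn[OF u] eq[OF u] using u ec pc by (simp add: a_minus_def E.M.r_neg)
      finally show ?thesis .
    qed
    then show ?thesis
      unfolding P_def using s Cd(5) mod_hom_closed[OF t_hom[OF s]] by blast
  qed
  have "\<exists>s. \<forall>n. P n (s n) \<and> (\<forall>u\<in>carrier (?E (Suc n)). e (Suc n) (s (Suc n) u) = t n (s n) u)"
  proof (rule dependent_nat_choice)
    interpret E: module R "?E 0" by (rule F)
    let ?h = "\<lambda>u. p 0 u \<ominus>\<^bsub>?E 0\<^esub> u"
    have h: "?h \<in> mod_hom R (?E 0) (?E 0)"
      by (intro mod_hom_minus_fun F p mod_hom_id)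
    have "?h u \<in> e 0 ` carrier (?E (Suc 0))" if u: "u \<in> carrier (?E 0)" for u
    proof -
      have "\<eta> (?h u) = \<eta> (p 0 u) \<ominus>\<^bsub>M\<^esub> \<eta> u"
        by (rule mod_hom_diff[OF F M Cd(1) pc[OF u] u])
      then have "\<eta> (?h u) = \<zero>\<^bsub>M\<^esub>"
        using mod_hom_closed[OF Cd(1) u] by (simp add: p0[OF u] a_minus_def M.r_neg)
      then show ?thesis
        using Cd(4) mod_hom_closed[OF h u] by blast
    qed
    from free_lift[OF M.R.cring_axioms F F Cd(2) h this]
    obtain s where s: "s \<in> mod_hom R (?E 0) (?E (Suc 0))" "\<And>u. u \<in> carrier (?E 0) \<Longrightarrow> e 0 (s u) = ?h u"
      by blast
    then show "\<exists>s. P 0 s"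
      using aux[OF s(1)] ec by blast
  next
    fix s n assume "P n s"
    then have s: "s \<in> mod_hom R (?E n) (?E (Suc n))"
      "\<And>u. u \<in> carrier (?E (Suc n)) \<Longrightarrow> t n s u \<in> e (Suc n) ` carrier (?E (Suc (Suc n)))"
      by (auto simp: P_def)
    from free_lift[OF M.R.cring_axioms F F Cd(2) t_hom[OF s(1)] s(2)]
    obtain k where k: "k \<in> mod_hom R (?E (Suc n)) (?E (Suc (Suc n)))"
      "\<And>u. u \<in> carrier (?E (Suc n)) \<Longrightarrow> e (Suc n) (k u) = t n s u" by blast
    interpret E': module R "?E (Suc n)" by (rule F)
    have "P (Suc n) k"
    proof (rule aux[OF k(1)])
      fix u assume u: "u \<in> carrier (?E (Suc (Suc n)))"
      have "t n s (e (Suc n) u) = p (Suc n) (e (Suc n) u) \<ominus>\<^bsub>?E (Suc n)\<^esub> e (Suc n) u"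
        unfolding t_def free_resolution_zero(2)[OF C u] mod_hom_zero[OF F F s(1)]
        using ec[OF u] pc by (simp add: a_minus_def module_minus_zero[OF F])
      then show "e (Suc n) (k (e (Suc n) u)) = p (Suc n) (e (Suc n) u) \<ominus>\<^bsub>?E (Suc n)\<^esub> e (Suc n) u"
        using k(2)[OF ec[OF u]] by simp
    qed
    with k show "\<exists>k. P (Suc n) k \<and> (\<forall>u\<in>carrier (?E (Suc n)). e (Suc n) (k u) = t n s u)"
      by blast
  qed
  then obtain s where s: "\<And>n. P n (s n)"
    "\<And>n u. u \<in> carrier (?E (Suc n)) \<Longrightarrow> e (Suc n) (s (Suc n) u) = t n (s n) u" by blast
  have sh: "s n \<in> mod_hom R (?E n) (?E (Suc n))" for n
    using s(1) by (simp add: P_def)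
  have "p (Suc n) u = u \<oplus>\<^bsub>?E (Suc n)\<^esub> (e (Suc n) (s (Suc n) u) \<oplus>\<^bsub>?E (Suc n)\<^esub> s n (e n u))"
    if u: "u \<in> carrier (?E (Suc n))" for n u
  proof -
    interpret E': module R "?E (Suc n)" by (rule F)
    show ?thesis
      unfolding s(2)[OF u] t_def
      by (rule E'.M.cancel_minus_twice) (use u pc ec mod_hom_closed[OF sh] in simp_all)
  qed
  with sh show ?thesis by blast
qed

text \<open>A cycle over \<open>C\<close> is sent to \<open>B\<close>, where it bounds, and then
  sent back. The round trip is homotopic to the identity, so the original cycle is a difference of
  two boundaries.\<close>

lemma acyclic_with_resolution:
  assumes N: "module R N" and B: "free_resolution R M B d \<epsilon>" and C: "free_resolution R M C e \<eta>"
    and ac: "acyclic_with R N B d n"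
  shows "acyclic_with R N C e n"
  unfolding acyclic_with_def
proof (intro ballI impI)
  let ?F = "\<lambda>n. free_module R (B n)" and ?E = "\<lambda>n. free_module R (C n)"
  let ?T = "\<lambda>X. tensor R X N" and ?t = "\<lambda>X Y. tensor_map R X Y N"
  note F = M.free_module_module and T = tensor_module[OF M.free_module_module N]
  note Bd = free_resolutionD[OF B] and Cd = free_resolutionD[OF C]
  obtain f where f: "\<And>n. f n \<in> mod_hom R (?E n) (?F n)"
    "\<And>u. u \<in> carrier (?E 0) \<Longrightarrow> \<epsilon> (f 0 u) = \<eta> u"
    "\<And>n u. u \<in> carrier (?E (Suc n)) \<Longrightarrow> d n (f (Suc n) u) = f n (e n u)"
    using chain_map_exists[OF B C] by blast
  obtain g where g: "\<And>n. g n \<in> mod_hom R (?F n) (?E n)"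
    "\<And>u. u \<in> carrier (?F 0) \<Longrightarrow> \<eta> (g 0 u) = \<epsilon> u"
    "\<And>n u. u \<in> carrier (?F (Suc n)) \<Longrightarrow> e n (g (Suc n) u) = g n (d n u)"
    using chain_map_exists[OF C B] by blast
  note fc = mod_hom_closed[OF f(1)] and gc = mod_hom_closed[OF g(1)]
  have gf: "(\<lambda>u. g n (f n u)) \<in> mod_hom R (?E n) (?E n)" for n
    by (rule mod_hom_comp[OF f(1) g(1)])
  have "\<exists>s. (\<forall>n. s n \<in> mod_hom R (?E n) (?E (Suc n))) \<and> (\<forall>n. \<forall>u\<in>carrier (?E (Suc n)).
      g (Suc n) (f (Suc n) u) = u \<oplus>\<^bsub>?E (Suc n)\<^esub>
        (e (Suc n) (s (Suc n) u) \<oplus>\<^bsub>?E (Suc n)\<^esub> s n (e n u)))"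
    by (rule homotopy_exists[OF C gf]) (simp_all add: g(2) f(2) g(3) f(3) fc)
  then obtain s where s: "\<And>n. s n \<in> mod_hom R (?E n) (?E (Suc n))"
    "\<And>n u. u \<in> carrier (?E (Suc n)) \<Longrightarrow> g (Suc n) (f (Suc n) u) = u \<oplus>\<^bsub>?E (Suc n)\<^esub>
        (e (Suc n) (s (Suc n) u) \<oplus>\<^bsub>?E (Suc n)\<^esub> s n (e n u))"
    by blast
  fix z assume z: "z \<in> carrier (?T (?E (Suc n)))"
    and dz: "?t (?E (Suc n)) (?E n) (e n) z = \<zero>\<^bsub>?T (?E n)\<^esub>"
  interpret T: module R "?T (?E (Suc n))" by (rule T)
  define y where "y = ?t (?E (Suc n)) (?F (Suc n)) (f (Suc n)) z"
  have y: "y \<in> carrier (?T (?F (Suc n)))"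
    unfolding y_def by (rule mod_hom_closed[OF tensor_map(1)[OF F F N f(1)] z])
  have "?t (?F (Suc n)) (?F n) (d n) y = ?t (?E (Suc n)) (?F n) (\<lambda>u. d n (f (Suc n) u)) z"
    unfolding y_def by (rule tensor_map_comp[OF N F F F f(1) Bd(2) z, symmetric])
  also have "\<dots> = ?t (?E (Suc n)) (?F n) (\<lambda>u. f n (e n u)) z"
    by (rule tensor_map_cong[OF N F F mod_hom_comp[OF f(1) Bd(2)] mod_hom_comp[OF Cd(2) f(1)] f(3) z])
  also have "\<dots> = ?t (?E n) (?F n) (f n) (?t (?E (Suc n)) (?E n) (e n) z)"
    by (rule tensor_map_comp[OF N F F F Cd(2) f(1) z])
  also have "\<dots> = \<zero>\<^bsub>?T (?F n)\<^esub>"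
    unfolding dz by (rule mod_hom_zero[OF T T tensor_map(1)[OF F F N f(1)]])
  finally obtain x where x: "x \<in> carrier (?T (?F (Suc (Suc n))))"
    "y = ?t (?F (Suc (Suc n))) (?F (Suc n)) (d (Suc n)) x"
    using ac y unfolding acyclic_with_def by blast
  define w where "w = ?t (?F (Suc (Suc n))) (?E (Suc (Suc n))) (g (Suc (Suc n))) x"
  have w: "w \<in> carrier (?T (?E (Suc (Suc n))))"
    unfolding w_def by (rule mod_hom_closed[OF tensor_map(1)[OF F F N g(1)] x(1)])
  define v where "v = ?t (?E (Suc n)) (?E (Suc (Suc n))) (s (Suc n)) z"
  have v: "v \<in> carrier (?T (?E (Suc (Suc n))))"
    unfolding v_def by (rule mod_hom_closed[OF tensor_map(1)[OF F F N s(1)] z])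
  note te = tensor_map(1)[OF F F N Cd(2)]
  let ?e = "?t (?E (Suc (Suc n))) (?E (Suc n)) (e (Suc n))"
  have "?e w = ?t (?F (Suc (Suc n))) (?E (Suc n)) (\<lambda>u. e (Suc n) (g (Suc (Suc n)) u)) x"
    unfolding w_def by (rule tensor_map_comp[OF N F F F g(1) Cd(2) x(1), symmetric])
  also have "\<dots> = ?t (?F (Suc (Suc n))) (?E (Suc n)) (\<lambda>u. g (Suc n) (d (Suc n) u)) x"
    by (rule tensor_map_cong[OF N F F mod_hom_comp[OF g(1) Cd(2)] mod_hom_comp[OF Bd(2) g(1)] g(3) x(1)])
  also have "\<dots> = ?t (?F (Suc n)) (?E (Suc n)) (g (Suc n)) y"
    unfolding x(2) by (rule tensor_map_comp[OF N F F F Bd(2) g(1) x(1)])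
  also have "\<dots> = ?t (?E (Suc n)) (?E (Suc n)) (\<lambda>u. g (Suc n) (f (Suc n) u)) z"
    unfolding y_def by (rule tensor_map_comp[OF N F F F f(1) g(1) z, symmetric])
  also have "\<dots> = ?t (?E (Suc n)) (?E (Suc n)) (\<lambda>u. u \<oplus>\<^bsub>?E (Suc n)\<^esub>
        (e (Suc n) (s (Suc n) u) \<oplus>\<^bsub>?E (Suc n)\<^esub> s n (e n u))) z"
    by (rule tensor_map_cong[OF N F F gf _ s(2) z])
      (intro mod_hom_plus F mod_hom_id mod_hom_comp[OF s(1) Cd(2)] mod_hom_comp[OF Cd(2) s(1)])
  also have "\<dots> = z \<oplus>\<^bsub>?T (?E (Suc n))\<^esub> (?e v \<oplus>\<^bsub>?T (?E (Suc n))\<^esub>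
      ?t (?E n) (?E (Suc n)) (s n) (?t (?E (Suc n)) (?E n) (e n) z))"
    unfolding v_def
    by (simp only: tensor_map_plus[OF N F F mod_hom_id mod_hom_plus[OF F F mod_hom_comp[OF s(1) Cd(2)]
            mod_hom_comp[OF Cd(2) s(1)]] z] tensor_map_id[OF N F z]
        tensor_map_plus[OF N F F mod_hom_comp[OF s(1) Cd(2)] mod_hom_comp[OF Cd(2) s(1)] z]
        tensor_map_comp[OF N F F F s(1) Cd(2) z] tensor_map_comp[OF N F F F Cd(2) s(1) z])
  \<comment> \<open>The homotopy term that passes through degree \<open>n\<close> vanishes because
    \<open>z\<close> is a cycle.\<close>
  also have "\<dots> = z \<oplus>\<^bsub>?T (?E (Suc n))\<^esub> ?e v"
    using mod_hom_closed[OF te v] by (simp add: dz mod_hom_zero[OF T T tensor_map(1)[OF F F N s(1)]])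
  finally have "z = ?e w \<ominus>\<^bsub>?T (?E (Suc n))\<^esub> ?e v"
    using z mod_hom_closed[OF te v] by (simp add: a_minus_def T.a_assoc T.r_neg)
  also have "\<dots> = ?e (w \<ominus>\<^bsub>?T (?E (Suc (Suc n)))\<^esub> v)"
    by (rule mod_hom_diff[OF T T te w v, symmetric])
  finally show "z \<in> ?e ` carrier (?T (?E (Suc (Suc n))))"
  proof (rule image_eqI)
    interpret T': module R "?T (?E (Suc (Suc n)))" by (rule T)
    show "w \<ominus>\<^bsub>?T (?E (Suc (Suc n)))\<^esub> v \<in> carrier (?T (?E (Suc (Suc n))))"
      using v w by simp
  qed
qed

text \<open>Changing the carrier leaves the addition of \<open>X\<close> untouched, so the elements
  of the homology module are still cosets in \<open>X\<close>.\<close>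

lemma zero_quot_module:
  assumes "module R X" "submodule I R X" "zero_module (quot_module (X\<lparr>carrier := Z\<rparr>) I)" "z \<in> Z" "Z \<subseteq> carrier X"
  shows "z \<in> I"
proof -
  interpret X: module R X by fact
  interpret I: submodule I R X by fact
  interpret KA: abelian_subgroup I X
    by (intro abelian_subgroupI3 additive_subgroup.intro I.subgroup_axioms X.abelian_group_axioms)
  have "I +>\<^bsub>X\<^esub> z \<in> carrier (quot_module (X\<lparr>carrier := Z\<rparr>) I)"
    using assms(4) by (auto simp: quot_module_def A_RCOSETS_def RCOSETS_def a_r_coset_def r_coset_def)
  then have "I +>\<^bsub>X\<^esub> z = I"
    using assms(3) by (auto simp: zero_module_def quot_module_def)
  then show ?thesis
    using KA.a_rcos_self assms(4,5) by blast
qed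

text \<open>\<open>Tor\<close> is read off from a resolution picked by \<open>SOME\<close>;
  \<open>free_resolution_exists\<close> guarantees that the pick is a resolution, and acyclicity
  then passes to \<open>C\<close>, whose index type is arbitrary.\<close>

lemma tor_acyclic:
  assumes N: "module R N" and Tor: "zero_module (Tor R M N (Suc n))" and C: "free_resolution R M C e \<eta>"
  shows "acyclic_with R N C e n"
proof -
  obtain B :: "nat \<Rightarrow> ('m + 'a) list set" and d where Bd: "(B, d) = (SOME (B, d). \<exists>\<epsilon>. free_resolution R M B d \<epsilon>)"
    by (metis surj_pair)
  have "\<exists>\<epsilon>. free_resolution R M B d \<epsilon>"
    using someI_ex[of "\<lambda>(B :: nat \<Rightarrow> ('m + 'a) list set, d). \<exists>\<epsilon>. free_resolution R M B d \<epsilon>"]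
      free_resolution_exists[OF M] Bd[symmetric] by auto
  then obtain \<epsilon> where B: "free_resolution R M B d \<epsilon>" ..
  note T = tensor_module[OF M.free_module_module N]
  note te = tensor_map(1)[OF M.free_module_module M.free_module_module N free_resolutionD(2)[OF B]]
  let ?T = "\<lambda>n. tensor R (free_module R (B n)) N"
  let ?\<delta> = "\<lambda>n. tensor_map R (free_module R (B (Suc n))) (free_module R (B n)) N (d n)"
  have Z: "zero_module (quot_module ((?T (Suc n))\<lparr>carrier := a_kernel (?T (Suc n)) (?T n) (?\<delta> n)\<rparr>)
      (?\<delta> (Suc n) ` carrier (?T (Suc (Suc n)))))"
    using Tor unfolding Tor_def Bd[symmetric] by (simp add: tor_of_def Let_def)
  have I: "submodule (?\<delta> (Suc n) ` carrier (?T (Suc (Suc n)))) R (?T (Suc n))"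
    by (rule image_submodule[OF T T te module.carrier_is_submodule[OF T]])
  have "acyclic_with R N B d n"
    unfolding acyclic_with_def
    using zero_quot_module[OF T I Z] by (auto simp: a_kernel_def kernel_def)
  then show ?thesis
    by (rule acyclic_with_resolution[OF N B C])
qed

end

section \<open>Tensoring finite free modules in coordinates\<close>

context
  fixes R :: "('a, 'r) ring_scheme" and N :: "('a, 'n, 'y) module_scheme" (structure)
  assumes N: "module R N"
begin

interpretation N: module R N by (rule N)

lemma tensor_coord_exists:
  "\<exists>k. \<forall>c. k c \<in> mod_hom R (tensor R (free_module R B) N) N \<and>
    (\<forall>u\<in>carrier (free_module R B). \<forall>n\<in>carrier N. k c (pure_tensor R (free_module R B) N u n) = u c \<odot> n)"
proof (rule choice, rule allI)
  fix c
  note co = N.free_module_coeff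
  show "\<exists>h. h \<in> mod_hom R (tensor R (free_module R B) N) N \<and>
    (\<forall>u\<in>carrier (free_module R B). \<forall>n\<in>carrier N. h (pure_tensor R (free_module R B) N u n) = u c \<odot> n)"
    by (rule tensor_lift_exists[OF N.free_module_module N N])
      (auto simp: co free_module_simps(3,4) N.smult_l_distr N.smult_r_distr N.smult_assoc1[symmetric] N.m_comm)
qed

text \<open>For finite \<open>B\<close>, the component at \<open>c\<close> of the isomorphism
  between \<open>F \<otimes> N\<close> and a power of \<open>N\<close>. A choice suffices because
  pure tensors determine it on the carrier.\<close>

definition tensor_coord :: "'b set \<Rightarrow> 'b \<Rightarrow> (('b \<Rightarrow> 'a) \<times> 'n \<Rightarrow> 'a) set \<Rightarrow> 'n" where
  "tensor_coord B = (SOME k. \<forall>c. k c \<in> mod_hom R (tensor R (free_module R B) N) N \<and>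
    (\<forall>u\<in>carrier (free_module R B). \<forall>n\<in>carrier N. k c (pure_tensor R (free_module R B) N u n) = u c \<odot> n))"

lemma tensor_coord:
  "tensor_coord B c \<in> mod_hom R (tensor R (free_module R B) N) N"
  "u \<in> carrier (free_module R B) \<Longrightarrow> n \<in> carrier N \<Longrightarrow>
    tensor_coord B c (pure_tensor R (free_module R B) N u n) = u c \<odot> n"
  using someI_ex[OF tensor_coord_exists[of B], folded tensor_coord_def] by auto

lemma pure_tensor_hom:
  assumes X: "module R X" and x: "x \<in> carrier X"
  shows "(\<lambda>n. pure_tensor R X N x n) \<in> mod_hom R N (tensor R X N)"
  using x by (auto simp: mod_hom_def pure_tensor_closed[OF X N] pure_tensor_bilinear[OF X N])

text \<open>Both sides are homomorphisms in \<open>z\<close>, so it is enough to expand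
  \<open>u\<close> in the basis for one pure tensor. In particular, coordinates determine a
  tensor.\<close>

lemma tensor_expand:
  assumes B: "finite B" and z: "z \<in> carrier (tensor R (free_module R B) N)"
  shows "z = (\<Oplus>\<^bsub>tensor R (free_module R B) N\<^esub>b\<in>B.
    pure_tensor R (free_module R B) N (free_basis R b) (tensor_coord B b z))"
proof -
  let ?F = "free_module R B"
  let ?T = "tensor R ?F N"
  note F = N.free_module_module[of B]
  note T = tensor_module[OF F N]
  note b = N.free_basis_closed[of _ B]
  note ph = pure_tensor_hom[OF F b]
  have h: "(\<lambda>z. \<Oplus>\<^bsub>?T\<^esub>b\<in>B. pure_tensor R ?F N (free_basis R b) (tensor_coord B b z)) \<in> mod_hom R ?T ?T"
    by (intro mod_hom_sum_fun[OF T T B] mod_hom_comp[OF tensor_coord(1) ph])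
  show ?thesis
  proof (rule tensor_hom_eq[OF F N T mod_hom_id h _ z])
    fix u n assume u: "u \<in> carrier ?F" and n: "n \<in> carrier N"
    have ph': "(\<lambda>u. pure_tensor R ?F N u n) \<in> mod_hom R ?F ?T"
      using n by (auto simp: mod_hom_def pure_tensor_closed[OF F N] pure_tensor_bilinear[OF F N])
    have "pure_tensor R ?F N u n = lin_ext R ?T (\<lambda>b. pure_tensor R ?F N (free_basis R b) n) u"
      by (rule free_hom_lin_ext[OF N.R.cring_axioms T ph' u])
    also have "\<dots> = (\<Oplus>\<^bsub>?T\<^esub>b\<in>B. u b \<odot>\<^bsub>?T\<^esub> pure_tensor R ?F N (free_basis R b) n)"
      by (intro lin_ext_finite[OF N.R.cring_axioms T B _ u] funcsetI pure_tensor_closed[OF F N] b n)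
    also have "\<dots> = (\<Oplus>\<^bsub>?T\<^esub>b\<in>B. pure_tensor R ?F N (free_basis R b) (tensor_coord B b (pure_tensor R ?F N u n)))"
    proof -
      interpret T: module R ?T by (rule T)
      show ?thesis
        using u n N.free_module_coeff[OF u] b
        by (intro T.finsum_cong')
          (auto simp: tensor_coord(2) pure_tensor_bilinear(4)[OF F N] pure_tensor_closed[OF F N])
    qed
    finally show "pure_tensor R ?F N u n = \<dots>" .
  qed
qed

lemma tensor_coord_inject:
  assumes B: "finite B" and z: "z \<in> carrier (tensor R (free_module R B) N)"
    and 0: "\<And>b. b \<in> B \<Longrightarrow> tensor_coord B b z = \<zero>"
  shows "z = \<zero>\<^bsub>tensor R (free_module R B) N\<^esub>"
proof -
  let ?F = "free_module R B"
  let ?T = "tensor R ?F N"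
  note F = N.free_module_module[of B]
  interpret T: module R ?T by (rule tensor_module[OF F N])
  have "(\<Oplus>\<^bsub>?T\<^esub>b\<in>B. pure_tensor R ?F N (free_basis R b) (tensor_coord B b z)) = (\<Oplus>\<^bsub>?T\<^esub>b\<in>B. \<zero>\<^bsub>?T\<^esub>)"
    using 0 mod_hom_zero[OF N T.module_axioms pure_tensor_hom[OF F N.free_basis_closed]]
    by (intro T.finsum_cong') auto
  also have "\<dots> = \<zero>\<^bsub>?T\<^esub>" by simp
  finally show ?thesis using tensor_expand[OF B z] by simp
qed

lemma tensor_coord_map:
  assumes B: "finite B" and h: "h \<in> mod_hom R (free_module R B) (free_module R C)"
    and z: "z \<in> carrier (tensor R (free_module R B) N)"
  shows "tensor_coord C c (tensor_map R (free_module R B) (free_module R C) N h z) =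
    (\<Oplus>b\<in>B. h (free_basis R b) c \<odot> tensor_coord B b z)"
proof -
  note F = N.free_module_module
  note T = tensor_module[OF F N]
  have hb: "h (free_basis R b) c \<in> carrier R" if "b \<in> B" for b
    using N.free_module_coeff[OF mod_hom_closed[OF h N.free_basis_closed[OF that]]] .
  show ?thesis
  proof (rule tensor_hom_eq[OF F N N mod_hom_comp[OF tensor_map(1)[OF F F N h] tensor_coord(1)] _ _ z])
    show "(\<lambda>z. \<Oplus>b\<in>B. h (free_basis R b) c \<odot> tensor_coord B b z) \<in>
        mod_hom R (tensor R (free_module R B) N) N"
      by (intro mod_hom_sum_fun[OF T N B] mod_hom_scale[OF T N] tensor_coord(1) hb)
  next
    fix u n assume u: "u \<in> carrier (free_module R B)" and n: "n \<in> carrier N"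
    have "tensor_coord C c (tensor_map R (free_module R B) (free_module R C) N h
        (pure_tensor R (free_module R B) N u n)) = h u c \<odot> n"
      using u n mod_hom_closed[OF h] by (simp add: tensor_map(2)[OF F F N h] tensor_coord(2))
    also have "\<dots> = (\<Oplus>b\<in>B. (u b \<otimes>\<^bsub>R\<^esub> h (free_basis R b) c) \<odot> n)"
      unfolding free_hom_coord[OF N.R.cring_axioms B h u]
      using hb N.free_module_coeff[OF u] n by (intro finsum_smult_rdistr[OF N B]) auto
    also have "\<dots> = (\<Oplus>b\<in>B. h (free_basis R b) c \<odot>
        tensor_coord B b (pure_tensor R (free_module R B) N u n))"
      using hb N.free_module_coeff[OF u] n u
      by (intro N.finsum_cong') (auto simp: tensor_coord(2) N.m_comm simp flip: N.smult_assoc1)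
    finally show "tensor_coord C c (tensor_map R (free_module R B) (free_module R C) N h
        (pure_tensor R (free_module R B) N u n)) = \<dots>" .
  qed
qed

text \<open>This frees all later arguments of tensor products: vanishing \<open>Tor\<close> becomes
  solvability of linear systems over \<open>N\<close> whose matrices are those of the
  differentials.\<close>

lemma acyclic_coords:
  assumes ac: "acyclic_with R N C e j"
    and e: "\<And>n. e n \<in> mod_hom R (free_module R (C (Suc n))) (free_module R (C n))"
    and C: "\<And>n. finite (C n)" and n: "n \<in> C (Suc j) \<rightarrow> carrier N"
    and 0: "\<And>c. c \<in> C j \<Longrightarrow> (\<Oplus>b\<in>C (Suc j). e j (free_basis R b) c \<odot> n b) = \<zero>"
  shows "\<exists>p\<in>C (Suc (Suc j)) \<rightarrow> carrier N. \<forall>b\<in>C (Suc j).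
    n b = (\<Oplus>c\<in>C (Suc (Suc j)). e (Suc j) (free_basis R c) b \<odot> p c)"
proof -
  let ?F = "\<lambda>n. free_module R (C n)"
  let ?T = "\<lambda>n. tensor R (?F n) N"
  note F = N.free_module_module
  note T = tensor_module[OF F N]
  interpret T: module R "?T (Suc j)" by (rule T)
  have nc: "n b \<in> carrier N" if "b \<in> C (Suc j)" for b
    using n that by auto
  \<comment> \<open>The tensor with coordinates \<open>n\<close>. The hypothesis makes it a cycle,
    and the coordinates of a preimage under the next differential solve the system.\<close>
  define z where "z = (\<Oplus>\<^bsub>?T (Suc j)\<^esub>b\<in>C (Suc j). pure_tensor R (?F (Suc j)) N (free_basis R b) (n b))"
  have zb: "(\<lambda>b. pure_tensor R (?F (Suc j)) N (free_basis R b) (n b)) \<in> C (Suc j) \<rightarrow> carrier (?T (Suc j))"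
    using n by (intro funcsetI pure_tensor_closed[OF F N] N.free_basis_closed) auto
  have z: "z \<in> carrier (?T (Suc j))"
    unfolding z_def using zb by (rule T.finsum_closed)
  have zc: "tensor_coord (C (Suc j)) b z = n b" if b: "b \<in> C (Suc j)" for b
  proof -
    have "tensor_coord (C (Suc j)) b z = (\<Oplus>a\<in>C (Suc j). free_basis R a b \<odot> n a)"
      unfolding z_def mod_hom_finsum[OF T N tensor_coord(1) C zb]
      using N.free_basis_closed[of _ "C (Suc j)"]
      by (intro N.finsum_cong') (auto simp: tensor_coord(2) nc free_basis_def)
    also have "\<dots> = (\<Oplus>a\<in>C (Suc j). if b = a then n a else \<zero>)"
      by (intro N.finsum_cong') (auto simp: free_basis_def nc)
    also have "\<dots> = n b"
      using N.finsum_singleton[OF b C n] by simp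
    finally show ?thesis .
  qed
  have "tensor_map R (?F (Suc j)) (?F j) N (e j) z = \<zero>\<^bsub>?T j\<^esub>"
  proof (rule tensor_coord_inject[OF C mod_hom_closed[OF tensor_map(1)[OF F F N e] z]])
    fix c assume c: "c \<in> C j"
    have "tensor_coord (C j) c (tensor_map R (?F (Suc j)) (?F j) N (e j) z) =
        (\<Oplus>b\<in>C (Suc j). e j (free_basis R b) c \<odot> tensor_coord (C (Suc j)) b z)"
      by (rule tensor_coord_map[OF C e z])
    also have "\<dots> = (\<Oplus>b\<in>C (Suc j). e j (free_basis R b) c \<odot> n b)"
      using n N.free_module_coeff[OF mod_hom_closed[OF e N.free_basis_closed]]
      by (intro N.finsum_cong') (auto simp: zc)
    finally show "tensor_coord (C j) c (tensor_map R (?F (Suc j)) (?F j) N (e j) z) = \<zero>"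
      using 0[OF c] by simp
  qed
  then obtain y where y: "y \<in> carrier (?T (Suc (Suc j)))"
    "z = tensor_map R (?F (Suc (Suc j))) (?F (Suc j)) N (e (Suc j)) y"
    using ac z unfolding acyclic_with_def by blast
  have "n b = (\<Oplus>c\<in>C (Suc (Suc j)). e (Suc j) (free_basis R c) b \<odot> tensor_coord (C (Suc (Suc j))) c y)"
    if "b \<in> C (Suc j)" for b
    using zc[OF that] tensor_coord_map[OF C e y(1), of b] y(2) by simp
  then show ?thesis
    using mod_hom_closed[OF tensor_coord(1) y(1)]
    by (intro bexI[of _ "\<lambda>c. tensor_coord (C (Suc (Suc j))) c y"]) auto
qed

end

section \<open>Generating families and syzygies\<close>

lemma finsum_submodule:
  assumes "module R V" "submodule K R V" "finite A" "f \<in> A \<rightarrow> K"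
  shows "finsum V f A \<in> K"
proof -
  interpret V: module R V by fact
  note K = V.submoduleE[OF assms(2)] V.submodule_zero[OF assms(2)]
  show ?thesis
    using assms(3,4)
  proof (induction A)
    case (insert x A)
    then have "f \<in> A \<rightarrow> carrier V" "f x \<in> carrier V"
      using K(1) by auto
    with insert K(5) show ?case by (simp add: Pi_iff)
  qed (simp add: K)
qed

definition generates ::
    "('a, 'r) ring_scheme \<Rightarrow> ('a, 'm, 'x) module_scheme \<Rightarrow> 'm set \<Rightarrow> 'b set \<Rightarrow> ('b \<Rightarrow> 'm) \<Rightarrow> bool" where
  "generates R V K B x \<longleftrightarrow> finite B \<and> x \<in> B \<rightarrow> carrier V \<and>
     lin_ext R V x ` carrier (free_module R B) = K"

definition relations ::
    "('a, 'r) ring_scheme \<Rightarrow> ('a, 'm, 'x) module_scheme \<Rightarrow> 'b set \<Rightarrow> ('b \<Rightarrow> 'm) \<Rightarrow> ('b \<Rightarrow> 'a) set" where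
  "relations R V B x = {u \<in> carrier (free_module R B). lin_ext R V x u = \<zero>\<^bsub>V\<^esub>}"

text \<open>Minimality by number of generators rather than through the quotient by
  \<open>\<mm>K\<close>: existence is then well-ordering of the naturals, and exchanging the
  generators over the same index set preserves it.\<close>

definition min_generates ::
    "('a, 'r) ring_scheme \<Rightarrow> ('a, 'm, 'x) module_scheme \<Rightarrow> 'm set \<Rightarrow> nat set \<Rightarrow> (nat \<Rightarrow> 'm) \<Rightarrow> bool" where
  "min_generates R V K B x \<longleftrightarrow> generates R V K B x \<and>
     (\<forall>(C :: nat set) y. generates R V K C y \<longrightarrow> card B \<le> card C)"

context
  fixes R :: "('a, 'r) ring_scheme" (structure) and V :: "('a, 'm, 'x) module_scheme"
  assumes V: "module R V"
begin

interpretation V: module R V by (rule V)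

lemma lin_ext_mem:
  assumes "submodule K R V" "finite B" "x \<in> B \<rightarrow> K" "u \<in> carrier (free_module R B)"
  shows "lin_ext R V x u \<in> K"
proof -
  note K = V.submoduleE[OF assms(1)]
  have "x \<in> B \<rightarrow> carrier V" using assms(3) K(1) by auto
  then show ?thesis
    using K(4) V.free_module_coeff[OF assms(4)] funcset_mem[OF assms(3)]
    by (subst lin_ext_finite[OF V.R.cring_axioms V assms(2) _ assms(4)])
      (auto intro!: finsum_submodule[OF V assms(1,2)])
qed

lemma generates_submodule: "generates R V K B x \<Longrightarrow> submodule K R V"
  using image_submodule[OF V.free_module_module V lin_ext_hom[OF V]
      module.carrier_is_submodule[OF V.free_module_module]]
  by (auto simp: generates_def)

lemma generates_mem: "generates R V K B x \<Longrightarrow> b \<in> B \<Longrightarrow> x b \<in> K"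
  unfolding generates_def
  by (metis lin_ext_basis[OF V] V.free_basis_closed imageI)

lemma generatesI:
  assumes "submodule K R V" "finite B" "x \<in> B \<rightarrow> K"
    and "\<And>y. y \<in> K \<Longrightarrow> \<exists>u\<in>carrier (free_module R B). lin_ext R V x u = y"
  shows "generates R V K B x"
  unfolding generates_def
  using assms lin_ext_mem[OF assms(1-3)] V.submoduleE(1)[OF assms(1)] by blast

lemma generatesE:
  assumes "generates R V K B x" "y \<in> K"
  obtains u where "u \<in> carrier (free_module R B)" "y = lin_ext R V x u"
  using assms unfolding generates_def by blast

lemma relations_submodule:
  "x \<in> B \<rightarrow> carrier V \<Longrightarrow> submodule (relations R V B x) R (free_module R B)"
  unfolding relations_def
  by (intro ker_submodule[OF V.free_module_module V lin_ext_hom[OF V]]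
      module.carrier_is_submodule V.free_module_module)

lemma submodule_gen_generates:
  assumes "finite S" "S \<subseteq> carrier V"
  shows "\<exists>(B :: nat set) x. generates R V (submodule_gen R V S) B x"
proof -
  obtain x where x: "bij_betw x {0..<card S} S"
    using ex_bij_betw_nat_finite[OF assms(1)] by blast
  let ?B = "{0..<card S}"
  have xc: "x \<in> ?B \<rightarrow> carrier V"
    using bij_betwE[OF x] assms(2) by auto
  let ?K = "lin_ext R V x ` carrier (free_module R ?B)"
  have K: "generates R V ?K ?B x"
    using xc by (simp add: generates_def)
  have "x ` ?B \<subseteq> ?K"
    by (intro image_subsetI generates_mem[OF K])
  note this[unfolded bij_betw_imp_surj_on[OF x]]
  then have "submodule_gen R V S \<subseteq> ?K"
    by (intro submodule_gen_least generates_submodule[OF K])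
  moreover have "?K \<subseteq> submodule_gen R V S"
    using lin_ext_mem[OF submodule_gen_submodule[OF V assms(2)], of ?B x] bij_betwE[OF x]
      submodule_gen_incl[of S R V] by blast
  ultimately show ?thesis using K by (metis subset_antisym)
qed

lemma min_generates_exists:
  assumes "generates R V K (B :: nat set) x"
  shows "\<exists>C y. min_generates R V K C y"
proof -
  let ?P = "\<lambda>p. generates R V K (fst p :: nat set) (snd p)"
  obtain p where "?P p" "\<forall>q. ?P q \<longrightarrow> card (fst p) \<le> card (fst q)"
    using ex_has_least_nat[of ?P "(B, x)" "\<lambda>p. card (fst p)"] assms by auto
  then show ?thesis
    unfolding min_generates_def by (intro exI[of _ "fst p"] exI[of _ "snd p"]) auto
qed

text \<open>A unit coefficient in a relation would allow dropping one generator.\<close>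
lemma min_generates_nonunit:
  assumes min: "min_generates R V K B x" and u: "u \<in> relations R V B x" and b: "b \<in> B"
  shows "u b \<notin> Units R"
proof
  assume ub: "u b \<in> Units R"
  have gen: "generates R V K B x" and B: "finite B" and xc: "x \<in> B \<rightarrow> carrier V"
    using min by (auto simp: min_generates_def generates_def)
  have uc: "u \<in> carrier (free_module R B)" and u0: "lin_ext R V x u = \<zero>\<^bsub>V\<^esub>"
    using u by (auto simp: relations_def)
  let ?F = "free_module R B"
  interpret F: module R ?F by (rule V.free_module_module)
  note h = lin_ext_hom[OF V xc]
  have xc': "x \<in> (B - {b}) \<rightarrow> carrier V" using xc by auto
  have "generates R V K (B - {b}) x"
  proof (rule generatesI[OF generates_submodule[OF gen]])
    show "finite (B - {b})" "x \<in> (B - {b}) \<rightarrow> K"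
      using B generates_mem[OF gen] by auto
  next
    fix y assume "y \<in> K"
    then obtain r where r: "r \<in> carrier ?F" "y = lin_ext R V x r"
      using generatesE[OF gen] by blast
    \<comment> \<open>Chosen so that subtracting \<open>c\<close> times the relation
      \<open>u\<close> clears coordinate \<open>b\<close> of \<open>r\<close> without changing the
      element that \<open>r\<close> represents.\<close>
    define c where "c = r b \<otimes> inv u b"
    have rb: "r b \<in> carrier R" by (rule V.free_module_coeff[OF r(1)])
    have c: "c \<in> carrier R" unfolding c_def using rb ub by simp
    define s where "s = r \<oplus>\<^bsub>?F\<^esub> (\<ominus> c) \<odot>\<^bsub>?F\<^esub> u"
    have s: "s \<in> carrier ?F" unfolding s_def using r(1) c uc by simp
    have "c \<otimes> u b = r b"
      unfolding c_def using rb ub by (simp add: V.m_assoc V.R.Units_closed)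
    then have "s b = \<zero>"
      unfolding s_def free_module_simps using c rb ub
      by (simp add: V.R.l_minus V.R.r_neg V.R.Units_closed)
    then have "s \<in> carrier (free_module R (B - {b}))"
      using s by (auto simp: free_module_simps)
    moreover have "lin_ext R V x s = y"
      unfolding s_def using r uc c mod_hom_closed[OF h r(1)]
      by (simp add: mod_hom_add[OF h] mod_hom_smult[OF h] u0)
    ultimately show "\<exists>w\<in>carrier (free_module R (B - {b})). lin_ext R V x w = y" by blast
  qed
  then have "card B \<le> card (B - {b})"
    using min by (auto simp: min_generates_def)
  then show False
    using card_Diff1_less[OF B b] by linarith
qed

end

text \<open>\<open>v\<close> lists the columns of some differential of a resolution of
  \<open>M\<close>, its position forgotten. Only finitely many stages are fixed, so generators of
  the next stage can be chosen after properties of the earlier ones have been proved.\<close>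

inductive syzygy ::
    "('a, 'r) ring_scheme \<Rightarrow> ('a, 'm, 'x) module_scheme \<Rightarrow> nat set \<Rightarrow> nat set \<Rightarrow> (nat \<Rightarrow> nat \<Rightarrow> 'a) \<Rightarrow> bool"
  for R M where
  first: "generates R M (carrier M) B x \<Longrightarrow> generates R (free_module R B) (relations R M B x) C v \<Longrightarrow>
    syzygy R M B C v"
| step: "syzygy R M B C v \<Longrightarrow>
    generates R (free_module R C) (relations R (free_module R B) C v) D w \<Longrightarrow> syzygy R M C D w"

lemma syzygy_family:
  "syzygy R M B C v \<Longrightarrow> finite B \<and> finite C \<and> v \<in> C \<rightarrow> carrier (free_module R B)"
  by (induction rule: syzygy.induct) (simp_all add: generates_def)

section \<open>Completing stretches of syzygies to free resolutions\<close>

context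
  fixes R :: "('a, 'r) ring_scheme" and M :: "('a, 'm, 'x) module_scheme" and N :: "('a, 'n, 'y) module_scheme" (structure)
  assumes M: "module R M" and N: "module R N"
    and noeth: "\<And>B K. finite B \<Longrightarrow> submodule K R (free_module R B) \<Longrightarrow>
      \<exists>(D :: nat set) w. generates R (free_module R (B :: nat set)) K D w"
    and Tor: "\<And>i. i > 0 \<Longrightarrow> zero_module (Tor R M N i)"
begin

interpretation M: module R M by (rule M)

text \<open>An infinite tail of a resolution that begins with an arbitrary matrix
  \<open>v 0\<close>; the link to \<open>M\<close> is added in \<open>syzygy_path\<close>.\<close>

definition syz_path :: "(nat \<Rightarrow> nat set) \<Rightarrow> (nat \<Rightarrow> nat \<Rightarrow> nat \<Rightarrow> 'a) \<Rightarrow> bool" where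
  "syz_path C v \<longleftrightarrow> (\<forall>n. finite (C n)) \<and> (\<forall>n. v n \<in> C (Suc n) \<rightarrow> carrier (free_module R (C n))) \<and>
    (\<forall>n. generates R (free_module R (C (Suc n)))
      (relations R (free_module R (C n)) (C (Suc n)) (v n)) (C (Suc (Suc n))) (v (Suc n)))"

lemma syz_path_exists:
  assumes "finite B" "finite C" "v \<in> C \<rightarrow> carrier (free_module R B)"
  shows "\<exists>Cs vs. syz_path Cs vs \<and> Cs 0 = B \<and> Cs (Suc 0) = C \<and> vs 0 = v"
proof -
  define P :: "nat \<Rightarrow> nat set \<times> nat set \<times> (nat \<Rightarrow> nat \<Rightarrow> 'a) \<Rightarrow> bool" where
    "P n s \<longleftrightarrow> finite (fst s) \<and> finite (fst (snd s)) \<and>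
      snd (snd s) \<in> fst (snd s) \<rightarrow> carrier (free_module R (fst s)) \<and> (n = 0 \<longrightarrow> s = (B, C, v))" for n s
  define Q :: "nat set \<times> nat set \<times> (nat \<Rightarrow> nat \<Rightarrow> 'a) \<Rightarrow> nat set \<times> nat set \<times> (nat \<Rightarrow> nat \<Rightarrow> 'a) \<Rightarrow> bool" where
    "Q s s' \<longleftrightarrow> fst s' = fst (snd s) \<and>
      generates R (free_module R (fst s')) (relations R (free_module R (fst s)) (fst s') (snd (snd s)))
        (fst (snd s')) (snd (snd s'))" for s s'
  have "\<exists>f. \<forall>n. P n (f n) \<and> Q (f n) (f (Suc n))"
  proof (rule dependent_nat_choice)
    show "\<exists>s. P 0 s" using assms by (intro exI[of _ "(B, C, v)"]) (simp add: P_def)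
  next
    fix s n assume "P n s"
    then have s: "finite (fst (snd s))" "snd (snd s) \<in> fst (snd s) \<rightarrow> carrier (free_module R (fst s))"
      by (auto simp: P_def)
    obtain D w where D: "generates R (free_module R (fst (snd s)))
        (relations R (free_module R (fst s)) (fst (snd s)) (snd (snd s))) (D :: nat set) w"
      using noeth[OF s(1) relations_submodule[OF M.free_module_module s(2)]] by blast
    then have "finite D" "w \<in> D \<rightarrow> carrier (free_module R (fst (snd s)))"
      by (simp_all add: generates_def)
    then show "\<exists>s'. P (Suc n) s' \<and> Q s s'"
      using s(1) D by (intro exI[of _ "(fst (snd s), D, w)"]) (simp add: P_def Q_def)
  qed
  then obtain f where f: "\<forall>n. P n (f n) \<and> Q (f n) (f (Suc n))" ..
  have P: "P n (f n)" and Q: "Q (f n) (f (Suc n))" for n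
    using f by simp_all
  have eq: "fst (f (Suc n)) = fst (snd (f n))" for n
    using Q by (simp add: Q_def)
  have "syz_path (\<lambda>n. fst (f n)) (\<lambda>n. snd (snd (f n)))"
    unfolding syz_path_def using P Q eq by (simp add: P_def Q_def)
  moreover have "fst (f 0) = B" "fst (f (Suc 0)) = C" "snd (snd (f 0)) = v"
    using P[of 0] eq[of 0] by (simp_all add: P_def)
  ultimately show ?thesis by blast
qed

lemma syz_path_cons:
  assumes "syz_path Cs vs" "finite B" "v \<in> Cs 0 \<rightarrow> carrier (free_module R B)"
    and "generates R (free_module R (Cs 0)) (relations R (free_module R B) (Cs 0) v) (Cs (Suc 0)) (vs 0)"
  shows "syz_path (case_nat B Cs) (case_nat v vs)"
  using assms unfolding syz_path_def by (auto split: nat.split)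

text \<open>The induction walks back from the matrix \<open>v\<close> to the generators of
  \<open>M\<close>, each step prepending one earlier matrix. The shift \<open>j\<close> records
  where the given tail begins in the result.\<close>

lemma syzygy_path:
  assumes "syzygy R M B C v" "syz_path Cs vs" "Cs 0 = B" "Cs (Suc 0) = C" "vs 0 = v"
  shows "\<exists>Ds ws x j. syz_path Ds ws \<and> generates R M (carrier M) (Ds 0) x \<and>
    generates R (free_module R (Ds 0)) (relations R M (Ds 0) x) (Ds (Suc 0)) (ws 0) \<and>
    (\<forall>i. Ds (j + i) = Cs i) \<and> (\<forall>i. ws (j + i) = vs i)"
  using assms
proof (induction arbitrary: Cs vs rule: syzygy.induct)
  case (first B x C v)
  then show ?case by (intro exI[of _ Cs] exI[of _ vs] exI[of _ x] exI[of _ 0]) auto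
next
  case (step B C v D w)
  define Ds where "Ds = case_nat B Cs"
  define ws where "ws = case_nat v vs"
  have "syz_path Ds ws"
    unfolding Ds_def ws_def using syzygy_family[OF step.hyps(1)] step.hyps(2) step.prems
    by (intro syz_path_cons) auto
  moreover have "Ds 0 = B" "Ds (Suc 0) = C" "ws 0 = v"
    using step.prems by (auto simp: Ds_def ws_def)
  ultimately obtain Es us x j where *: "syz_path Es us" "generates R M (carrier M) (Es 0) x"
    "generates R (free_module R (Es 0)) (relations R M (Es 0) x) (Es (Suc 0)) (us 0)"
    "\<And>i. Es (j + i) = Ds i" "\<And>i. us (j + i) = ws i"
    using step.IH[of Ds ws] by blast
  have "Es (Suc j + i) = Cs i" "us (Suc j + i) = vs i" for i
    using *(4)[of "Suc i"] *(5)[of "Suc i"] by (auto simp: Ds_def ws_def)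
  with *(1-3) show ?case by blast
qed

lemma syz_path_resolution:
  assumes "syz_path C v" "generates R M (carrier M) (C 0) x"
    "generates R (free_module R (C 0)) (relations R M (C 0) x) (C (Suc 0)) (v 0)"
  shows "free_resolution R M C (\<lambda>n. lin_ext R (free_module R (C n)) (v n)) (lin_ext R M x)"
proof -
  have "lin_ext R (free_module R (C n)) (v n) \<in>
      mod_hom R (free_module R (C (Suc n))) (free_module R (C n))" for n
    using assms(1) by (intro lin_ext_hom M.free_module_module) (simp add: syz_path_def)
  moreover have "lin_ext R M x \<in> mod_hom R (free_module R (C 0)) M"
    using assms(2) by (intro lin_ext_hom M) (simp add: generates_def)
  ultimately show ?thesis
    unfolding free_resolution_def Let_def a_kernel_def kernel_def
    using assms by (simp add: syz_path_def generates_def relations_def)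
qed

text \<open>The prescribed \<open>v\<close> and \<open>w\<close> are made consecutive differentials
  of one resolution: \<open>w\<close> is continued to an infinite tail, \<open>v\<close> is put in
  front, and the earlier stages are prepended. Vanishing \<open>Tor\<close> is then applied in
  degree \<open>Suc j\<close>.\<close>

lemma syzygy_exact:
  assumes S: "syzygy R M B C v"
    and D: "generates R (free_module R C) (relations R (free_module R B) C v) (D :: nat set) w"
    and n: "n \<in> C \<rightarrow> carrier N"
    and 0: "\<And>c. c \<in> B \<Longrightarrow> (\<Oplus>b\<in>C. v b c \<odot> n b) = \<zero>"
  shows "\<exists>p\<in>D \<rightarrow> carrier N. \<forall>b\<in>C. n b = (\<Oplus>c\<in>D. w c b \<odot> p c)"
proof -
  interpret N: module R N by (rule N)
  have fin: "finite C" "finite D" "w \<in> D \<rightarrow> carrier (free_module R C)" "finite B" "v \<in> C \<rightarrow> carrier (free_module R B)"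
    using syzygy_family[OF S] D by (simp_all add: generates_def)
  obtain Cs vs where Cs: "syz_path Cs vs" "Cs 0 = C" "Cs (Suc 0) = D" "vs 0 = w"
    using syz_path_exists[OF fin(1-3)] by blast
  define Ds where "Ds = case_nat B Cs"
  define ws where "ws = case_nat v vs"
  have "syz_path Ds ws"
    unfolding Ds_def ws_def using fin D Cs by (intro syz_path_cons) auto
  moreover have "Ds 0 = B" "Ds (Suc 0) = C" "ws 0 = v"
    using Cs by (simp_all add: Ds_def ws_def)
  ultimately obtain Es us x j where E: "syz_path Es us" "generates R M (carrier M) (Es 0) x"
    "generates R (free_module R (Es 0)) (relations R M (Es 0) x) (Es (Suc 0)) (us 0)"
    "\<And>i. Es (j + i) = Ds i" "\<And>i. us (j + i) = ws i"
    using syzygy_path[OF S, of Ds ws] by blast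
  let ?e = "\<lambda>n. lin_ext R (free_module R (Es n)) (us n)"
  note res = syz_path_resolution[OF E(1-3)]
  have Ej: "Es j = B" "Es (Suc j) = C" "Es (Suc (Suc j)) = D" "us j = v" "us (Suc j) = w"
    using E(4)[of 0] E(4)[of 1] E(4)[of 2] E(5)[of 0] E(5)[of 1] Cs
    by (simp_all add: Ds_def ws_def numeral_2_eq_2)
  have us: "\<And>n. us n \<in> Es (Suc n) \<rightarrow> carrier (free_module R (Es n))" and fE: "\<And>n. finite (Es n)"
    using E(1) by (auto simp: syz_path_def)
  have eb: "?e n (free_basis R b) = us n b" if "b \<in> Es (Suc n)" for n b
    by (rule lin_ext_basis[OF M.free_module_module us that])
  have vc: "v b c \<in> carrier R" if "b \<in> C" for b c
    by (rule M.free_module_coeff[OF funcset_mem[OF fin(5) that]])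
  have wc: "w b c \<in> carrier R" if "b \<in> D" for b c
    by (rule M.free_module_coeff[OF funcset_mem[OF fin(3) that]])
  have nc: "n b \<in> carrier N" if "b \<in> C" for b
    using n that by auto
  have "\<exists>p\<in>Es (Suc (Suc j)) \<rightarrow> carrier N. \<forall>b\<in>Es (Suc j).
      n b = (\<Oplus>c\<in>Es (Suc (Suc j)). ?e (Suc j) (free_basis R c) b \<odot> p c)"
  proof (rule acyclic_coords[OF N tor_acyclic[OF M N Tor res] free_resolutionD(2)[OF M res] fE])
    show "n \<in> Es (Suc j) \<rightarrow> carrier N" using n Ej by simp
    show "(\<Oplus>b\<in>Es (Suc j). ?e j (free_basis R b) c \<odot> n b) = \<zero>" if "c \<in> Es j" for c
    proof -
      have "(\<Oplus>b\<in>Es (Suc j). ?e j (free_basis R b) c \<odot> n b) = (\<Oplus>b\<in>C. v b c \<odot> n b)"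
        using eb[of _ j] by (intro N.finsum_cong') (auto simp: Ej vc nc)
      then show ?thesis using 0 that Ej by simp
    qed
  qed simp
  then obtain p where p: "p \<in> D \<rightarrow> carrier N"
    "\<And>b. b \<in> C \<Longrightarrow> n b = (\<Oplus>c\<in>D. ?e (Suc j) (free_basis R c) b \<odot> p c)"
    unfolding Ej by blast
  have "n b = (\<Oplus>c\<in>D. w c b \<odot> p c)" if "b \<in> C" for b
    unfolding p(2)[OF that] using p(1) eb[of _ "Suc j"] by (intro N.finsum_cong') (auto simp: Ej wc)
  with p(1) show ?thesis by blast
qed

end

section \<open>Standard graded Artinian local rings\<close>

text \<open>Fixes witnesses of \<open>standard_graded\<close>. The subring \<open>G 0\<close> serves
  as the residue field, and every \<open>R\<close>-module is viewed as a vector space over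
  it.\<close>

locale standard_graded_ring = artinian_local_ring R \<mm> for R (structure) and \<mm> +
  fixes h :: nat and G :: "nat \<Rightarrow> 'a set"
  assumes G_subgroup: "additive_subgroup (G i) R"
    and G_above: "i > h \<Longrightarrow> G i = {\<zero>}"
    and decomposition: "x \<in> carrier R \<Longrightarrow> \<exists>!f. f \<in> (\<Pi>\<^sub>E i\<in>{..h}. G i) \<and> x = (\<Oplus>i\<in>{..h}. f i)"
    and G_mult': "\<lbrakk>i \<le> h; j \<le> h; a \<in> G i; b \<in> G j\<rbrakk> \<Longrightarrow> a \<otimes> b \<in> G (i + j)"
    and G_0_subring: "subring (G 0) R"
    and G_0_residue: "(\<lambda>a. \<mm> +> a) \<in> ring_iso (R\<lparr>carrier := G 0\<rparr>) (R Quot \<mm>)"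
    and G_generate: "generate_ring R (G 0 \<union> G 1) = carrier R"
begin

abbreviation K where "K \<equiv> R\<lparr>carrier := G 0\<rparr>"

abbreviation Free where "Free \<equiv> free_module R"

text \<open>Homogeneous components. Extensional families are \<open>undefined\<close> above
  \<open>h\<close>, hence the explicit value zero there, in agreement with \<open>G i\<close> being
  trivial.\<close>

definition cmp :: "nat \<Rightarrow> 'a \<Rightarrow> 'a" where
  "cmp i x = (if i \<le> h then (THE f. f \<in> (\<Pi>\<^sub>E i\<in>{..h}. G i) \<and> x = (\<Oplus>i\<in>{..h}. f i)) i else \<zero>)"

text \<open>The elements of order at least \<open>p\<close>. This filtration stands in for the
  powers of \<open>\<mm>\<close>: \<open>I 1\<close> is \<open>\<mm>\<close>, and \<open>I 2\<close>
  lies in \<open>\<mm> \<cdot> \<mm>\<close>.\<close>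

definition I :: "nat \<Rightarrow> 'a set" where
  "I p = {x \<in> carrier R. \<forall>i<p. cmp i x = \<zero>}"

lemma G_closed: "a \<in> G i \<Longrightarrow> a \<in> carrier R"
  using additive_subgroup.a_subset[OF G_subgroup] by blast

lemma G_zero [simp]: "\<zero> \<in> G i"
  by (rule additive_subgroup.zero_closed[OF G_subgroup])

lemma G_add: "a \<in> G i \<Longrightarrow> b \<in> G i \<Longrightarrow> a \<oplus> b \<in> G i"
  by (rule additive_subgroup.a_closed[OF G_subgroup])

lemma G_minus: "a \<in> G i \<Longrightarrow> \<ominus> a \<in> G i"
  by (rule additive_subgroup.a_inv_closed[OF G_subgroup])

lemma G_mult: "a \<in> G i \<Longrightarrow> b \<in> G j \<Longrightarrow> a \<otimes> b \<in> G (i + j)"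
  using G_mult'[of i j a b] G_above[of i] G_above[of j] G_closed
  by (cases "i \<le> h"; cases "j \<le> h") auto

lemma one_G [simp]: "\<one> \<in> G 0"
  using subringE(3)[OF G_0_subring] .

lemma cmp_props:
  assumes "x \<in> carrier R"
  shows "cmp i x \<in> G i" and "x = (\<Oplus>i\<in>{..h}. cmp i x)"
proof -
  let ?f = "THE f. f \<in> (\<Pi>\<^sub>E i\<in>{..h}. G i) \<and> x = (\<Oplus>i\<in>{..h}. f i)"
  have f: "?f \<in> (\<Pi>\<^sub>E i\<in>{..h}. G i)" "x = (\<Oplus>i\<in>{..h}. ?f i)"
    using theI'[OF decomposition[OF assms]] by auto
  show "cmp i x \<in> G i"
    using f(1) by (auto simp: cmp_def)
  have "?f i \<in> carrier R" if "i \<le> h" for i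
    using PiE_mem[OF f(1), of i] that G_closed by simp
  then have "(\<Oplus>i\<in>{..h}. ?f i) = (\<Oplus>i\<in>{..h}. cmp i x)"
    by (intro finsum_cong') (auto simp: cmp_def)
  with f(2) show "x = (\<Oplus>i\<in>{..h}. cmp i x)" by simp
qed

lemma cmp_closed [simp]: "x \<in> carrier R \<Longrightarrow> cmp i x \<in> carrier R"
  using cmp_props(1) G_closed by blast

lemma cmp_unique:
  assumes f: "\<And>i. f i \<in> G i" and x: "x = (\<Oplus>i\<in>{..h}. f i)"
  shows "cmp i x = f i"
proof -
  note fc = G_closed[OF f]
  show ?thesis
  proof (cases "i \<le> h")
    case True
    have xc: "x \<in> carrier R" unfolding x using fc by (intro finsum_closed) auto
    have "restrict f {..h} \<in> (\<Pi>\<^sub>E i\<in>{..h}. G i) \<and> x = (\<Oplus>i\<in>{..h}. restrict f {..h} i)"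
      unfolding x using f fc by (auto intro!: finsum_cong')
    then have "(THE f. f \<in> (\<Pi>\<^sub>E i\<in>{..h}. G i) \<and> x = (\<Oplus>i\<in>{..h}. f i)) = restrict f {..h}"
      by (rule the1_equality[OF decomposition[OF xc]])
    with True show ?thesis
      by (simp add: cmp_def)
  next
    case False
    then show ?thesis using f[of i] G_above[of i] by (simp add: cmp_def)
  qed
qed

lemma cmp_homogeneous: "a \<in> G i \<Longrightarrow> cmp j a = (if j = i then a else \<zero>)"
proof (rule cmp_unique)
  assume a: "a \<in> G i"
  then show "(if j = i then a else \<zero>) \<in> G j" for j by auto
  show "a = (\<Oplus>j\<in>{..h}. if j = i then a else \<zero>)"
  proof (cases "i \<le> h")
    case True
    then show ?thesis
      using finsum_singleton[of i "{..h}" "\<lambda>_. a"] G_closed[OF a] by (simp add: eq_commute)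
  next
    case False
    then have "a = \<zero>" using a G_above[of i] by simp
    then show ?thesis by (simp add: finsum_zero cong: if_cong)
  qed
qed

lemma cmp_add: "x \<in> carrier R \<Longrightarrow> y \<in> carrier R \<Longrightarrow> cmp i (x \<oplus> y) = cmp i x \<oplus> cmp i y"
proof (rule cmp_unique)
  assume x: "x \<in> carrier R" and y: "y \<in> carrier R"
  then show "cmp i x \<oplus> cmp i y \<in> G i" for i
    by (intro G_add cmp_props(1))
  show "x \<oplus> y = (\<Oplus>i\<in>{..h}. cmp i x \<oplus> cmp i y)"
    using x y by (subst finsum_addf) (auto simp flip: cmp_props(2))
qed

lemma cmp_zero [simp]: "cmp i \<zero> = \<zero>"
  using cmp_homogeneous[OF G_zero[of i], of i] by simp

lemma cmp_minus: "x \<in> carrier R \<Longrightarrow> cmp i (\<ominus> x) = \<ominus> cmp i x"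
  using cmp_add[of "\<ominus> x" x i] by (simp add: l_neg) (metis a_inv_closed cmp_closed minus_equality)

lemma cmp_diff: "x \<in> carrier R \<Longrightarrow> y \<in> carrier R \<Longrightarrow> cmp i (x \<ominus> y) = cmp i x \<ominus> cmp i y"
  by (simp add: a_minus_def cmp_add cmp_minus)

lemma cmp_finsum:
  assumes "finite A" "f \<in> A \<rightarrow> carrier R"
  shows "cmp i (finsum R f A) = (\<Oplus>a\<in>A. cmp i (f a))"
  using assms by (induction A) (auto simp: cmp_add Pi_iff)

lemma cmp_mult_homogeneous:
  assumes a: "a \<in> G i" and x: "x \<in> carrier R"
  shows "cmp j (a \<otimes> x) = (if i \<le> j then a \<otimes> cmp (j - i) x else \<zero>)"
proof -
  note ac = G_closed[OF a]
  have ax: "a \<otimes> cmp k x \<in> G (i + k)" for k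
    by (rule G_mult[OF a cmp_props(1)[OF x]])
  have "a \<otimes> x = a \<otimes> (\<Oplus>k\<in>{..h}. cmp k x)"
    using cmp_props(2)[OF x] by simp
  also have "\<dots> = (\<Oplus>k\<in>{..h}. a \<otimes> cmp k x)"
    using ac x by (intro finsum_rdistr) auto
  finally have "cmp j (a \<otimes> x) = (\<Oplus>k\<in>{..h}. cmp j (a \<otimes> cmp k x))"
    using ac x by (simp add: cmp_finsum Pi_iff)
  also have "\<dots> = (\<Oplus>k\<in>{..h}. if j = i + k then a \<otimes> cmp k x else \<zero>)"
    using ac x by (intro finsum_cong') (auto simp: cmp_homogeneous[OF ax])
  also have "\<dots> = (if i \<le> j then a \<otimes> cmp (j - i) x else \<zero>)"
  proof (cases "i \<le> j \<and> j - i \<le> h")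
    case True
    then have "(\<Oplus>k\<in>{..h}. if j = i + k then a \<otimes> cmp k x else \<zero>) =
        (\<Oplus>k\<in>{..h}. if j - i = k then a \<otimes> cmp k x else \<zero>)"
      using ac x by (intro finsum_cong') auto
    then show ?thesis
      using True finsum_singleton[of "j - i" "{..h}" "\<lambda>k. a \<otimes> cmp k x"] ac x by (simp add: Pi_iff)
  next
    case False
    then have "(\<Oplus>k\<in>{..h}. if j = i + k then a \<otimes> cmp k x else \<zero>) = (\<Oplus>k\<in>{..h}. \<zero>)"
      using ac x by (intro finsum_cong') auto
    then show ?thesis
      using False ac by (auto simp: finsum_zero cmp_def)
  qed
  finally show ?thesis .
qed

section \<open>The filtration by order\<close>

lemma I_closed: "x \<in> I p \<Longrightarrow> x \<in> carrier R"
  by (simp add: I_def)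

lemma I_cmp: "x \<in> I p \<Longrightarrow> i < p \<Longrightarrow> cmp i x = \<zero>"
  by (simp add: I_def)

text \<open>Below degree \<open>p + q\<close> every term of the convolution has a vanishing factor;
  in degree \<open>p + q\<close> only the product of the initial parts survives.\<close>

lemma cmp_mult_I:
  assumes x: "x \<in> I p" and y: "y \<in> I q"
  shows "j < p + q \<Longrightarrow> cmp j (x \<otimes> y) = \<zero>" and "cmp (p + q) (x \<otimes> y) = cmp p x \<otimes> cmp q y"
proof -
  note c = I_closed[OF x] I_closed[OF y]
  have "x \<otimes> y = (\<Oplus>i\<in>{..h}. cmp i x) \<otimes> y"
    using cmp_props(2)[OF c(1)] by simp
  also have "\<dots> = (\<Oplus>i\<in>{..h}. cmp i x \<otimes> y)"
    using c by (intro finsum_ldistr) auto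
  finally have eq: "cmp j (x \<otimes> y) = (\<Oplus>i\<in>{..h}. if i \<le> j then cmp i x \<otimes> cmp (j - i) y else \<zero>)" for j
    using c by (simp add: cmp_finsum Pi_iff cmp_mult_homogeneous[OF cmp_props(1)] cong: if_cong)
  have zero: "cmp i x \<otimes> cmp (j - i) y = \<zero>" if "i \<le> j" "i < p \<or> j - i < q" for i j
    using that x y c by (auto simp: I_def)
  show "cmp j (x \<otimes> y) = \<zero>" if "j < p + q"
  proof -
    have "cmp j (x \<otimes> y) = (\<Oplus>i\<in>{..h}. \<zero>)"
      unfolding eq using that by (intro finsum_cong') (auto intro!: zero)
    then show ?thesis by (simp add: finsum_zero)
  qed
  have pq: "cmp (p + q) (x \<otimes> y) = (\<Oplus>i\<in>{..h}. if p = i then cmp i x \<otimes> cmp q y else \<zero>)"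
    unfolding eq using c by (intro finsum_cong') (auto intro!: zero)
  show "cmp (p + q) (x \<otimes> y) = cmp p x \<otimes> cmp q y"
  proof (cases "p \<le> h")
    case True
    then show ?thesis
      using pq finsum_singleton[of p "{..h}" "\<lambda>i. cmp i x \<otimes> cmp q y"] c
      by (simp add: Pi_iff)
  next
    case False
    then have "(\<Oplus>i\<in>{..h}. if p = i then cmp i x \<otimes> cmp q y else \<zero>) = (\<Oplus>i\<in>{..h}. \<zero>)"
      using c by (intro finsum_cong') auto
    moreover have "cmp p x = \<zero>" using False by (simp add: cmp_def)
    ultimately show ?thesis
      using c pq by (simp add: finsum_zero)
  qed
qed

lemma I_mult: "x \<in> I p \<Longrightarrow> y \<in> I q \<Longrightarrow> x \<otimes> y \<in> I (p + q)"
  using cmp_mult_I(1)[of x p y q] by (simp add: I_def)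

lemma I_0: "I 0 = carrier R"
  by (simp add: I_def)

lemma I_antimono: "p \<le> q \<Longrightarrow> I q \<subseteq> I p"
  by (auto simp: I_def)

text \<open>This ends the successive approximations that take the place of Nakayama's lemma.\<close>

lemma I_top: "I (Suc h) = {\<zero>}"
proof -
  have "x = \<zero>" if "x \<in> I (Suc h)" for x
  proof -
    have "x = (\<Oplus>i\<in>{..h}. cmp i x)"
      using cmp_props(2) that by (simp add: I_def)
    also have "\<dots> = (\<Oplus>i\<in>{..h}. \<zero>)"
      using that by (intro finsum_cong') (auto simp: I_def)
    finally show ?thesis by (simp add: finsum_zero)
  qed
  then show ?thesis by (auto simp: I_def)
qed

lemma G_subset_I: "p \<le> j \<Longrightarrow> G j \<subseteq> I p"
  by (auto simp: I_def G_closed cmp_homogeneous)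

text \<open>With \<open>W\<close> a \<open>k\<close>-subspace of \<open>R\<^sub>j\<close>, these are the ideals \<open>W + \<mm>\<^sup>j\<^sup>+\<^sup>1\<close>.\<close>
lemma layer_ideal:
  assumes "W \<subseteq> G j" "\<zero> \<in> W" "\<And>x y. x \<in> W \<Longrightarrow> y \<in> W \<Longrightarrow> x \<oplus> y \<in> W" "\<And>x. x \<in> W \<Longrightarrow> \<ominus> x \<in> W"
    "\<And>c x. c \<in> G 0 \<Longrightarrow> x \<in> W \<Longrightarrow> c \<otimes> x \<in> W"
  shows "ideal {x \<in> I j. cmp j x \<in> W} R"
proof (rule idealI)
  show "ring R" by (rule ring_axioms)
  show "subgroup {x \<in> I j. cmp j x \<in> W} (add_monoid R)"
    using assms(2-4)
    by (intro add.subgroupI) (auto simp: I_def cmp_add cmp_minus simp flip: a_inv_def intro!: exI[of _ \<zero>])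
  fix a x assume a: "a \<in> {x \<in> I j. cmp j x \<in> W}" and x: "x \<in> carrier R"
  then have "x \<otimes> a \<in> I j" "cmp j (x \<otimes> a) = cmp 0 x \<otimes> cmp j a"
    using I_mult[of x 0 a j] cmp_mult_I(2)[of x 0 a j] by (auto simp: I_0)
  then show "x \<otimes> a \<in> {x \<in> I j. cmp j x \<in> W}"
    using a assms(5)[OF cmp_props(1)[OF x]] by simp
  then show "a \<otimes> x \<in> {x \<in> I j. cmp j x \<in> W}"
    using a x m_comm[of a x] by (simp add: I_def)
qed

lemma I_ideal: "ideal (I p) R"
proof -
  have "{x \<in> I p. cmp p x \<in> G p} = I p"
    using cmp_props(1) by (auto simp: I_def)
  moreover have "ideal {x \<in> I p. cmp p x \<in> G p} R"
    using G_mult[of _ 0 _ p] by (intro layer_ideal) (auto simp: G_add G_minus)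
  ultimately show ?thesis by simp
qed

section \<open>The residue field, the maximal ideal and units\<close>

lemma one_not_zero: "\<one> \<noteq> \<zero>"
proof
  assume "\<one> = \<zero>"
  then have "carrier R = {\<zero>}" using one_zeroD by blast
  moreover have "\<zero> \<in> \<mm>" "\<mm> \<subseteq> carrier R" "\<mm> \<noteq> carrier R"
    using maximal
    by (auto simp: maximalideal_def maximalideal_axioms_def ideal_def additive_subgroup.zero_closed
      dest: additive_subgroup.a_subset)
  ultimately show False by auto
qed

lemma K_cring: "cring K"
  using subcring_iff[OF subringE(1)[OF G_0_subring]] subcringI'[OF G_0_subring] by blast

text \<open>Inverses exist in the quotient field, and the isomorphism from \<open>G 0\<close> pulls
  them back.\<close>

lemma G_0_inverse:
  assumes a: "a \<in> G 0" "a \<noteq> \<zero>"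
  shows "\<exists>b\<in>G 0. a \<otimes> b = \<one>"
proof -
  let ?Q = "R Quot \<mm>"
  let ?f = "\<lambda>a. \<mm> +> a"
  interpret Q: field ?Q
    by (rule maximalideal.quotient_is_field[OF maximal cring_axioms])
  have hom: "?f \<in> ring_hom K ?Q" and bij: "bij_betw ?f (G 0) (carrier ?Q)"
    using G_0_residue by (auto simp: ring_iso_def)
  have z: "?f \<zero> = \<zero>\<^bsub>?Q\<^esub>"
    using ring_hom_zero[OF hom cring.axioms(1)[OF K_cring] Q.ring_axioms] by simp
  have "?f a \<noteq> \<zero>\<^bsub>?Q\<^esub>"
    using inj_on_eq_iff[OF bij_betw_imp_inj_on[OF bij] a(1) G_zero] a(2) z by simp
  moreover have "?f a \<in> carrier ?Q"
    using bij_betwE[OF bij] a by blast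
  ultimately have "?f a \<in> Units ?Q"
    using Q.field_Units by blast
  then obtain y where y: "y \<in> carrier ?Q" "?f a \<otimes>\<^bsub>?Q\<^esub> y = \<one>\<^bsub>?Q\<^esub>"
    using Q.Units_r_inv_ex by blast
  then obtain b where b: "b \<in> G 0" "y = ?f b"
    using bij_betw_imp_surj_on[OF bij] by blast
  have "?f (a \<otimes> b) = ?f \<one>"
    using y(2) ring_hom_mult[OF hom, of a b] ring_hom_one[OF hom] a b by simp
  then have "a \<otimes> b = \<one>"
    using inj_on_eq_iff[OF bij_betw_imp_inj_on[OF bij] _ one_G] G_mult[OF a(1) b(1)] by simp
  with b show ?thesis by blast
qed

lemma K_field: "field K"
proof -
  interpret K: cring K by (rule K_cring)
  have "Units K = carrier K - {\<zero>\<^bsub>K\<^esub>}"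
  proof (intro equalityI subsetI)
    fix a assume "a \<in> Units K"
    then obtain b where "a \<in> G 0" "b \<in> G 0" "a \<otimes> b = \<one>"
      by (auto simp: Units_def)
    then show "a \<in> carrier K - {\<zero>\<^bsub>K\<^esub>}"
      using one_not_zero G_closed[of b 0] by auto
  next
    fix a assume "a \<in> carrier K - {\<zero>\<^bsub>K\<^esub>}"
    then obtain b where b: "a \<in> G 0" "b \<in> G 0" "a \<otimes> b = \<one>"
      using G_0_inverse[of a] by auto
    moreover have "b \<otimes> a = \<one>"
      using b m_comm[OF G_closed[OF b(2)] G_closed[OF b(1)]] by simp
    ultimately show "a \<in> Units K"
      unfolding Units_def by (intro CollectI conjI bexI[of _ b]) simp_all
  qed
  then show ?thesis by (rule K.cring_fieldI)
qed

lemma split_low: "x \<in> carrier R \<Longrightarrow> x \<ominus> cmp 0 x \<in> I 1"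
  using cmp_homogeneous[OF cmp_props(1), of x 0 0] by (simp add: I_def cmp_diff a_minus_def r_neg cmp_add cmp_minus)

text \<open>An ideal above \<open>I 1\<close> and different from it contains an element with nonzero
  constant term; subtracting the part in \<open>I 1\<close> leaves a unit. So \<open>I 1\<close> is
  maximal, and locality identifies it.\<close>

lemma maximal_eq: "\<mm> = I 1"
proof (rule unique_maximal[symmetric])
  show "maximalideal (I 1) R"
  proof (rule maximalidealI[OF I_ideal])
    show "carrier R \<noteq> I 1"
    proof
      assume "carrier R = I 1"
      then have "\<one> \<in> I 1" using one_closed by simp
      then show False
        using one_not_zero cmp_homogeneous[OF one_G, of 0] by (simp add: I_def)
    qed
    fix J assume J: "ideal J R" "I 1 \<subseteq> J" "J \<subseteq> carrier R"
    interpret J: ideal J R by fact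
    show "J = I 1 \<or> J = carrier R"
    proof (cases "J \<subseteq> I 1")
      case False
      then obtain x where x: "x \<in> J" "cmp 0 x \<noteq> \<zero>" using J(3) by (auto simp: I_def)
      then have xc: "x \<in> carrier R" using J(3) by blast
      obtain b where b: "b \<in> G 0" "cmp 0 x \<otimes> b = \<one>"
        using G_0_inverse[OF cmp_props(1)[OF xc] x(2)] by blast
      have "x \<ominus> (x \<ominus> cmp 0 x) \<in> J"
        using split_low[OF xc] J(2) x(1) J.a_inv_closed J.a_closed by (auto simp: a_minus_def)
      moreover have "x \<ominus> (x \<ominus> cmp 0 x) = cmp 0 x"
        using xc by (simp add: a_minus_def minus_add r_neg2)
      ultimately have "\<one> \<in> J"
        using J.I_r_closed[of "cmp 0 x" b] b G_closed[OF b(1)] by simp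
      then show ?thesis using J.one_imp_carrier by simp
    qed (use J in blast)
  qed
qed

text \<open>Solve \<open>u y = x\<close> by descending induction on the order of \<open>x\<close>.
  With \<open>b\<close> inverse to the constant term of \<open>u\<close>, the guess
  \<open>b x\<close> leaves an error of one order higher, and the filtration ends at zero.\<close>

lemma unit_if_cmp_0:
  assumes u: "u \<in> carrier R" "cmp 0 u \<noteq> \<zero>"
  shows "u \<in> Units R"
proof -
  obtain b where b: "b \<in> G 0" "cmp 0 u \<otimes> b = \<one>"
    using G_0_inverse[OF cmp_props(1)[OF u(1)] u(2)] by blast
  note bc = G_closed[OF b(1)]
  have "\<exists>y\<in>carrier R. u \<otimes> y = x" if "x \<in> I (Suc h - p)" for p x
    using that
  proof (induction p arbitrary: x)
    case 0
    then have "x = \<zero>" using I_top by simp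
    then show ?case using u(1) by (intro bexI[of _ \<zero>]) simp_all
  next
    case (Suc p)
    have xc: "x \<in> carrier R" using Suc.prems I_closed by blast
    have "(u \<ominus> cmp 0 u) \<otimes> (b \<otimes> x) \<in> I (1 + (0 + (Suc h - Suc p)))"
      by (intro I_mult split_low u Suc.prems) (simp add: I_0 bc)
    then have "(u \<ominus> cmp 0 u) \<otimes> (b \<otimes> x) \<in> I (Suc h - p)"
      by (rule subsetD[OF I_antimono, rotated]) arith
    then obtain y where y: "y \<in> carrier R" "u \<otimes> y = (u \<ominus> cmp 0 u) \<otimes> (b \<otimes> x)"
      using Suc.IH by blast
    have "u \<otimes> (b \<otimes> x \<ominus> y) = u \<otimes> (b \<otimes> x) \<ominus> (u \<ominus> cmp 0 u) \<otimes> (b \<otimes> x)"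
      using u(1) bc xc y by (simp add: a_minus_def r_distr r_minus y(2)[symmetric])
    also have "\<dots> = cmp 0 u \<otimes> (b \<otimes> x)"
      using u(1) bc xc by (simp add: a_minus_def l_distr l_minus minus_add r_neg2)
    also have "\<dots> = x"
      using u(1) bc xc b(2) by (simp flip: m_assoc)
    finally show ?case
      using bc xc y(1) by (intro bexI[of _ "b \<otimes> x \<ominus> y"]) auto
  qed
  from this[of \<one> "Suc h"] obtain y where "y \<in> carrier R" "u \<otimes> y = \<one>"
    by (auto simp: I_0)
  then show ?thesis
    using u(1) m_comm[OF u(1), of y] unfolding Units_def by (intro CollectI conjI bexI[of _ y]) simp_all
qed

lemma nonunit_mem: "u \<in> carrier R \<Longrightarrow> u \<notin> Units R \<Longrightarrow> u \<in> I 1"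
  using unit_if_cmp_0 by (auto simp: I_def)

text \<open>The elements whose part of degree at least two lies in \<open>J\<close> form a subring.\<close>
lemma I_2_subset:
  assumes J: "ideal J R" and G1: "\<And>a b. a \<in> G 1 \<Longrightarrow> b \<in> G 1 \<Longrightarrow> a \<otimes> b \<in> J"
  shows "I 2 \<subseteq> J"
proof -
  \<comment> \<open>Intersecting with \<open>I 2\<close> ensures that in
    \<open>a \<oplus> b \<oplus> j\<close> the summands \<open>a\<close> and \<open>b\<close> are
    the components of degree zero and one.\<close>
  let ?J = "J \<inter> I 2"
  interpret J: ideal ?J R by (rule i_intersect[OF J I_ideal])
  define S where "S = {x. \<exists>a\<in>G 0. \<exists>b\<in>G 1. \<exists>j\<in>?J. x = a \<oplus> b \<oplus> j}"
  have SI: "x \<in> S" if "a \<in> G 0" "b \<in> G 1" "j \<in> ?J" "x = a \<oplus> b \<oplus> j" for x a b j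
    unfolding S_def using that by blast
  have c: "a \<in> G i \<Longrightarrow> a \<in> carrier R" for a i by (rule G_closed)
  have "generate_ring R (G 0 \<union> G 1) \<subseteq> S"
  proof
    fix x assume "x \<in> generate_ring R (G 0 \<union> G 1)"
    then show "x \<in> S"
    proof induction
      case one
      show ?case by (rule SI[of \<one> \<zero> \<zero>]) (simp_all add: J.zero_closed del: Int_iff)
    next
      case (incl x)
      then show ?case
      proof
        assume "x \<in> G 0"
        then show ?thesis by (intro SI[of x \<zero> \<zero>]) (simp_all add: J.zero_closed c del: Int_iff)
      next
        assume "x \<in> G 1"
        then show ?thesis by (intro SI[of \<zero> x \<zero>]) (simp_all add: J.zero_closed c del: Int_iff)
      qed
    next
      case (a_inv x)
      then obtain a b j where "a \<in> G 0" "b \<in> G 1" "j \<in> ?J" "x = a \<oplus> b \<oplus> j"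
        by (auto simp: S_def)
      then show ?case
        using J.Icarr[of j] J.a_inv_closed[of j]
        by (intro SI[of "\<ominus> a" "\<ominus> b" "\<ominus> j"]) (simp_all add: minus_add c G_minus del: Int_iff)
    next
      case (eng_add x y)
      then obtain a b j a' b' j' where "a \<in> G 0" "b \<in> G 1" "j \<in> ?J" "x = a \<oplus> b \<oplus> j"
        "a' \<in> G 0" "b' \<in> G 1" "j' \<in> ?J" "y = a' \<oplus> b' \<oplus> j'"
        by (auto simp: S_def)
      then show ?case
        using J.Icarr[of j] J.Icarr[of j'] J.a_closed[of j j']
        by (intro SI[of "a \<oplus> a'" "b \<oplus> b'" "j \<oplus> j'"]) (simp_all add: a_ac c G_add del: Int_iff)
    next
      case (eng_mult x y)
      then obtain a b j a' b' j' where x: "a \<in> G 0" "b \<in> G 1" "j \<in> ?J" "x = a \<oplus> b \<oplus> j"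
        and y: "a' \<in> G 0" "b' \<in> G 1" "j' \<in> ?J" "y = a' \<oplus> b' \<oplus> j'"
        by (auto simp: S_def)
      note cs = x(1,2)[THEN c] y(1,2)[THEN c] J.Icarr[OF x(3)] J.Icarr[OF y(3)]
      \<comment> \<open>The terms of \<open>x \<otimes> y\<close> that lie in \<open>?J\<close>: a
        product of two linear forms and multiples of \<open>j\<close> and \<open>j'\<close>.\<close>
      define l where "l = b \<otimes> b' \<oplus> (a \<oplus> b) \<otimes> j' \<oplus> j \<otimes> y"
      have yc: "y \<in> carrier R" using y(4) cs by simp
      have "b \<otimes> b' \<in> ?J"
        using G1[OF x(2) y(2)] G_mult[OF x(2) y(2)] G_subset_I[of 2 "1 + 1"] by auto
      then have l: "l \<in> ?J"
        unfolding l_def using J.I_l_closed[OF y(3)] J.I_r_closed[OF x(3) yc] cs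
        by (intro J.a_closed) auto
      have "x \<otimes> y = (a \<oplus> b) \<otimes> y \<oplus> j \<otimes> y"
        unfolding x(4) using cs yc by (simp add: l_distr)
      also have "(a \<oplus> b) \<otimes> y = (a \<oplus> b) \<otimes> (a' \<oplus> b') \<oplus> (a \<oplus> b) \<otimes> j'"
        unfolding y(4) using cs by (simp add: r_distr)
      also have "(a \<oplus> b) \<otimes> (a' \<oplus> b') = a \<otimes> a' \<oplus> (a \<otimes> b' \<oplus> b \<otimes> a') \<oplus> b \<otimes> b'"
        using cs by (simp add: r_distr l_distr a_ac)
      finally have "x \<otimes> y = a \<otimes> a' \<oplus> (a \<otimes> b' \<oplus> b \<otimes> a') \<oplus> l"
        unfolding l_def using cs yc by (simp add: a_assoc)
      moreover have "a \<otimes> a' \<in> G 0" "a \<otimes> b' \<oplus> b \<otimes> a' \<in> G 1"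
        using G_mult[OF x(1) y(1)] G_mult[OF x(1) y(2)] G_mult[OF x(2) y(1)] by (simp_all add: G_add)
      ultimately show ?case
        using l by (intro SI)
    qed
  qed
  then have S: "carrier R \<subseteq> S" using G_generate by simp
  show ?thesis
  proof
    fix x assume x: "x \<in> I 2"
    then have "x \<in> S" using subsetD[OF S I_closed] by simp
    then obtain a b j where abj: "a \<in> G 0" "b \<in> G 1" "j \<in> ?J" "x = a \<oplus> b \<oplus> j"
      unfolding S_def by blast
    have xc: "cmp 0 x = \<zero>" "cmp 1 x = \<zero>" and jc: "cmp 0 j = \<zero>" "cmp 1 j = \<zero>"
      using x abj(3) by (simp_all add: I_cmp[of _ 2])
    note cs = abj(1,2)[THEN c] J.Icarr[OF abj(3)]
    have "cmp 0 x = a" "cmp 1 x = b"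
      unfolding abj(4) using cs jc
      by (simp_all add: cmp_add cmp_homogeneous[OF abj(1)] cmp_homogeneous[OF abj(2)])
    with xc have "a = \<zero>" "b = \<zero>" by simp_all
    then show "x \<in> J" using abj(3,4) cs by simp
  qed
qed

end

section \<open>Finite-dimensionality\<close>

text \<open>Functions that are zero off \<open>B\<close>, the convention of
  \<open>free_module\<close>, so that for finite \<open>B\<close> a free module is literally a power
  of \<open>regular_module\<close>.\<close>

definition pow_module :: "('a, 'm, 'x) module_scheme \<Rightarrow> 'b set \<Rightarrow> ('a, 'b \<Rightarrow> 'm) module" where
  "pow_module V B =
    \<lparr>carrier = {u. (\<forall>b\<in>B. u b \<in> carrier V) \<and> (\<forall>b. b \<notin> B \<longrightarrow> u b = \<zero>\<^bsub>V\<^esub>)},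
     mult = undefined, one = undefined, ring.zero = (\<lambda>b. \<zero>\<^bsub>V\<^esub>), add = (\<lambda>u v b. u b \<oplus>\<^bsub>V\<^esub> v b),
     smult = (\<lambda>a u b. a \<odot>\<^bsub>V\<^esub> u b)\<rparr>"

definition pow_sub :: "('a, 'm, 'x) module_scheme \<Rightarrow> 'b set \<Rightarrow> 'm set \<Rightarrow> ('b \<Rightarrow> 'm) set" where
  "pow_sub V B A = {u. (\<forall>b\<in>B. u b \<in> A) \<and> (\<forall>b. b \<notin> B \<longrightarrow> u b = \<zero>\<^bsub>V\<^esub>)}"

lemma pow_module_simps:
  "carrier (pow_module V B) = pow_sub V B (carrier V)"
  "\<zero>\<^bsub>pow_module V B\<^esub> = (\<lambda>b. \<zero>\<^bsub>V\<^esub>)"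
  "u \<oplus>\<^bsub>pow_module V B\<^esub> v = (\<lambda>b. u b \<oplus>\<^bsub>V\<^esub> v b)"
  "a \<odot>\<^bsub>pow_module V B\<^esub> u = (\<lambda>b. a \<odot>\<^bsub>V\<^esub> u b)"
  by (simp_all add: pow_module_def pow_sub_def)

lemma free_module_eq_pow: "finite B \<Longrightarrow> free_module R B = pow_module (regular_module R) B"
  by (auto simp: free_module_def pow_module_def intro!: finite_subset[of _ B])

lemma pow_module_module:
  fixes V (structure)
  assumes "module R V"
  shows "module R (pow_module V B)"
proof -
  let ?P = "pow_module V B"
  interpret V: module R V by fact
  have c: "u b \<in> carrier V" if "u \<in> pow_sub V B (carrier V)" for u b
    using that by (cases "b \<in> B") (auto simp: pow_sub_def)
  have cl: "(\<And>b. b \<in> B \<Longrightarrow> u b \<in> carrier V) \<Longrightarrow> (\<And>b. b \<notin> B \<Longrightarrow> u b = \<zero>) \<Longrightarrow>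
      u \<in> pow_sub V B (carrier V)" for u
    by (simp add: pow_sub_def)
  have out: "u \<in> pow_sub V B (carrier V) \<Longrightarrow> b \<notin> B \<Longrightarrow> u b = \<zero>" for u b
    by (simp add: pow_sub_def)
  note simps = pow_module_simps
  show ?thesis
  proof (rule moduleI)
    show "abelian_group (?P)"
    proof (rule abelian_groupI; unfold simps)
      show "(\<lambda>b. \<zero>) \<in> pow_sub V B (carrier V)" by (rule cl) simp_all
    next
      fix u v assume u: "u \<in> pow_sub V B (carrier V)" and v: "v \<in> pow_sub V B (carrier V)"
      show "(\<lambda>b. u b \<oplus> v b) \<in> pow_sub V B (carrier V)"
        by (rule cl) (simp_all add: c[OF u] c[OF v] out[OF u] out[OF v])
      show "(\<lambda>b. u b \<oplus> v b) = (\<lambda>b. v b \<oplus> u b)"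
        by (simp add: V.a_comm[OF c[OF u] c[OF v]])
      fix w assume w: "w \<in> pow_sub V B (carrier V)"
      show "(\<lambda>b. (u b \<oplus> v b) \<oplus> w b) = (\<lambda>b. u b \<oplus> (v b \<oplus> w b))"
        by (simp add: V.a_assoc[OF c[OF u] c[OF v] c[OF w]])
    next
      fix u assume u: "u \<in> pow_sub V B (carrier V)"
      show "(\<lambda>b. \<zero> \<oplus> u b) = u"
        by (simp add: c[OF u])
      show "\<exists>v\<in>pow_sub V B (carrier V). (\<lambda>b. v b \<oplus> u b) = (\<lambda>b. \<zero>)"
        by (rule bexI[of _ "\<lambda>b. \<ominus> u b"], simp add: V.l_neg[OF c[OF u]], rule cl)
          (simp_all add: c[OF u] out[OF u] module_minus_zero[OF assms])
    qed
  next
    fix a u assume a: "a \<in> carrier R" and "u \<in> carrier (?P)"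
    then have u: "u \<in> pow_sub V B (carrier V)" by (simp add: simps)
    show "a \<odot>\<^bsub>?P\<^esub> u \<in> carrier (?P)"
      unfolding simps by (rule cl) (simp_all add: a c[OF u] out[OF u])
    fix d assume d: "d \<in> carrier R"
    show "(a \<oplus>\<^bsub>R\<^esub> d) \<odot>\<^bsub>?P\<^esub> u =
        a \<odot>\<^bsub>?P\<^esub> u \<oplus>\<^bsub>?P\<^esub> d \<odot>\<^bsub>?P\<^esub> u"
      "(a \<otimes>\<^bsub>R\<^esub> d) \<odot>\<^bsub>?P\<^esub> u = a \<odot>\<^bsub>?P\<^esub> (d \<odot>\<^bsub>?P\<^esub> u)"
      unfolding simps by (simp_all add: a d c[OF u] V.smult_l_distr V.smult_assoc1)
  next
    fix a u v assume a: "a \<in> carrier R" and "u \<in> carrier (?P)" "v \<in> carrier (?P)"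
    then have u: "u \<in> pow_sub V B (carrier V)" and v: "v \<in> pow_sub V B (carrier V)" by (simp_all add: simps)
    show "a \<odot>\<^bsub>?P\<^esub> (u \<oplus>\<^bsub>?P\<^esub> v) =
        a \<odot>\<^bsub>?P\<^esub> u \<oplus>\<^bsub>?P\<^esub> a \<odot>\<^bsub>?P\<^esub> v"
      unfolding simps by (simp add: a c[OF u] c[OF v] V.smult_r_distr)
  next
    fix u assume "u \<in> carrier (?P)"
    then have u: "u \<in> pow_sub V B (carrier V)" by (simp add: simps)
    show "\<one>\<^bsub>R\<^esub> \<odot>\<^bsub>?P\<^esub> u = u"
      unfolding simps by (simp add: c[OF u])
  qed (rule V.R.cring_axioms)
qed

lemma pow_module_eval: "(\<lambda>u. u b) \<in> mod_hom R (pow_module V B) V" if "module R V"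
proof -
  interpret V: module R V by fact
  show ?thesis
    by (cases "b \<in> B") (auto simp: mod_hom_def pow_module_simps pow_sub_def)
qed

lemma pow_sub_submodule:
  fixes V (structure)
  assumes "module R V" "submodule A R V" "C \<subseteq> B"
  shows "submodule (pow_sub V C A) R (pow_module V B)"
proof -
  let ?P = "pow_module V B"
  interpret V: module R V by fact
  interpret P: module R ?P by (rule pow_module_module[OF assms(1)])
  note A = V.submoduleE[OF assms(2)] V.submodule_zero[OF assms(2)]
  have neg: "\<ominus>\<^bsub>?P\<^esub> u = (\<lambda>b. \<ominus> u b)" if u: "u \<in> carrier ?P" for u
  proof (rule P.minus_equality)
    show "u \<in> carrier ?P" by fact
    show "(\<lambda>b. \<ominus> u b) \<oplus>\<^bsub>?P\<^esub> u = \<zero>\<^bsub>?P\<^esub>"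
      using u mod_hom_closed[OF pow_module_eval[OF assms(1)] u]
      by (auto simp: pow_module_simps V.l_neg)
    show "(\<lambda>b. \<ominus> u b) \<in> carrier ?P"
      using u by (auto simp: pow_module_simps pow_sub_def module_minus_zero[OF assms(1)])
  qed
  have sub: "pow_sub V C A \<subseteq> carrier ?P"
    using A(1) assms(3) by (auto simp: pow_module_simps pow_sub_def)
  show ?thesis
  proof (rule P.submoduleI[OF sub])
    fix u assume "u \<in> pow_sub V C A"
    then show "\<ominus>\<^bsub>?P\<^esub> u \<in> pow_sub V C A"
      using A sub by (subst neg) (auto simp: pow_sub_def module_minus_zero[OF assms(1)])
  qed (use A in \<open>auto simp: pow_sub_def pow_module_simps\<close>)
qed

text \<open>Coordinates are released one at a time: evaluation at the new index \<open>c\<close> has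
  image \<open>A\<close>, and its kernel is the power over the earlier indices.\<close>

lemma pow_sub_sdim:
  fixes V (structure)
  assumes "field K" "module K V" "sdim K V A n" "finite B"
  shows "sdim K (pow_module V B) (pow_sub V B A) (card B * n)"
proof -
  interpret V: module K V by fact
  let ?P = "pow_module V B"
  note P = pow_module_module[OF assms(2), of B]
  note A = sdim_submodule[OF assms(2,3)]
  note zero = V.submodule_zero[OF A]
  have "sdim K ?P (pow_sub V C A) (card C * n)" if "finite C" "C \<subseteq> B" for C
    using that
  proof (induction C)
    case empty
    have "pow_sub V {} A = {\<zero>\<^bsub>?P\<^esub>}"
      by (auto simp: pow_sub_def pow_module_simps)
    then show ?case by (simp add: sdim.zero)
  next
    case (insert c C)
    let ?S = "pow_sub V (insert c C) A"
    have "{u \<in> ?S. u c = \<zero>} = pow_sub V C A"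
      using insert.hyps zero by (auto simp: pow_sub_def)
    then have k: "sdim K ?P {u \<in> ?S. u c = \<zero>} (card C * n)"
      using insert by simp
    have "(\<lambda>u. u c) ` ?S = A"
    proof (intro equalityI subsetI)
      fix a assume "a \<in> A"
      then show "a \<in> (\<lambda>u. u c) ` ?S"
        using zero by (intro image_eqI[of _ _ "\<lambda>b. if b = c then a else \<zero>"]) (auto simp: pow_sub_def)
    qed (auto simp: pow_sub_def)
    then have im: "sdim K V ((\<lambda>u. u c) ` ?S) n"
      using assms(3) by simp
    show ?case
      using sdim_extension[OF P assms(2) pow_module_eval[OF assms(2)]
          pow_sub_submodule[OF assms(2) A insert.prems] k im] insert.hyps
      by (simp add: add.commute)
  qed
  then show ?thesis using assms(4) by blast
qed

lemma pow_sub_dim: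
  assumes "field K" "module K V" "fin_dim K V A" "finite B"
  shows "fin_dim K (pow_module V B) (pow_sub V B A)"
    and "vdim K (pow_module V B) (pow_sub V B A) = card B * vdim K V A"
  using pow_sub_sdim[OF assms(1,2) sdim_vdim[OF assms(1-3)] assms(4)]
    vdim_eqI[OF assms(1) pow_module_module[OF assms(2)]]
  by (auto simp: fin_dim_def)

section \<open>Hyperplanes and descending chains of subspaces\<close>

lemma Union_chain_submodule:
  fixes V (structure)
  assumes V: "module K V" and C: "C \<noteq> {}" "subset.chain S C" and sub: "\<And>H. H \<in> C \<Longrightarrow> submodule H K V"
  shows "submodule (\<Union>C) K V"
proof -
  interpret V: module K V by fact
  note E = V.submoduleE[OF sub]
  obtain H0 where "H0 \<in> C" using C(1) by blast
  show ?thesis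
  proof (rule V.submoduleI)
    show "\<Union>C \<subseteq> carrier V" using E(1) by blast
    show "\<zero> \<in> \<Union>C" using V.submodule_zero[OF sub] \<open>H0 \<in> C\<close> by blast
    show "\<ominus> a \<in> \<Union>C" if "a \<in> \<Union>C" for a using that E(3) by blast
    show "c \<odot> a \<in> \<Union>C" if "c \<in> carrier K" "a \<in> \<Union>C" for a c using that E(4) by blast
    fix a b assume "a \<in> \<Union>C" "b \<in> \<Union>C"
    then obtain H1 H2 where H: "H1 \<in> C" "a \<in> H1" "H2 \<in> C" "b \<in> H2" by blast
    then have "H1 \<subseteq> H2 \<or> H2 \<subseteq> H1"
      using C(2) by (auto simp: subset.chain_def)
    then show "a \<oplus> b \<in> \<Union>C"
    proof
      assume "H1 \<subseteq> H2"
      then have "a \<oplus> b \<in> H2" using E(5)[OF H(3)] H by blast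
      then show ?thesis using H(3) by blast
    next
      assume "H2 \<subseteq> H1"
      then have "a \<oplus> b \<in> H1" using E(5)[OF H(1)] H by blast
      then show ?thesis using H(1) by blast
    qed
  qed
qed

text \<open>Zorn gives a subspace \<open>H\<close> of \<open>A\<close> maximal among those avoiding
  \<open>v\<close>. If \<open>x \<notin> H\<close>, then \<open>v \<in> H + Kx\<close> by
  maximality; the coefficient of \<open>x\<close> is nonzero because \<open>v \<notin> H\<close>, so
  \<open>x \<in> H + Kv\<close>.\<close>

lemma hyperplane_exists:
  fixes V (structure)
  assumes K: "field K" and V: "module K V" and A: "submodule A K V" and v: "v \<in> A" "v \<noteq> \<zero>"
  shows "\<exists>H. submodule H K V \<and> v \<notin> H \<and> adjoin K V H v = A"
proof -
  interpret K: field K by fact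
  interpret V: module K V by fact
  note AE = V.submoduleE[OF A] V.submodule_zero[OF A]
  have vc: "v \<in> carrier V" using AE(1) v by blast
  let ?S = "{H. submodule H K V \<and> H \<subseteq> A \<and> v \<notin> H}"
  have "\<exists>H\<in>?S. \<forall>X\<in>?S. H \<subseteq> X \<longrightarrow> X = H"
  proof (rule subset_Zorn_nonempty)
    show "?S \<noteq> {}"
      using zero_submodule[OF V] v AE(7) by (auto intro!: exI[of _ "{\<zero>}"])
    fix C assume "C \<noteq> {}" and C: "subset.chain ?S C"
    then have "C \<subseteq> ?S" by (auto simp: subset.chain_def)
    then show "\<Union>C \<in> ?S"
      using Union_chain_submodule[OF V \<open>C \<noteq> {}\<close> C] by blast
  qed
  then obtain H where "H \<in> ?S" and max': "\<forall>X\<in>?S. H \<subseteq> X \<longrightarrow> X = H" ..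
  then have H: "submodule H K V" "H \<subseteq> A" "v \<notin> H" by simp_all
  have max: "X = H" if "submodule X K V" "X \<subseteq> A" "v \<notin> X" "H \<subseteq> X" for X
    using max' that by simp
  note HE = V.submoduleE[OF H(1)]
  have "x \<in> adjoin K V H v" if x: "x \<in> A" for x
  proof (cases "x \<in> H")
    case True
    then show ?thesis using adjoin_supset[OF V H(1) vc] by blast
  next
    case False
    have xc: "x \<in> carrier V" using AE(1) x by blast
    have "v \<in> adjoin K V H x"
      using max[OF adjoin_submodule[OF V H(1) xc] adjoin_least[OF V A H(2) x]]
        adjoin_supset[OF V H(1) xc] adjoin_self[OF V H(1) xc] False by metis
    then obtain c where c: "c \<in> carrier K" "v \<ominus> c \<odot> x \<in> H"
      by (auto simp: adjoin_def)
    have "c \<noteq> \<zero>\<^bsub>K\<^esub>"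
      using c(2) H(3) vc xc by (auto simp: a_minus_def module_minus_zero[OF V])
    then have cu: "c \<in> Units K" using K.field_Units c(1) by blast
    let ?i = "inv\<^bsub>K\<^esub> c"
    have "\<ominus> (?i \<odot> (v \<ominus> c \<odot> x)) \<in> H"
      using HE(3,4) c(2) cu by simp
    moreover have "?i \<odot> (c \<odot> x) = x"
      using cu xc by (simp add: K.Units_closed flip: V.smult_assoc1)
    then have "?i \<odot> (v \<ominus> c \<odot> x) = ?i \<odot> v \<ominus> x"
      using cu c(1) vc xc by (simp add: V.smult_r_diff)
    then have "\<ominus> (?i \<odot> (v \<ominus> c \<odot> x)) = x \<ominus> ?i \<odot> v"
      using cu vc xc by (simp add: a_minus_def V.minus_add V.a_comm)
    ultimately show ?thesis
      using xc cu by (auto simp: adjoin_def)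
  qed
  then have "adjoin K V H v = A"
    using adjoin_least[OF V A H(2) v(1)] by blast
  with H show ?thesis by blast
qed

text \<open>A hyperplane in an infinite-dimensional space is again infinite-dimensional, so the step
  can be iterated against the descending chain condition.\<close>

lemma infinite_dim_descent:
  fixes V (structure)
  assumes "field K" "module K V" "submodule A K V" "\<not> fin_dim K V A"
  shows "\<exists>H. submodule H K V \<and> H \<subset> A \<and> \<not> fin_dim K V H"
proof -
  have "A \<noteq> {\<zero>}" using vdim_zero(1)[OF assms(1,2)] assms(4) by blast
  then obtain v where v: "v \<in> A" "v \<noteq> \<zero>"
    using module.submodule_zero[OF assms(2,3)] by blast
  have vc: "v \<in> carrier V" using module.submoduleE(1)[OF assms(2,3)] v by blast
  obtain H where H: "submodule H K V" "v \<notin> H" "adjoin K V H v = A"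
    using hyperplane_exists[OF assms(1-3) v] by blast
  have "\<not> fin_dim K V H"
    using sdim.step[OF _ vc H(2)] H(3) assms(4) unfolding fin_dim_def by blast
  with H show ?thesis
    using adjoin_supset[OF assms(2) H(1) vc] v(1) by blast
qed

text \<open>The vectors adjoined along the chain span. This passes from finite dimension over
  \<open>K\<close> to finite generation over \<open>R\<close>.\<close>

lemma sdim_finite_span:
  assumes "module K V" "sdim K V A n"
  shows "\<exists>S. finite S \<and> S \<subseteq> A \<and> (\<forall>H. submodule H K V \<longrightarrow> S \<subseteq> H \<longrightarrow> A \<subseteq> H)"
  using assms(2)
proof (induction rule: sdim.induct)
  case zero
  then show ?case
    using module.submodule_zero[OF assms(1)] by (intro exI[of _ "{}"]) auto
next
  case (step A n v)
  then obtain S where S: "finite S" "S \<subseteq> A" "\<And>H. submodule H K V \<Longrightarrow> S \<subseteq> H \<Longrightarrow> A \<subseteq> H" by blast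
  note A = sdim_submodule[OF assms(1) step.hyps(1)]
  show ?case
  proof (intro exI[of _ "insert v S"] conjI allI impI)
    show "finite (insert v S)" using S by simp
    show "insert v S \<subseteq> adjoin K V A v"
      using S(2) adjoin_self[OF assms(1) A step.hyps(2)] adjoin_supset[OF assms(1) A step.hyps(2)] by blast
    fix H assume "submodule H K V" "insert v S \<subseteq> H"
    then show "adjoin K V A v \<subseteq> H"
      using S(3)[of H] by (intro adjoin_least[OF assms(1)]) auto
  qed
qed

section \<open>Finite dimension of the graded pieces and of the ring\<close>

context standard_graded_ring
begin

lemma module_K:
  assumes "module R V"
  shows "module K V"
proof -
  interpret V: module R V by fact
  show ?thesis
    by (rule moduleI)
      (auto simp: K_cring V.abelian_group_axioms G_closed V.smult_l_distr V.smult_r_distr V.smult_assoc1)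
qed

lemma mod_hom_K: "f \<in> mod_hom R V W \<Longrightarrow> f \<in> mod_hom K V W"
  by (auto simp: mod_hom_def G_closed)

lemma submodule_K: "submodule A R V \<Longrightarrow> submodule A K V"
  by (auto simp: submodule_def submodule_axioms_def G_closed)

abbreviation RM where "RM \<equiv> regular_module R"

lemma RM_module: "module K RM"
  by (rule module_K[OF regular_module_module])

lemma RM_minus: "a \<in> carrier R \<Longrightarrow> \<ominus>\<^bsub>RM\<^esub> a = \<ominus> a"
  by (rule abelian_group.minus_equality[OF module.axioms(2)[OF RM_module]]) (simp_all add: l_neg)

lemma G_submodule: "submodule (G j) K RM"
proof (rule module.submoduleI[OF RM_module])
  fix a assume "a \<in> G j"
  then show "\<ominus>\<^bsub>RM\<^esub> a \<in> G j" using G_minus by (simp add: RM_minus G_closed)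
qed (use G_mult[of _ 0 _ j] in \<open>auto simp: G_closed G_add\<close>)

text \<open>An infinite-dimensional \<open>G j\<close> would contain a strictly descending sequence
  of subspaces. Enlarged by \<open>I (Suc j)\<close> they become ideals, and their components of
  degree \<open>j\<close> show that the sequence stays strict.\<close>

lemma G_fin_dim: "fin_dim K RM (G j)"
proof (rule ccontr)
  assume nf: "\<not> fin_dim K RM (G j)"
  have "\<exists>W. \<forall>n. (submodule (W n) K RM \<and> W n \<subseteq> G j \<and> \<not> fin_dim K RM (W n)) \<and> W (Suc n) \<subset> W n"
  proof (rule dependent_nat_choice)
    show "\<exists>W. submodule W K RM \<and> W \<subseteq> G j \<and> \<not> fin_dim K RM W"
      using nf G_submodule by blast
    fix W n assume "submodule W K RM \<and> W \<subseteq> G j \<and> \<not> fin_dim K RM W"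
    then show "\<exists>H. (submodule H K RM \<and> H \<subseteq> G j \<and> \<not> fin_dim K RM H) \<and> H \<subset> W"
      using infinite_dim_descent[OF K_field RM_module, of W] by blast
  qed
  then obtain W where W': "\<forall>n. (submodule (W n) K RM \<and> W n \<subseteq> G j \<and> \<not> fin_dim K RM (W n)) \<and>
      W (Suc n) \<subset> W n" ..
  then have W: "submodule (W n) K RM" "W n \<subseteq> G j" "W (Suc n) \<subset> W n" for n
    by simp_all
  define L where "L n = {x \<in> I j. cmp j x \<in> W n}" for n
  have "ideal (L n) R" for n
  proof -
    note E = module.submoduleE[OF RM_module W(1)[of n]]
    have "\<ominus>\<^bsub>RM\<^esub> x = \<ominus> x" if "x \<in> W n" for x
      using W(2)[of n] that by (intro RM_minus G_closed[of _ j]) blast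
    then show ?thesis
      unfolding L_def using E(3-5) module.submodule_zero[OF RM_module W(1)[of n]] W(2)[of n]
      by (intro layer_ideal) auto
  qed
  moreover have "L (Suc n) \<subseteq> L n" for n
    using W(3)[of n] by (auto simp: L_def)
  ultimately obtain n where n: "\<forall>k\<ge>n. L k = L n"
    using descending_chain[of L] by blast
  have "W n \<subseteq> W (Suc n)"
  proof
    fix w assume w: "w \<in> W n"
    then have wG: "w \<in> G j" using W(2) by blast
    then have "w \<in> L n"
      using w G_subset_I[of j j] by (auto simp: L_def cmp_homogeneous)
    moreover have "L (Suc n) = L n" using n[rule_format, of "Suc n"] by simp
    ultimately have "w \<in> L (Suc n)" by metis
    then show "w \<in> W (Suc n)" by (simp add: L_def cmp_homogeneous[OF wG])
  qed
  then show False using W(3) by blast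
qed

lemma cmp_hom: "cmp p \<in> mod_hom K RM RM"
  using cmp_mult_homogeneous[of _ 0] by (auto simp: mod_hom_def cmp_add)

text \<open>Climb the filtration from \<open>I (Suc h)\<close>: on \<open>I q\<close> the component
  map of degree \<open>q\<close> has kernel \<open>I (Suc q)\<close> and image inside the
  finite-dimensional \<open>G q\<close>.\<close>

lemma R_fin_dim: "fin_dim K RM (carrier R)"
proof -
  have I: "submodule (I p) K RM" for p
  proof (rule module.submoduleI[OF RM_module])
    interpret J: ideal "I p" R by (rule I_ideal)
    show "\<ominus>\<^bsub>RM\<^esub> a \<in> I p" if "a \<in> I p" for a
      using that by (simp add: RM_minus J.a_inv_closed I_closed)
    show "a \<odot>\<^bsub>RM\<^esub> x \<in> I p" if "a \<in> carrier K" "x \<in> I p" for a x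
      using that J.I_l_closed G_closed by simp
  qed (use additive_subgroup.zero_closed[OF ideal.axioms(1)[OF I_ideal]]
      additive_subgroup.a_closed[OF ideal.axioms(1)[OF I_ideal]] I_closed in auto)
  have "fin_dim K RM (I (Suc h - p))" for p
  proof (induction p)
    case 0
    then show ?case using vdim_zero(1)[OF K_field RM_module] I_top by simp
  next
    case (Suc p)
    show ?case
    proof (cases "p \<le> h")
      case True
      let ?q = "Suc h - Suc p"
      have "{x \<in> I ?q. cmp ?q x = \<zero>\<^bsub>RM\<^esub>} = I (Suc ?q)"
        by (auto simp: I_def less_Suc_eq)
      moreover have "Suc ?q = Suc h - p" using True by simp
      ultimately have "fin_dim K RM {x \<in> I ?q. cmp ?q x = \<zero>\<^bsub>RM\<^esub>}"
        using Suc by simp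
      moreover have "fin_dim K RM (cmp ?q ` I ?q)"
        using cmp_props(1) I_closed
        by (intro fin_dim_subspace(1)[OF K_field RM_module G_fin_dim image_submodule[OF RM_module RM_module cmp_hom I]]) auto
      ultimately show ?thesis
        by (rule fin_dim_extension[OF K_field RM_module RM_module cmp_hom I])
    qed (use Suc in simp)
  qed
  from this[of "Suc h"] show ?thesis by (simp add: I_0)
qed

text \<open>All basis elements sit in degree zero, without the usual shifts by homological degree; a
  matrix of linear forms therefore maps degree \<open>j\<close> to degree
  \<open>Suc j\<close>.\<close>

definition piece :: "'i set \<Rightarrow> nat \<Rightarrow> ('i \<Rightarrow> 'a) set" where
  "piece B j = {u \<in> carrier (Free B). \<forall>b. u b \<in> G j}"

definition hdim :: "nat \<Rightarrow> nat" where
  "hdim j = vdim K RM (G j)"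

lemma free_module_K: "module K (Free B)"
  by (rule module_K[OF free_module_module])

lemma piece_dim:
  assumes "finite B"
  shows "fin_dim K (Free B) (piece B j)" and "vdim K (Free B) (piece B j) = card B * hdim j"
proof -
  have "piece B j = pow_sub RM B (G j)"
    using G_closed by (auto simp: piece_def free_module_eq_pow[OF assms] pow_module_simps pow_sub_def)
  then show "fin_dim K (Free B) (piece B j)"
    "vdim K (Free B) (piece B j) = card B * hdim j"
    using pow_sub_dim[OF K_field RM_module G_fin_dim assms]
    by (simp_all add: free_module_eq_pow[OF assms] hdim_def)
qed

lemma free_fin_dim:
  assumes "finite B"
  shows "fin_dim K (Free B) (carrier (Free B))"
  using pow_sub_dim(1)[OF K_field RM_module R_fin_dim assms]
  by (simp add: free_module_eq_pow[OF assms] pow_module_simps)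

text \<open>A submodule is a subspace of the finite-dimensional \<open>Free B\<close>, and a finite
  spanning set over \<open>K\<close> also generates it over \<open>R\<close>.\<close>

lemma noetherian_free:
  assumes "finite B" "submodule L R (Free B)"
  shows "\<exists>(D :: nat set) w. generates R (Free B) L D w"
proof -
  interpret F: module R "Free B" by (rule free_module_module)
  have "fin_dim K (Free B) L"
    by (rule fin_dim_subspace(1)[OF K_field free_module_K free_fin_dim[OF assms(1)] submodule_K[OF assms(2)]
          F.submoduleE(1)[OF assms(2)]])
  then obtain S where S: "finite S" "S \<subseteq> L" "\<And>H. submodule H K (Free B) \<Longrightarrow> S \<subseteq> H \<Longrightarrow> L \<subseteq> H"
    using sdim_finite_span[OF free_module_K] unfolding fin_dim_def by metis
  have Sc: "S \<subseteq> carrier (Free B)" using S(2) F.submoduleE(1)[OF assms(2)] by blast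
  have "L = submodule_gen R (Free B) S"
    using S(3)[OF submodule_K[OF submodule_gen_submodule[OF F.module_axioms Sc]] submodule_gen_incl]
      submodule_gen_least[OF assms(2) S(2)] by blast
  then show ?thesis
    using submodule_gen_generates[OF F.module_axioms S(1) Sc] by simp
qed

lemma generates_fin_dim:
  assumes "module R V" "generates R V L B x"
  shows "fin_dim K V L"
proof -
  have B: "finite B" "x \<in> B \<rightarrow> carrier V" "lin_ext R V x ` carrier (Free B) = L"
    using assms(2) by (simp_all add: generates_def)
  show ?thesis
    using rank_nullity(1)[OF K_field free_module_K module_K[OF assms(1)]
        mod_hom_K[OF lin_ext_hom[OF assms(1) B(2)]] free_fin_dim[OF B(1)]] B(3) by simp
qed

end

section \<open>Minimal linear syzygies\<close>

context standard_graded_ring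
begin

lemma I_finsum:
  assumes "finite A" "f \<in> A \<rightarrow> I p"
  shows "finsum R f A \<in> I p"
proof -
  have fc: "f \<in> A \<rightarrow> carrier R" using assms(2) I_closed by blast
  have "cmp i (finsum R f A) = \<zero>" if "i < p" for i
  proof -
    have "cmp i (finsum R f A) = (\<Oplus>a\<in>A. \<zero>)"
      unfolding cmp_finsum[OF assms(1) fc] using assms(2) I_cmp[OF _ that]
      by (intro finsum_cong') auto
    then show ?thesis by (simp add: finsum_zero)
  qed
  then show ?thesis using fc by (simp add: I_def finsum_closed)
qed

lemma I_1_linear_part: "x \<in> I 1 \<Longrightarrow> x \<ominus> cmp 1 x \<in> I 2"
  using cmp_homogeneous[OF cmp_props(1)[OF I_closed], of x 1]
  by (auto simp: I_def less_2_cases_iff a_minus_def r_neg cmp_add cmp_minus)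

text \<open>By standardness, whether an ideal contains \<open>I 2\<close> can be tested on products
  of two linear forms. Applied to annihilators, this shows first that \<open>I 2\<close> kills
  \<open>G 2\<close> and then that it kills \<open>I 1\<close>, so \<open>G 3\<close> controls all
  higher degrees.\<close>

lemma cube_zero:
  assumes G3: "G 3 = {\<zero>}"
  shows "\<mm> \<cdot> \<mm> \<cdot> \<mm> = {\<zero>}"
proof -
  define Ann where "Ann S = {x \<in> carrier R. \<forall>y\<in>S. x \<otimes> y = \<zero>}" for S
  have Ann: "ideal (Ann S) R" if "S \<subseteq> carrier R" for S
  proof (rule idealI)
    show "subgroup (Ann S) (add_monoid R)"
      using that by (intro add.subgroupI) (auto simp: Ann_def l_distr l_minus subset_iff simp flip: a_inv_def intro!: exI[of _ \<zero>])
    fix a x assume "a \<in> Ann S" and x: "x \<in> carrier R"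
    then have a: "a \<in> carrier R" "\<And>y. y \<in> S \<Longrightarrow> a \<otimes> y = \<zero>" by (auto simp: Ann_def)
    then have "x \<otimes> a \<otimes> y = \<zero>" if "y \<in> S" for y
      using x that \<open>S \<subseteq> carrier R\<close> m_assoc[of x a y] by auto
    then show "x \<otimes> a \<in> Ann S" using a x by (simp add: Ann_def)
    then show "a \<otimes> x \<in> Ann S" using a x m_comm[of a x] by simp
  qed (rule ring_axioms)
  have 1: "I 2 \<subseteq> Ann (G 2)"
  proof (rule I_2_subset[OF Ann])
    fix a b assume ab: "a \<in> G 1" "b \<in> G 1"
    have "a \<otimes> b \<otimes> y = \<zero>" if "y \<in> G 2" for y
    proof -
      have "1 + 2 = (3 :: nat)" by simp
      with G_mult[OF ab(2) that] G3 have "b \<otimes> y = \<zero>" by (metis singletonD)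
      then show ?thesis
        using m_assoc[OF ab(1)[THEN G_closed] ab(2)[THEN G_closed] that[THEN G_closed]]
          ab(1)[THEN G_closed] by simp
    qed
    then show "a \<otimes> b \<in> Ann (G 2)" using ab G_closed by (simp add: Ann_def)
  qed (use G_closed in blast)
  have 2: "I 2 \<subseteq> Ann (I 1)"
  proof (rule I_2_subset[OF Ann])
    fix a b assume ab: "a \<in> G 1" "b \<in> G 1"
    have abG: "a \<otimes> b \<in> G 2" using G_mult[OF ab] by (simp add: numeral_2_eq_2)
    have "a \<otimes> b \<otimes> c = \<zero>" if c: "c \<in> I 1" for c
    proof -
      have cc: "c \<in> carrier R" using c by (rule I_closed)
      define d where "d = c \<ominus> cmp 1 c"
      have d: "d \<in> I 2" unfolding d_def by (rule I_1_linear_part[OF c])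
      have "c = cmp 1 c \<oplus> d"
        unfolding d_def using cc by (simp add: a_minus_def r_neg2 a_comm[of c])
      then have "a \<otimes> b \<otimes> c = a \<otimes> b \<otimes> cmp 1 c \<oplus> a \<otimes> b \<otimes> d"
        using abG G_closed cc d I_closed by (metis r_distr cmp_closed)
      moreover have "a \<otimes> b \<otimes> cmp 1 c = \<zero>"
        using G_mult[OF abG cmp_props(1)[OF cc, of 1]] G3 by (simp add: numeral_3_eq_3)
      moreover have "a \<otimes> b \<otimes> d = \<zero>"
        using 1 d abG G_closed[OF abG] I_closed[OF d] m_comm[of "a \<otimes> b" d] by (auto simp: Ann_def)
      ultimately show ?thesis by simp
    qed
    then show "a \<otimes> b \<in> Ann (I 1)" using ab G_closed by (simp add: Ann_def)
  qed (use I_closed in blast)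
  note m = I_ideal[of 1, folded maximal_eq]
  note mm = ideal_prod_is_ideal[OF m m]
  have "\<mm> <#> \<mm> \<subseteq> I 2"
    unfolding maximal_eq set_mult_def using I_mult[of _ 1 _ 1] by (auto simp: numeral_2_eq_2)
  then have mm2: "\<mm> \<cdot> \<mm> \<subseteq> I 2"
    unfolding ideal_prod_eq_genideal[OF m m] by (rule genideal_minimal[OF I_ideal])
  then have "(\<mm> \<cdot> \<mm>) <#> \<mm> \<subseteq> {\<zero>}"
    unfolding set_mult_def using 2 by (auto simp: maximal_eq Ann_def)
  then have "\<mm> \<cdot> \<mm> \<cdot> \<mm> \<subseteq> {\<zero>}"
    unfolding ideal_prod_eq_genideal[OF mm m] by (rule genideal_minimal[OF zeroideal])
  moreover have "\<zero> \<in> \<mm> \<cdot> \<mm> \<cdot> \<mm>"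
    by (rule additive_subgroup.zero_closed[OF ideal.axioms(1)[OF ideal_prod_is_ideal[OF mm m]]])
  ultimately show ?thesis by blast
qed

text \<open>Generation in degree one again. This transfers the hypotheses on
  \<open>\<mm>\<^sup>2M\<close> and \<open>\<mm>\<^sup>2N\<close> to the filtration.\<close>

lemma I_2_prod: "I 2 \<subseteq> \<mm> \<cdot> \<mm>"
proof (rule I_2_subset)
  note m = I_ideal[of 1, folded maximal_eq]
  show "ideal (\<mm> \<cdot> \<mm>) R" by (rule ideal_prod_is_ideal[OF m m])
  fix a b assume "a \<in> G 1" "b \<in> G 1"
  then show "a \<otimes> b \<in> \<mm> \<cdot> \<mm>"
    using G_subset_I[of 1 1] by (auto simp: maximal_eq intro!: ideal_prod.prod)
qed

lemma hdim_0: "hdim 0 = 1"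
proof -
  have "adjoin K RM {\<zero>} \<one> = G 0"
  proof (intro equalityI subsetI)
    fix x assume "x \<in> adjoin K RM {\<zero>} \<one>"
    then obtain c where c: "x \<in> carrier R" "c \<in> G 0" "x \<ominus>\<^bsub>RM\<^esub> c = \<zero>"
      by (auto simp: adjoin_def G_closed)
    then have "x = c"
      using G_closed[OF c(2)] by (simp add: a_minus_def RM_minus) (metis minus_equality minus_minus a_inv_closed)
    with c show "x \<in> G 0" by simp
  next
    fix x assume x: "x \<in> G 0"
    then show "x \<in> adjoin K RM {\<zero>} \<one>"
      using G_closed[OF x] by (auto simp: adjoin_def a_minus_def RM_minus r_neg intro!: bexI[of _ x])
  qed
  moreover have "sdim K RM (adjoin K RM {\<zero>} \<one>) (Suc 0)"
    using sdim.zero[of K RM] one_not_zero by (intro sdim.step) auto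
  ultimately show ?thesis
    unfolding hdim_def using vdim_eqI[OF K_field RM_module] by simp
qed

lemma min_relations_I_1:
  assumes "module R V" "min_generates R V L B x" "u \<in> relations R V B x"
  shows "u b \<in> I 1"
proof (cases "b \<in> B")
  case True
  have "u b \<in> carrier R"
    using assms(3) free_module_coeff by (auto simp: relations_def)
  then show ?thesis
    using min_generates_nonunit[OF assms True] nonunit_mem by blast
next
  case False
  then show ?thesis using assms(3) by (auto simp: relations_def free_module_simps I_def)
qed

section \<open>Homogeneous components in free modules and graded syzygies\<close>

definition fcmp :: "nat \<Rightarrow> ('i \<Rightarrow> 'a) \<Rightarrow> 'i \<Rightarrow> 'a" where
  "fcmp j u = (\<lambda>b. cmp j (u b))"

lemma fcmp_piece: "u \<in> carrier (Free B) \<Longrightarrow> fcmp j u \<in> piece B j"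
proof -
  assume u: "u \<in> carrier (Free B)"
  have "{b. cmp j (u b) \<noteq> \<zero>} \<subseteq> {b. u b \<noteq> \<zero>}" by auto
  then show ?thesis
    using u free_module_coeff[OF u] cmp_props(1)
    by (auto simp: piece_def fcmp_def free_module_simps intro: finite_subset)
qed

lemma fcmp_closed: "u \<in> carrier (Free B) \<Longrightarrow> fcmp j u \<in> carrier (Free B)"
  using fcmp_piece by (auto simp: piece_def)

lemma fcmp_on_piece: "u \<in> piece B j \<Longrightarrow> fcmp j u = u"
  using cmp_homogeneous[of "u _" j j] by (simp add: piece_def fcmp_def)

lemma free_minus: "u \<in> carrier (Free B) \<Longrightarrow> v \<in> carrier (Free B) \<Longrightarrow>
    u \<ominus>\<^bsub>Free B\<^esub> v = (\<lambda>b. u b \<ominus> v b)"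
proof
  fix b assume u: "u \<in> carrier (Free B)" and v: "v \<in> carrier (Free B)"
  have "(u \<ominus>\<^bsub>Free B\<^esub> v) b = u b \<ominus>\<^bsub>RM\<^esub> v b"
    using mod_hom_diff[OF free_module_module regular_module_module free_eval_hom[OF cring_axioms] u v] .
  then show "(u \<ominus>\<^bsub>Free B\<^esub> v) b = u b \<ominus> v b"
    using free_module_coeff[OF v] by (simp add: a_minus_def RM_minus)
qed

lemma linear_part_diff:
  assumes x: "x \<in> carrier (Free B)" "\<And>c. x c \<in> I 1"
  shows "(x \<ominus>\<^bsub>Free B\<^esub> fcmp 1 x) c \<in> I 2"
proof -
  show ?thesis
    using I_1_linear_part[OF x(2)]
    by (subst free_minus[OF x(1) fcmp_closed[OF x(1)]]) (simp add: fcmp_def)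
qed

text \<open>By \<open>quad\<close>, the part of \<open>v b\<close> beyond its linear part is a
  combination of the \<open>v\<close> with coefficients \<open>t b\<close> in \<open>I 1\<close>.
  Repeated substitution pushes the error coefficients into \<open>I p\<close> for growing
  \<open>p\<close> until they vanish. The index set is unchanged, so minimality is
  inherited.\<close>

lemma linear_min_generates:
  assumes C: "min_generates R (Free B) L C v"
    and v1: "\<And>b c. b \<in> C \<Longrightarrow> v b c \<in> I 1"
    and lin: "\<And>b. b \<in> C \<Longrightarrow> fcmp 1 (v b) \<in> L"
    and quad: "\<And>r. r \<in> carrier (Free C) \<Longrightarrow>
      (\<And>c. lin_ext R (Free B) v r c \<in> I 2) \<Longrightarrow> (\<And>b. r b \<in> I 1)"
  shows "min_generates R (Free B) L C (\<lambda>b. fcmp 1 (v b))"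
proof -
  let ?F = "Free B" and ?E = "Free C"
  note F = free_module_module
  have gen: "generates R ?F L C v"
    and min: "\<forall>(D :: nat set) w. generates R ?F L D w \<longrightarrow> card C \<le> card D"
    using C unfolding min_generates_def by blast+
  have fin: "finite C" and vc: "v \<in> C \<rightarrow> carrier ?F"
    using gen by (simp_all add: generates_def)
  interpret F: module R ?F by (rule F)
  interpret E: module R ?E by (rule F)
  have L: "submodule L R ?F" by (rule generates_submodule[OF F gen])
  note LE = F.submoduleE[OF L]
  let ?v = "\<lambda>b. fcmp 1 (v b)"
  have v'L: "?v \<in> C \<rightarrow> L" using lin by auto
  have v'c: "?v \<in> C \<rightarrow> carrier ?F" using v'L LE(1) by auto
  note h = lin_ext_hom[OF F vc] and h' = lin_ext_hom[OF F v'c]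
  have "\<forall>b\<in>C. \<exists>t\<in>carrier ?E. (\<forall>d. t d \<in> I 1) \<and> v b = ?v b \<oplus>\<^bsub>?F\<^esub> lin_ext R ?F v t"
  proof
    fix b assume b: "b \<in> C"
    have vb: "v b \<in> carrier ?F" "fcmp 1 (v b) \<in> carrier ?F" using vc v'c b by auto
    have "v b \<ominus>\<^bsub>?F\<^esub> ?v b \<in> L"
      by (rule F.submodule_diff[OF L generates_mem[OF F gen b] lin[OF b]])
    then obtain t where t: "t \<in> carrier ?E" "v b \<ominus>\<^bsub>?F\<^esub> ?v b = lin_ext R ?F v t"
      using generatesE[OF F gen] by blast
    have "lin_ext R ?F v t c \<in> I 2" for c
      using linear_part_diff[OF vb(1) v1[OF b]] t(2) by simp
    then have "\<forall>d. t d \<in> I 1" using quad[OF t(1)] by blast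
    moreover have "v b = ?v b \<oplus>\<^bsub>?F\<^esub> lin_ext R ?F v t"
      unfolding t(2)[symmetric] using vb by (simp add: a_minus_def F.M.a_comm[of "v b"] F.M.r_neg2)
    ultimately show "\<exists>t\<in>carrier ?E. (\<forall>d. t d \<in> I 1) \<and> v b = ?v b \<oplus>\<^bsub>?F\<^esub> lin_ext R ?F v t"
      using t(1) by blast
  qed
  then obtain t where t: "\<And>b. b \<in> C \<Longrightarrow> t b \<in> carrier ?E" "\<And>b d. b \<in> C \<Longrightarrow> t b d \<in> I 1"
    "\<And>b. b \<in> C \<Longrightarrow> v b = ?v b \<oplus>\<^bsub>?F\<^esub> lin_ext R ?F v (t b)"
    by metis
  have tc: "t \<in> C \<rightarrow> carrier ?E" using t(1) by auto
  note ht = lin_ext_hom[OF F tc]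
  have step: "lin_ext R ?F v s = lin_ext R ?F ?v s \<oplus>\<^bsub>?F\<^esub> lin_ext R ?F v (lin_ext R ?E t s)"
    if s: "s \<in> carrier ?E" for s
  proof (rule free_hom_eq[OF cring_axioms F h mod_hom_plus[OF F F h' mod_hom_comp[OF ht h]] _ s])
    fix b assume b: "b \<in> C"
    show "lin_ext R ?F v (free_basis R b) = lin_ext R ?F ?v (free_basis R b) \<oplus>\<^bsub>?F\<^esub>
        lin_ext R ?F v (lin_ext R ?E t (free_basis R b))"
      unfolding lin_ext_basis[OF F vc b] lin_ext_basis[OF F v'c b] lin_ext_basis[OF F tc b]
      by (rule t(3)[OF b])
  qed
  have tI: "lin_ext R ?E t s d \<in> I (Suc p)" if s: "s \<in> carrier ?E" "\<And>b. s b \<in> I p" for s p d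
    unfolding lin_ext_coord[OF cring_axioms fin tc s(1)]
    using I_mult[OF s(2) t(2)] by (intro I_finsum[OF fin]) auto
  \<comment> \<open>\<open>k\<close> collects the coefficients already expressed through the linear
    parts; \<open>s\<close> holds the error, still expressed through \<open>v\<close>.\<close>
  have ex: "\<exists>k\<in>carrier ?E. \<exists>s\<in>carrier ?E. (\<forall>b. s b \<in> I p) \<and>
      lin_ext R ?F v r = lin_ext R ?F ?v k \<oplus>\<^bsub>?F\<^esub> lin_ext R ?F v s" if r: "r \<in> carrier ?E" for p r
  proof (induction p)
    case 0
    show ?case
      using r free_module_coeff[OF r] mod_hom_zero[OF F F h'] mod_hom_closed[OF h r]
      by (intro bexI[of _ "\<zero>\<^bsub>?E\<^esub>"] bexI[of _ r]) (auto simp: I_0)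
  next
    case (Suc p)
    then obtain k s where ks: "k \<in> carrier ?E" "s \<in> carrier ?E" "\<And>b. s b \<in> I p"
      "lin_ext R ?F v r = lin_ext R ?F ?v k \<oplus>\<^bsub>?F\<^esub> lin_ext R ?F v s" by blast
    have Ts: "lin_ext R ?E t s \<in> carrier ?E" by (rule mod_hom_closed[OF ht ks(2)])
    have "lin_ext R ?F v r = lin_ext R ?F ?v (k \<oplus>\<^bsub>?E\<^esub> s) \<oplus>\<^bsub>?F\<^esub> lin_ext R ?F v (lin_ext R ?E t s)"
      unfolding ks(4) step[OF ks(2)] mod_hom_add[OF h' ks(1,2)]
      using mod_hom_closed[OF h' ks(1)] mod_hom_closed[OF h' ks(2)] mod_hom_closed[OF h Ts]
      by (simp add: F.M.a_assoc)
    then show ?case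
      using ks Ts tI[OF ks(2,3)] by (intro bexI[of _ "k \<oplus>\<^bsub>?E\<^esub> s"] bexI[of _ "lin_ext R ?E t s"]) auto
  qed
  have "generates R ?F L C ?v"
  proof (rule generatesI[OF F L fin v'L])
    fix y assume "y \<in> L"
    then obtain r where r: "r \<in> carrier ?E" "y = lin_ext R ?F v r" using generatesE[OF F gen] by blast
    \<comment> \<open>After \<open>Suc h\<close> rounds the error coefficients lie in the zero
      ideal.\<close>
    from ex[OF r(1), of "Suc h"] obtain k s where ks: "k \<in> carrier ?E" "s \<in> carrier ?E" "\<And>b. s b \<in> I (Suc h)"
      "lin_ext R ?F v r = lin_ext R ?F ?v k \<oplus>\<^bsub>?F\<^esub> lin_ext R ?F v s" by blast
    have "s = \<zero>\<^bsub>?E\<^esub>" using ks(3) I_top by (auto simp: free_module_simps)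
    then have "y = lin_ext R ?F ?v k"
      using ks(4) r(2) mod_hom_zero[OF F F h] mod_hom_closed[OF h' ks(1)] by simp
    with ks(1) show "\<exists>u\<in>carrier ?E. lin_ext R ?F ?v u = y" by blast
  qed
  then show ?thesis unfolding min_generates_def using min by blast
qed

text \<open>A matrix of linear forms is homogeneous of degree one. From the second syzygies on, this
  is the source of gradedness.\<close>

lemma fcmp_lin_ext:
  assumes "finite C" "v \<in> C \<rightarrow> carrier (Free B)" "\<And>b c. b \<in> C \<Longrightarrow> v b c \<in> G 1"
    and u: "u \<in> carrier (Free C)"
  shows "fcmp (Suc j) (lin_ext R (Free B) v u) = lin_ext R (Free B) v (fcmp j u)"
proof
  fix c
  have vc: "b \<in> C \<Longrightarrow> v b c \<in> carrier R" for b using assms(3) G_closed by blast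
  note uc = free_module_coeff[OF u]
  have "cmp (Suc j) (u b \<otimes> v b c) = cmp j (u b) \<otimes> v b c" if "b \<in> C" for b
    using cmp_mult_homogeneous[OF assms(3)[OF that, of c] uc[of b], of "Suc j"] uc[of b] vc[OF that]
    by (simp add: m_comm)
  then have "cmp (Suc j) (\<Oplus>b\<in>C. u b \<otimes> v b c) = (\<Oplus>b\<in>C. cmp j (u b) \<otimes> v b c)"
    using uc vc by (subst cmp_finsum[OF assms(1)]) (auto intro!: finsum_cong')
  then show "fcmp (Suc j) (lin_ext R (Free B) v u) c = lin_ext R (Free B) v (fcmp j u) c"
    using lin_ext_coord[OF cring_axioms assms(1,2) u, where c = c]
      lin_ext_coord[OF cring_axioms assms(1,2) fcmp_closed[OF u, of j], where c = c]
    by (simp add: fcmp_def)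
qed

lemma fcmp_relations:
  assumes "finite C" "v \<in> C \<rightarrow> carrier (Free B)" "\<And>b c. b \<in> C \<Longrightarrow> v b c \<in> G 1"
    and u: "u \<in> relations R (Free B) C v"
  shows "fcmp j u \<in> relations R (Free B) C v"
proof -
  have uc: "u \<in> carrier (Free C)" and "lin_ext R (Free B) v u = (\<lambda>b. \<zero>)"
    using u by (auto simp: relations_def free_module_simps(2))
  then have "lin_ext R (Free B) v (fcmp j u) = (\<lambda>b. \<zero>)"
    using fcmp_lin_ext[OF assms(1-3) uc, of j] by (simp add: fcmp_def)
  then show ?thesis
    using fcmp_closed[OF uc] by (simp add: relations_def free_module_simps(2))
qed

text \<open>Rank-nullity for \<open>v\<close> restricted to degree \<open>j\<close>. If an element
  of \<open>L\<close> of degree \<open>Suc j\<close> has a preimage \<open>u\<close>, the component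
  of \<open>u\<close> in degree \<open>j\<close> is a preimage too, so the image is all of
  \<open>L \<inter> piece B (Suc j)\<close>.\<close>

lemma strand_dim:
  assumes gen: "generates R (Free B) L C v" and v: "\<And>b c. b \<in> C \<Longrightarrow> v b c \<in> G 1"
  shows "card C * hdim j = vdim K (Free C) (relations R (Free B) C v \<inter> piece C j) +
    vdim K (Free B) (L \<inter> piece B (Suc j))"
proof -
  let ?F = "Free B" and ?E = "Free C"
  note F = free_module_module
  have fin: "finite C" and vc: "v \<in> C \<rightarrow> carrier ?F" using gen by (auto simp: generates_def)
  let ?d = "lin_ext R ?F v"
  note h = lin_ext_hom[OF F vc]
  have pc: "u \<in> piece C j \<Longrightarrow> u \<in> carrier ?E" for u by (simp add: piece_def)
  have im: "?d ` piece C j = L \<inter> piece B (Suc j)"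
  proof (intro equalityI subsetI)
    fix y assume "y \<in> ?d ` piece C j"
    then obtain u where u: "u \<in> piece C j" "y = ?d u" by blast
    have "y = fcmp (Suc j) y"
      unfolding u(2) using fcmp_lin_ext[OF fin vc v pc[OF u(1)], of j] fcmp_on_piece[OF u(1)] by simp
    moreover have "y \<in> carrier ?F" using mod_hom_closed[OF h pc[OF u(1)]] u(2) by simp
    ultimately have "y \<in> piece B (Suc j)" using fcmp_piece[of y B "Suc j"] by simp
    moreover have "y \<in> L" using gen pc[OF u(1)] u(2) by (auto simp: generates_def)
    ultimately show "y \<in> L \<inter> piece B (Suc j)" by blast
  next
    fix y assume y: "y \<in> L \<inter> piece B (Suc j)"
    then obtain u where u: "u \<in> carrier ?E" "y = ?d u" using generatesE[OF F gen] by blast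
    have "y = ?d (fcmp j u)"
      using fcmp_lin_ext[OF fin vc v u(1), of j] fcmp_on_piece[of y B "Suc j"] y u(2) by simp
    then show "y \<in> ?d ` piece C j" using fcmp_piece[OF u(1)] by blast
  qed
  have ker: "{u \<in> piece C j. ?d u = \<zero>\<^bsub>?F\<^esub>} = relations R ?F C v \<inter> piece C j"
    by (auto simp: relations_def piece_def)
  from rank_nullity(2)[OF K_field free_module_K free_module_K mod_hom_K[OF h] piece_dim(1)[OF fin, of j]]
  show ?thesis unfolding im ker piece_dim(2)[OF fin] .
qed

text \<open>In degree one only constant coefficients and linear parts of \<open>v\<close>
  contribute, so the linear elements of \<open>L\<close> lie in the span of \<open>card C\<close>
  vectors. This serves the last stage, whose generators are not replaced by linear ones.\<close>

lemma linear_syzygies_bound: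
  assumes gen: "generates R (Free B) L C v" and v: "\<And>b c. b \<in> C \<Longrightarrow> v b c \<in> I 1"
    and B: "finite B"
  shows "vdim K (Free B) (L \<inter> piece B 1) \<le> card C"
proof -
  let ?F = "Free B" and ?E = "Free C"
  note F = free_module_module
  have fin: "finite C" and vc: "v \<in> C \<rightarrow> carrier ?F" using gen by (auto simp: generates_def)
  let ?v = "\<lambda>b. fcmp 1 (v b)"
  have v'c: "?v \<in> C \<rightarrow> carrier ?F" using vc fcmp_closed by auto
  note h = lin_ext_hom[OF F v'c]
  have L: "submodule L R ?F" by (rule generates_submodule[OF F gen])
  have "L \<inter> piece B 1 \<subseteq> lin_ext R ?F ?v ` piece C 0"
  proof
    fix y assume y: "y \<in> L \<inter> piece B 1"
    then obtain u where u: "u \<in> carrier ?E" "y = lin_ext R ?F v u" using generatesE[OF F gen] by blast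
    note uc = free_module_coeff[OF u(1)]
    have "lin_ext R ?F ?v (fcmp 0 u) c = y c" for c
    proof -
      have vbc: "b \<in> C \<Longrightarrow> v b c \<in> carrier R" for b using v I_closed by blast
      have e: "y c = (\<Oplus>b\<in>C. u b \<otimes> v b c)"
        unfolding u(2) by (rule lin_ext_coord[OF cring_axioms fin vc u(1)])
      have "y c = cmp 1 (y c)" using y cmp_homogeneous[of "y c" 1 1] by (auto simp: piece_def)
      also have "\<dots> = (\<Oplus>b\<in>C. cmp 1 (u b \<otimes> v b c))"
        unfolding e using uc vbc by (intro cmp_finsum[OF fin]) auto
      also have "\<dots> = (\<Oplus>b\<in>C. cmp 0 (u b) \<otimes> cmp 1 (v b c))"
        using uc vbc cmp_mult_I(2)[of _ 0 _ 1] v by (intro finsum_cong') (auto simp: I_0)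
      also have "\<dots> = lin_ext R ?F ?v (fcmp 0 u) c"
        unfolding lin_ext_coord[OF cring_axioms fin v'c fcmp_closed[OF u(1)]] by (simp add: fcmp_def)
      finally show ?thesis by simp
    qed
    then have "y = lin_ext R ?F ?v (fcmp 0 u)" by auto
    then show "y \<in> lin_ext R ?F ?v ` piece C 0" using fcmp_piece[OF u(1)] by blast
  qed
  note rn = rank_nullity[OF K_field free_module_K free_module_K mod_hom_K[OF h] piece_dim(1)[OF fin, of 0]]
  have "vdim K ?F (L \<inter> piece B 1) \<le> vdim K ?F (lin_ext R ?F ?v ` piece C 0)"
    using \<open>L \<inter> piece B 1 \<subseteq> _\<close>
    by (intro fin_dim_subspace(2)[OF K_field free_module_K rn(1)] Int_submodule[OF free_module_K]
        submodule_K[OF L] fin_dim_submodule[OF free_module_K piece_dim(1)[OF B]])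
  also have "\<dots> \<le> card C"
    using rn(2) piece_dim(2)[OF fin, of 0] hdim_0 by simp
  finally show ?thesis .
qed

end

lemma pow_module_hom:
  assumes "module R X" "module R V" "\<And>c. c \<in> B \<Longrightarrow> f c \<in> mod_hom R X V"
  shows "(\<lambda>x c. if c \<in> B then f c x else \<zero>\<^bsub>V\<^esub>) \<in> mod_hom R X (pow_module V B)"
proof -
  interpret V: module R V by fact
  show ?thesis
    using mod_hom_closed[OF assms(3)] mod_hom_add[OF assms(3)] mod_hom_smult[OF assms(3)]
    by (auto simp: mod_hom_def pow_module_simps pow_sub_def fun_eq_iff)
qed

section \<open>Dimension counts from vanishing Tor\<close>

locale tor_vanishing = standard_graded_ring R \<mm> h G
  for R :: "('a, 'r) ring_scheme" (structure) and \<mm> h G +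
  fixes M :: "('a, 'm, 'x) module_scheme" and N :: "('a, 'n, 'y) module_scheme"
  assumes M_fin_gen: "fin_gen_module R M" and M_nonzero: "\<not> zero_module M"
    and N_fin_gen: "fin_gen_module R N" and N_nonzero: "\<not> zero_module N"
    and M_killed: "ideal_smult R (\<mm> \<cdot> \<mm>) M = {\<zero>\<^bsub>M\<^esub>}"
    and N_killed: "ideal_smult R (\<mm> \<cdot> \<mm>) N = {\<zero>\<^bsub>N\<^esub>}"
    and Tor_zero: "i > 0 \<Longrightarrow> zero_module (Tor R M N i)"
begin

lemma M_module: "module R M" and N_module: "module R N"
  using M_fin_gen N_fin_gen by (auto simp: fin_gen_module_def)

sublocale N: module R N by (rule N_module)

lemmas N_K = module_K[OF N_module]
  and pow_K = module_K[OF pow_module_module[OF N_module]]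

lemma ideal_smult_mem: "a \<in> J \<Longrightarrow> x \<in> carrier V \<Longrightarrow> a \<odot>\<^bsub>V\<^esub> x \<in> ideal_smult R J V"
  unfolding ideal_smult_def by (rule subsetD[OF submodule_gen_incl]) blast

lemma I_2_kill:
  assumes "ideal_smult R (\<mm> \<cdot> \<mm>) V = {\<zero>\<^bsub>V\<^esub>}" "a \<in> I 2" "x \<in> carrier V"
  shows "a \<odot>\<^bsub>V\<^esub> x = \<zero>\<^bsub>V\<^esub>"
  using ideal_smult_mem[OF subsetD[OF I_2_prod assms(2)] assms(3)] assms(1) by simp

lemmas I_2_M = I_2_kill[OF M_killed] and I_2_N = I_2_kill[OF N_killed]

lemma fin_gen_generates:
  assumes "fin_gen_module R V"
  shows "\<exists>(B :: nat set) x. generates R V (carrier V) B x"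
proof -
  obtain S where "module R V" "finite S" "S \<subseteq> carrier V" "submodule_gen R V S = carrier V"
    using assms by (auto simp: fin_gen_module_def)
  then show ?thesis using submodule_gen_generates[of R V S] by simp
qed

lemma N_fin_dim: "fin_dim K N (carrier N)"
  using fin_gen_generates[OF N_fin_gen] generates_fin_dim[OF N_module] by blast

text \<open>This is \<open>\<mm>N\<close>: matrices with entries in \<open>I 1\<close> take values
  in it and, by \<open>I_1_P\<close>, annihilate it.\<close>

definition P :: "'n set" where
  "P = ideal_smult R (I 1) N"

lemma P_submodule: "submodule P R N"
  unfolding P_def ideal_smult_def
  by (rule submodule_gen_submodule[OF N_module]) (auto simp: I_closed)

lemma P_mem: "a \<in> I 1 \<Longrightarrow> x \<in> carrier N \<Longrightarrow> a \<odot>\<^bsub>N\<^esub> x \<in> P"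
  unfolding P_def by (rule ideal_smult_mem)

lemma P_carrier: "x \<in> P \<Longrightarrow> x \<in> carrier N"
  using N.submoduleE(1)[OF P_submodule] by blast

lemma I_1_P: "a \<in> I 1 \<Longrightarrow> x \<in> P \<Longrightarrow> a \<odot>\<^bsub>N\<^esub> x = \<zero>\<^bsub>N\<^esub>"
proof -
  assume a: "a \<in> I 1" and x: "x \<in> P"
  have ac: "a \<in> carrier R" using a by (rule I_closed)
  have "(\<lambda>x. a \<odot>\<^bsub>N\<^esub> x) \<in> mod_hom R N N"
    by (rule mod_hom_scale[OF N_module N_module mod_hom_id ac])
  from ker_submodule[OF N_module N_module this N.carrier_is_submodule]
  have sub: "submodule {x \<in> carrier N. a \<odot>\<^bsub>N\<^esub> x = \<zero>\<^bsub>N\<^esub>} R N" .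
  have "P \<subseteq> {x \<in> carrier N. a \<odot>\<^bsub>N\<^esub> x = \<zero>\<^bsub>N\<^esub>}"
    unfolding P_def ideal_smult_def
  proof (rule submodule_gen_least[OF sub], safe)
    fix b y assume b: "b \<in> I 1" and y: "y \<in> carrier N"
    have bc: "b \<in> carrier R" using b by (rule I_closed)
    show "b \<odot>\<^bsub>N\<^esub> y \<in> carrier N" using bc y by simp
    have "a \<otimes> b \<in> I 2" using I_mult[OF a b] by (simp add: numeral_2_eq_2)
    then show "a \<odot>\<^bsub>N\<^esub> (b \<odot>\<^bsub>N\<^esub> y) = \<zero>\<^bsub>N\<^esub>"
      using I_2_N y ac bc by (simp flip: N.smult_assoc1)
  qed
  with x show ?thesis by blast
qed

text \<open>Nakayama is immediate here: if \<open>\<mm>N = N\<close>, then \<open>\<mm>\<close>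
  annihilates \<open>N\<close> by \<open>I_1_P\<close>, so \<open>N\<close> would be zero.\<close>

lemma P_proper: "P \<noteq> carrier N"
proof
  assume eq: "P = carrier N"
  have "ideal_smult R (I 1) N \<subseteq> {\<zero>\<^bsub>N\<^esub>}"
    unfolding ideal_smult_def
    by (rule submodule_gen_least[OF zero_submodule[OF N_module]], safe) (rule I_1_P, simp_all add: eq)
  then have "P \<subseteq> {\<zero>\<^bsub>N\<^esub>}" by (simp add: P_def)
  then show False
    using N_nonzero eq N.submodule_zero[OF P_submodule] by (auto simp: zero_module_def)
qed

text \<open>Multiplication by a unit is onto \<open>N\<close> and cannot land in the proper
  submodule \<open>P\<close>.\<close>

lemma I_1_if_smult_P:
  assumes r: "r \<in> carrier R" and rP: "\<And>n. n \<in> carrier N \<Longrightarrow> r \<odot>\<^bsub>N\<^esub> n \<in> P"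
  shows "r \<in> I 1"
proof (rule nonunit_mem[OF r], rule notI)
  assume u: "r \<in> Units R"
  have "n \<in> P" if n: "n \<in> carrier N" for n
  proof -
    have "r \<odot>\<^bsub>N\<^esub> (inv r \<odot>\<^bsub>N\<^esub> n) \<in> P" using u n by (intro rP) simp
    moreover have "r \<odot>\<^bsub>N\<^esub> (inv r \<odot>\<^bsub>N\<^esub> n) = n"
      using u n r by (simp flip: N.smult_assoc1)
    ultimately show ?thesis by simp
  qed
  then show False using P_proper P_carrier by blast
qed

lemma exact:
  assumes "syzygy R M B C v"
    and "generates R (Free C) (relations R (Free B) C v) (D :: nat set) w"
    and "n \<in> C \<rightarrow> carrier N"
    and "\<And>c. c \<in> B \<Longrightarrow> (\<Oplus>\<^bsub>N\<^esub>b\<in>C. v b c \<odot>\<^bsub>N\<^esub> n b) = \<zero>\<^bsub>N\<^esub>"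
  shows "\<exists>p\<in>D \<rightarrow> carrier N. \<forall>b\<in>C. n b = (\<Oplus>\<^bsub>N\<^esub>c\<in>D. w c b \<odot>\<^bsub>N\<^esub> p c)"
  by (rule syzygy_exact[OF M_module N_module _ _ assms(1-3)])
    (simp_all add: noetherian_free Tor_zero assms(4))

text \<open>A cycle is the value of the next matrix \<open>w\<close> at some \<open>p\<close>. The
  columns of \<open>w\<close> are relations, so \<open>min\<close> puts their entries into
  \<open>I 1\<close>.\<close>

lemma exact_P:
  assumes S: "syzygy R M B C v" and min: "\<And>u b. u \<in> relations R (Free B) C v \<Longrightarrow> u b \<in> I 1"
    and n: "n \<in> C \<rightarrow> carrier N"
    and 0: "\<And>c. c \<in> B \<Longrightarrow> (\<Oplus>\<^bsub>N\<^esub>b\<in>C. v b c \<odot>\<^bsub>N\<^esub> n b) = \<zero>\<^bsub>N\<^esub>"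
    and b: "b \<in> C"
  shows "n b \<in> P"
proof -
  have fin: "finite C" "v \<in> C \<rightarrow> carrier (Free B)" using syzygy_family[OF S] by auto
  obtain D :: "nat set" and w where D: "generates R (Free C) (relations R (Free B) C v) D w"
    using noetherian_free[OF fin(1) relations_submodule[OF free_module_module fin(2)]] by blast
  obtain p where p: "p \<in> D \<rightarrow> carrier N" "\<forall>b\<in>C. n b = (\<Oplus>\<^bsub>N\<^esub>c\<in>D. w c b \<odot>\<^bsub>N\<^esub> p c)"
    using exact[OF S D n] 0 by auto
  have "w c b \<odot>\<^bsub>N\<^esub> p c \<in> P" if "c \<in> D" for c
    using P_mem min[OF generates_mem[OF free_module_module D that]] p(1) that by auto
  then show ?thesis
    using p(2) b D by (auto simp: generates_def intro!: finsum_submodule[OF N_module P_submodule])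
qed

lemma quadratic_coefficients:
  assumes S: "syzygy R M B C v" and min: "\<And>u b. u \<in> relations R (Free B) C v \<Longrightarrow> u b \<in> I 1"
    and r: "r \<in> carrier (Free C)" and x: "\<And>c. lin_ext R (Free B) v r c \<in> I 2"
  shows "r b \<in> I 1"
proof (cases "b \<in> C")
  case True
  have fin: "finite C" "v \<in> C \<rightarrow> carrier (Free B)" using syzygy_family[OF S] by auto
  note rc = free_module_coeff[OF r]
  have vc: "v b c \<in> carrier R" if "b \<in> C" for b c
    using free_module_coeff[OF funcset_mem[OF fin(2) that]] .
  show ?thesis
  proof (rule I_1_if_smult_P[OF rc])
    fix n assume n: "n \<in> carrier N"
    show "r b \<odot>\<^bsub>N\<^esub> n \<in> P"
    proof (rule exact_P[OF S _ _ _ True])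
      show "u b \<in> I 1" if "u \<in> relations R (Free B) C v" for u b
        by (rule min[OF that])
      show "(\<lambda>b. r b \<odot>\<^bsub>N\<^esub> n) \<in> C \<rightarrow> carrier N" using rc n by simp
      fix c
      have "(\<Oplus>\<^bsub>N\<^esub>b\<in>C. v b c \<odot>\<^bsub>N\<^esub> (r b \<odot>\<^bsub>N\<^esub> n)) = (\<Oplus>\<^bsub>N\<^esub>b\<in>C. (r b \<otimes> v b c) \<odot>\<^bsub>N\<^esub> n)"
        using rc vc n by (intro N.finsum_cong') (auto simp: m_comm simp flip: N.smult_assoc1)
      also have "\<dots> = (\<Oplus>b\<in>C. r b \<otimes> v b c) \<odot>\<^bsub>N\<^esub> n"
        using rc vc n by (intro finsum_smult_rdistr[OF N_module fin(1), symmetric]) auto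
      also have "\<dots> = \<zero>\<^bsub>N\<^esub>"
        using x[of c] n unfolding lin_ext_coord[OF cring_axioms fin r] by (rule I_2_N)
      finally show "(\<Oplus>\<^bsub>N\<^esub>b\<in>C. v b c \<odot>\<^bsub>N\<^esub> (r b \<odot>\<^bsub>N\<^esub> n)) = \<zero>\<^bsub>N\<^esub>" .
    qed
  qed
next
  case False
  then show ?thesis using r by (auto simp: free_module_simps I_def)
qed

text \<open>The differential tensored with \<open>N\<close>, read in coordinates. The value zero off
  \<open>B\<close> follows the convention of \<open>pow_module\<close>.\<close>

definition coord_map :: "nat set \<Rightarrow> nat set \<Rightarrow> (nat \<Rightarrow> nat \<Rightarrow> 'a) \<Rightarrow> (nat \<Rightarrow> 'n) \<Rightarrow> nat \<Rightarrow> 'n" where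
  "coord_map B C v = (\<lambda>n c. if c \<in> B then (\<Oplus>\<^bsub>N\<^esub>b\<in>C. v b c \<odot>\<^bsub>N\<^esub> n b) else \<zero>\<^bsub>N\<^esub>)"

lemma coord_map_hom:
  assumes "finite C" "v \<in> C \<rightarrow> carrier (Free B)"
  shows "coord_map B C v \<in> mod_hom R (pow_module N C) (pow_module N B)"
  unfolding coord_map_def
  using free_module_coeff[OF funcset_mem[OF assms(2)]]
  by (intro pow_module_hom[OF pow_module_module[OF N_module] N_module]
      mod_hom_sum_fun[OF pow_module_module[OF N_module] N_module assms(1)]
      mod_hom_scale[OF pow_module_module[OF N_module] N_module] pow_module_eval[OF N_module])

text \<open>In the notation of the overview \<open>dP\<close> is \<open>p\<close> and
  \<open>dN\<close> is \<open>p + q\<close>; keeping both avoids subtraction of naturals in the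
  inequalities.\<close>

definition dN where "dN = vdim K N (carrier N)"
definition dP where "dP = vdim K N P"

lemma P_fin_dim: "fin_dim K N P"
  by (rule fin_dim_subspace(1)[OF K_field N_K N_fin_dim submodule_K[OF P_submodule]
        N.submoduleE(1)[OF P_submodule]])

lemma dP_less: "dP < dN"
proof -
  note KP = submodule_K[OF P_submodule]
  note q = quot_module_proj[OF N_K KP]
  note Q = quot_module_module[OF N_K KP]
  note rn = rank_nullity[OF K_field N_K Q q(1) N_fin_dim]
  have "{x \<in> carrier N. P +>\<^bsub>N\<^esub> x = \<zero>\<^bsub>quot_module N P\<^esub>} = P"
    using q(2) P_carrier by blast
  with rn(2) have eq: "dN = dP + vdim K (quot_module N P) ((\<lambda>x. P +>\<^bsub>N\<^esub> x) ` carrier N)"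
    by (simp add: dN_def dP_def)
  have "vdim K (quot_module N P) ((\<lambda>x. P +>\<^bsub>N\<^esub> x) ` carrier N) \<noteq> 0"
  proof
    assume "vdim K (quot_module N P) ((\<lambda>x. P +>\<^bsub>N\<^esub> x) ` carrier N) = 0"
    from vdim_eq_0[OF K_field Q rn(1) this] have "x \<in> P" if "x \<in> carrier N" for x
      using q(2)[OF that] that by blast
    then show False using P_proper P_carrier by blast
  qed
  with eq show ?thesis by simp
qed

lemma coord_map_rank:
  assumes "finite C" "v \<in> C \<rightarrow> carrier (Free B)"
  shows "fin_dim K (pow_module N B) (coord_map B C v ` carrier (pow_module N C))"
    and "card C * dN = vdim K (pow_module N C) {n \<in> carrier (pow_module N C).
        coord_map B C v n = \<zero>\<^bsub>pow_module N B\<^esub>} +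
      vdim K (pow_module N B) (coord_map B C v ` carrier (pow_module N C))"
  using rank_nullity[OF K_field pow_K
      pow_K mod_hom_K[OF coord_map_hom[OF assms]]
      pow_sub_dim(1)[OF K_field N_K N_fin_dim assms(1), folded pow_module_simps(1)]]
    pow_sub_dim(2)[OF K_field N_K N_fin_dim assms(1), folded pow_module_simps(1)]
  by (simp_all add: dN_def)

text \<open>Cycles lie in \<open>P\<close> coordinatewise by \<open>exact_P\<close>, and boundaries
  do because the entries of \<open>v\<close> are in \<open>I 1\<close>. Rank-nullity thus bounds a
  power of \<open>N\<close> by two powers of \<open>P\<close>.\<close>

lemma rank_upper:
  assumes S: "syzygy R M B C v" and min: "\<And>u b. u \<in> relations R (Free B) C v \<Longrightarrow> u b \<in> I 1"
    and v: "\<And>b c. b \<in> C \<Longrightarrow> v b c \<in> I 1"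
  shows "card C * dN \<le> card C * dP + card B * dP"
proof -
  have fin: "finite B" "finite C" "v \<in> C \<rightarrow> carrier (Free B)" using syzygy_family[OF S] by auto
  let ?Z = "{n \<in> carrier (pow_module N C). coord_map B C v n = \<zero>\<^bsub>pow_module N B\<^esub>}"
  let ?Y = "coord_map B C v ` carrier (pow_module N C)"
  note hom = mod_hom_K[OF coord_map_hom[OF fin(2,3)]]
  note pd = pow_sub_dim[OF K_field N_K P_fin_dim, folded dP_def]
  have "?Z \<subseteq> pow_sub N C P"
  proof
    fix n assume "n \<in> ?Z"
    then have n: "n \<in> pow_sub N C (carrier N)" "coord_map B C v n = (\<lambda>b. \<zero>\<^bsub>N\<^esub>)"
      by (simp_all add: pow_module_simps)
    have "(\<Oplus>\<^bsub>N\<^esub>b\<in>C. v b c \<odot>\<^bsub>N\<^esub> n b) = \<zero>\<^bsub>N\<^esub>" if "c \<in> B" for c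
      using fun_cong[OF n(2), of c] that by (simp add: coord_map_def)
    note z = this
    have "n b \<in> P" if "b \<in> C" for b
      by (rule exact_P[OF S _ _ _ that]) (use n(1) z min in \<open>auto simp: pow_sub_def\<close>)
    with n(1) show "n \<in> pow_sub N C P" by (simp add: pow_sub_def)
  qed
  then have 1: "vdim K (pow_module N C) ?Z \<le> card C * dP"
    using fin_dim_subspace(2)[OF K_field pow_K pd(1)[OF fin(2)]
        ker_submodule[OF pow_K pow_K hom module.carrier_is_submodule[OF pow_K]]] pd(2)[OF fin(2)] by simp
  have "?Y \<subseteq> pow_sub N B P"
    using v P_mem
    by (auto simp: coord_map_def pow_sub_def pow_module_simps
        intro!: finsum_submodule[OF N_module P_submodule fin(2)])
  then have "vdim K (pow_module N B) ?Y \<le> card B * dP"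
    using fin_dim_subspace(2)[OF K_field pow_K pd(1)[OF fin(1)]
        fin_dim_submodule[OF pow_K coord_map_rank(1)[OF fin(2,3)]]] pd(2)[OF fin(1)] by simp
  with 1 coord_map_rank(2)[OF fin(2,3)] show ?thesis by linarith
qed

text \<open>The opposite inclusions: families in \<open>P\<close> over \<open>D\<close> are killed
  by \<open>w\<close>, and families in \<open>P\<close> over \<open>C\<close> are killed by
  \<open>v\<close>, hence are values of \<open>w\<close> by exactness.\<close>

lemma rank_lower:
  assumes S: "syzygy R M B C v" and v: "\<And>b c. b \<in> C \<Longrightarrow> v b c \<in> I 1"
    and D: "generates R (Free C) (relations R (Free B) C v) (D :: nat set) w"
    and w: "\<And>b c. b \<in> D \<Longrightarrow> w b c \<in> I 1"
  shows "card D * dP + card C * dP \<le> card D * dN"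
proof -
  have fin: "finite C" "finite D" "w \<in> D \<rightarrow> carrier (Free C)"
    using syzygy_family[OF S] D by (simp_all add: generates_def)
  let ?Z = "{n \<in> carrier (pow_module N D). coord_map C D w n = \<zero>\<^bsub>pow_module N C\<^esub>}"
  let ?Y = "coord_map C D w ` carrier (pow_module N D)"
  note hom = mod_hom_K[OF coord_map_hom[OF fin(2,3)]]
  note pd = pow_sub_dim[OF K_field N_K P_fin_dim, folded dP_def]
  have zero: "(\<Oplus>\<^bsub>N\<^esub>b\<in>A. a b \<odot>\<^bsub>N\<^esub> n b) = \<zero>\<^bsub>N\<^esub>"
    if "\<And>b. b \<in> A \<Longrightarrow> a b \<in> I 1" "\<And>b. b \<in> A \<Longrightarrow> n b \<in> P" for A :: "nat set" and a n
  proof -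
    have "(\<Oplus>\<^bsub>N\<^esub>b\<in>A. a b \<odot>\<^bsub>N\<^esub> n b) = (\<Oplus>\<^bsub>N\<^esub>b\<in>A. \<zero>\<^bsub>N\<^esub>)"
      using I_1_P that by (intro N.finsum_cong') auto
    then show ?thesis by simp
  qed
  have "pow_sub N D P \<subseteq> ?Z"
    using P_carrier zero[OF w]
    by (auto simp: coord_map_def pow_module_simps pow_sub_def fun_eq_iff)
  then have 1: "card D * dP \<le> vdim K (pow_module N D) ?Z"
    using fin_dim_subspace[OF K_field pow_K _ submodule_K[OF pow_sub_submodule[OF N_module P_submodule order_refl]]]
      fin_dim_subspace(1)[OF K_field pow_K
        pow_sub_dim(1)[OF K_field N_K N_fin_dim fin(2), folded pow_module_simps(1)]
        ker_submodule[OF pow_K pow_K hom module.carrier_is_submodule[OF pow_K]]] pd(2)[OF fin(2)] by fastforce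
  have "pow_sub N C P \<subseteq> ?Y"
  proof
    fix n assume n: "n \<in> pow_sub N C P"
    have "\<exists>p\<in>D \<rightarrow> carrier N. \<forall>b\<in>C. n b = (\<Oplus>\<^bsub>N\<^esub>c\<in>D. w c b \<odot>\<^bsub>N\<^esub> p c)"
    proof (rule exact[OF S D])
      show "n \<in> C \<rightarrow> carrier N" using n P_carrier by (auto simp: pow_sub_def)
      show "(\<Oplus>\<^bsub>N\<^esub>b\<in>C. v b c \<odot>\<^bsub>N\<^esub> n b) = \<zero>\<^bsub>N\<^esub>" for c
        using n by (intro zero v) (auto simp: pow_sub_def)
    qed
    then obtain p where p: "p \<in> D \<rightarrow> carrier N" "\<forall>b\<in>C. n b = (\<Oplus>\<^bsub>N\<^esub>c\<in>D. w c b \<odot>\<^bsub>N\<^esub> p c)" by blast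
    define q where "q c = (if c \<in> D then p c else \<zero>\<^bsub>N\<^esub>)" for c
    have q: "q \<in> carrier (pow_module N D)" using p(1) by (auto simp: q_def pow_module_simps pow_sub_def)
    have pc: "p c \<in> carrier N" and wc: "w c b \<in> carrier R" if "c \<in> D" for c b
      using p(1) w[OF that] I_closed that by auto
    have "(\<Oplus>\<^bsub>N\<^esub>c\<in>D. w c b \<odot>\<^bsub>N\<^esub> q c) = (\<Oplus>\<^bsub>N\<^esub>c\<in>D. w c b \<odot>\<^bsub>N\<^esub> p c)" for b
      using pc wc by (intro N.finsum_cong') (auto simp: q_def)
    then have "n = coord_map C D w q"
      using n p(2) by (auto simp: coord_map_def pow_sub_def)
    with q show "n \<in> ?Y" by blast
  qed
  then have "card C * dP \<le> vdim K (pow_module N C) ?Y"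
    using fin_dim_subspace(2)[OF K_field pow_K coord_map_rank(1)[OF fin(2,3)]
        submodule_K[OF pow_sub_submodule[OF N_module P_submodule order_refl]]] pd(2)[OF fin(1)] by simp
  with 1 coord_map_rank(2)[OF fin(2,3)] show ?thesis by linarith
qed

text \<open>Minimal generators are chosen first, and then their linear parts are taken. The premise
  \<open>syz\<close> speaks of arbitrary generators because exactness is applied to the original
  ones.\<close>

lemma linear_stage:
  assumes B: "finite B" and L: "submodule L R (Free B)"
    and syz: "\<And>C v. generates R (Free B) L C v \<Longrightarrow> syzygy R M B C v"
    and LI: "\<And>u b. u \<in> L \<Longrightarrow> u b \<in> I 1" and graded: "\<And>u. u \<in> L \<Longrightarrow> fcmp 1 u \<in> L"
  shows "\<exists>C v. min_generates R (Free B) L C v \<and> (\<forall>b\<in>C. \<forall>c. v b c \<in> G 1)"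
proof -
  note F = free_module_module
  obtain D :: "nat set" and w where "generates R (Free B) L D w"
    using noetherian_free[OF B L] by blast
  then obtain C v where min: "min_generates R (Free B) L C v"
    using min_generates_exists[OF F] by blast
  then have gen: "generates R (Free B) L C v" by (simp add: min_generates_def)
  note mem = generates_mem[OF F gen]
  have "min_generates R (Free B) L C (\<lambda>b. fcmp 1 (v b))"
  proof (rule linear_min_generates[OF min])
    show "v b c \<in> I 1" if "b \<in> C" for b c by (rule LI[OF mem[OF that]])
    show "fcmp 1 (v b) \<in> L" if "b \<in> C" for b by (rule graded[OF mem[OF that]])
    show "r b \<in> I 1" if "r \<in> carrier (Free C)" "\<And>c. lin_ext R (Free B) v r c \<in> I 2" for r b
      by (rule quadratic_coefficients[OF syz[OF gen] _ that]) (rule min_relations_I_1[OF F min])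
  qed
  moreover have "fcmp 1 (v b) c \<in> G 1" if "b \<in> C" for b c
    unfolding fcmp_def by (rule cmp_props(1)[OF I_closed[OF LI[OF mem[OF that]]]])
  ultimately show ?thesis by blast
qed

text \<open>Here \<open>k2\<close> and \<open>k3\<close> stand for the second syzygies in degrees
  one and two, \<open>l\<close> for the third syzygies in degree one, and \<open>n = p + q\<close>.
  The assumptions give \<open>k3 q \<ge> g1 h1 p - g2 p = g0 h2 p \<ge> g1 h2 q = k3 q + g0 h3
  q\<close>.\<close>

lemma dimension_inequality:
  fixes g0 g1 g2 g3 h1 h2 h3 p n k2 k3 l :: nat
  assumes "g1 * h1 = k2 + g0 * h2" "g1 * h2 = k3 + g0 * h3" "g2 = k2" "g2 * h1 = l + k3" "l \<le> g3"
    and "g1 * n \<le> g1 * p + g0 * p" "g2 * p + g1 * p \<le> g2 * n" "g3 * n \<le> g3 * p + g2 * p" "p < n" "g0 > 0"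
  shows "h3 = 0"
proof -
  obtain q where q: "n = p + q" "q > 0" using \<open>p < n\<close> less_imp_add_positive by blast
  have i1: "g1 * q \<le> g0 * p" and i2: "g1 * p \<le> g2 * q" and i3: "g3 * q \<le> g2 * p"
    using assms(6-8) by (simp_all add: q(1) algebra_simps)
  have "(g1 * h2) * q = k3 * q + g0 * h3 * q"
    unfolding assms(2) by (rule add_mult_distrib)
  moreover have "(g2 * h1) * q = l * q + k3 * q"
    unfolding assms(4) by (rule add_mult_distrib)
  moreover have "(g1 * h1) * p = g2 * p + g0 * h2 * p"
    unfolding assms(1,3) by (rule add_mult_distrib)
  moreover have "l * q \<le> g2 * p" using mult_le_mono1[OF assms(5), of q] i3 by linarith
  moreover have "(g1 * h2) * q \<le> g0 * h2 * p" "(g1 * h1) * p \<le> (g2 * h1) * q"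
    using mult_le_mono1[OF i1, of h2] mult_le_mono1[OF i2, of h1] by (simp_all add: ac_simps)
  ultimately have "g0 * h3 * q = 0" by linarith
  then show ?thesis using q(2) \<open>g0 > 0\<close> by simp
qed

lemma hdim_3: "hdim 3 = 0"
proof -
  note F = free_module_module
  obtain B0 x where min0: "min_generates R M (carrier M) B0 x"
    using fin_gen_generates[OF M_fin_gen] min_generates_exists[OF M_module] by blast
  then have gen0: "generates R M (carrier M) B0 x" by (simp add: min_generates_def)
  have B0: "finite B0" and xc: "x \<in> B0 \<rightarrow> carrier M"
    and onto: "lin_ext R M x ` carrier (Free B0) = carrier M"
    using gen0 by (simp_all add: generates_def)
  note h0 = lin_ext_hom[OF M_module xc]
  \<comment> \<open>The nonvanishing of \<open>M\<close> enters here: the positive rank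
    \<open>card B0\<close> is cancelled at the end.\<close>
  have "B0 \<noteq> {}"
  proof
    assume "B0 = {}"
    then have "carrier (Free B0) = {\<zero>\<^bsub>Free B0\<^esub>}" by (auto simp: free_module_simps)
    with onto mod_hom_zero[OF F M_module h0] have "carrier M = {\<zero>\<^bsub>M\<^esub>}" by simp
    then show False using M_nonzero by (simp add: zero_module_def)
  qed
  then have g0: "card B0 > 0" using B0 by (simp add: card_gt_0_iff)
  let ?K1 = "relations R M B0 x"
  note K1 = relations_submodule[OF M_module xc]
  interpret F0: module R "Free B0" by (rule F)
  interpret M: module R M by (rule M_module)
  have K1I: "u b \<in> I 1" if "u \<in> ?K1" for u b by (rule min_relations_I_1[OF M_module min0 that])
  have K1c: "u \<in> carrier (Free B0)" if "u \<in> ?K1" for u using that by (simp add: relations_def)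
  have K1Q: "u \<in> ?K1" if u: "u \<in> carrier (Free B0)" "\<And>b. u b \<in> I 2" for u
  proof -
    have "lin_ext R M x u = (\<Oplus>\<^bsub>M\<^esub>b\<in>B0. u b \<odot>\<^bsub>M\<^esub> x b)"
      by (rule lin_ext_finite[OF cring_axioms M_module B0 xc u(1)])
    also have "\<dots> = (\<Oplus>\<^bsub>M\<^esub>b\<in>B0. \<zero>\<^bsub>M\<^esub>)"
      using I_2_M[OF u(2)] xc by (intro M.finsum_cong') auto
    finally show ?thesis using u(1) by (simp add: relations_def)
  qed
  \<comment> \<open>\<open>M\<close> has no grading to appeal to; instead \<open>u\<close> and its
    linear part differ by an element of order two, which \<open>K1Q\<close> places in
    \<open>?K1\<close>.\<close>
  have K1lin: "fcmp 1 u \<in> ?K1" if u: "u \<in> ?K1" for u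
  proof -
    note uc = K1c[OF u] fcmp_closed[OF K1c[OF u], of 1]
    let ?d = "u \<ominus>\<^bsub>Free B0\<^esub> fcmp 1 u"
    have "?d \<in> ?K1"
      using uc linear_part_diff[OF uc(1) K1I[OF u]] by (intro K1Q) simp_all
    then have "u \<ominus>\<^bsub>Free B0\<^esub> ?d \<in> ?K1" by (rule F0.submodule_diff[OF K1 u])
    moreover have "u \<ominus>\<^bsub>Free B0\<^esub> ?d = fcmp 1 u"
      using uc by (simp add: a_minus_def F0.M.minus_add F0.M.r_neg2)
    ultimately show ?thesis by simp
  qed
  have "\<exists>C v. min_generates R (Free B0) ?K1 C v \<and> (\<forall>b\<in>C. \<forall>c. v b c \<in> G 1)"
    by (rule linear_stage[OF B0 K1]) (blast intro: syzygy.first[OF gen0] K1I K1lin)+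
  then obtain B1 v where min1: "min_generates R (Free B0) ?K1 B1 v"
    and v: "\<And>b c. b \<in> B1 \<Longrightarrow> v b c \<in> G 1"
    by blast
  then have gen1: "generates R (Free B0) ?K1 B1 v" by (simp add: min_generates_def)
  have B1: "finite B1" and vc: "v \<in> B1 \<rightarrow> carrier (Free B0)"
    using gen1 by (simp_all add: generates_def)
  note S1 = syzygy.first[OF gen0 gen1]
  let ?K2 = "relations R (Free B0) B1 v"
  note K2 = relations_submodule[OF F vc]
  have K2I: "u b \<in> I 1" if "u \<in> ?K2" for u b by (rule min_relations_I_1[OF F min1 that])
  have "\<exists>C w. min_generates R (Free B1) ?K2 C w \<and> (\<forall>b\<in>C. \<forall>c. w b c \<in> G 1)"
  proof (rule linear_stage[OF B1 K2])
    \<comment> \<open>The matrix \<open>v\<close> is linear by now, so its relations are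
      graded.\<close>
    show "fcmp 1 u \<in> ?K2" if "u \<in> ?K2" for u by (rule fcmp_relations[OF B1 vc _ that]) (rule v)
  qed (blast intro: syzygy.step[OF S1] K2I)+
  then obtain B2 w where min2: "min_generates R (Free B1) ?K2 B2 w"
    and w: "\<And>b c. b \<in> B2 \<Longrightarrow> w b c \<in> G 1"
    by blast
  then have gen2: "generates R (Free B1) ?K2 B2 w" by (simp add: min_generates_def)
  have B2: "finite B2" and wc: "w \<in> B2 \<rightarrow> carrier (Free B1)"
    using gen2 by (simp_all add: generates_def)
  note S2 = syzygy.step[OF S1 gen2]
  let ?K3 = "relations R (Free B1) B2 w"
  note K3 = relations_submodule[OF F wc]
  have K3I: "u b \<in> I 1" if "u \<in> ?K3" for u b by (rule min_relations_I_1[OF F min2 that])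
  \<comment> \<open>The third stage supplies the rank \<open>card B3\<close> and a minimal matrix;
    its linear relations are controlled by \<open>linear_syzygies_bound\<close>.\<close>
  obtain B3 t where min3: "min_generates R (Free B2) ?K3 B3 t"
    using noetherian_free[OF B2 K3] min_generates_exists[OF F] by blast
  then have gen3: "generates R (Free B2) ?K3 B3 t" by (simp add: min_generates_def)
  note S3 = syzygy.step[OF S2 gen3]
  have t: "t b c \<in> I 1" if "b \<in> B3" for b c by (rule K3I[OF generates_mem[OF F gen3 that]])
  have vI: "v b c \<in> I 1" if "b \<in> B1" for b c using v[OF that] G_subset_I[of 1 1] by blast
  have wI: "w b c \<in> I 1" if "b \<in> B2" for b c using w[OF that] G_subset_I[of 1 1] by blast
  \<comment> \<open>From degree two on the first syzygies fill the free module, so their dimensions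
    there are multiples of \<open>card B0\<close>.\<close>
  have K1p: "?K1 \<inter> piece B0 j = piece B0 j" if "j \<ge> 2" for j
    using K1Q G_subset_I[OF that] by (auto simp: piece_def)
  \<comment> \<open>Minimality forbids relations with nonzero constant coefficients. The strand
    starting in degree zero is therefore injective, and \<open>card B2\<close> counts the linear
    second syzygies.\<close>
  have K3p: "?K3 \<inter> piece B2 0 = {\<zero>\<^bsub>Free B2\<^esub>}"
  proof (intro equalityI subsetI)
    fix u assume u: "u \<in> ?K3 \<inter> piece B2 0"
    then have "u b = \<zero>" for b
      using K3I[of u b] cmp_homogeneous[of "u b" 0 0] by (auto simp: piece_def I_def)
    then show "u \<in> {\<zero>\<^bsub>Free B2\<^esub>}" by (auto simp: free_module_simps)
  qed (use module.submodule_zero[OF F K3] in \<open>auto simp: piece_def free_module_simps\<close>)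
  have s1: "card B1 * hdim 1 = vdim K (Free B1) (?K2 \<inter> piece B1 1) + card B0 * hdim 2"
    using strand_dim[OF gen1 v, of 1] K1p[of 2] piece_dim(2)[OF B0, of 2] by (simp add: numeral_2_eq_2)
  have s2: "card B1 * hdim 2 = vdim K (Free B1) (?K2 \<inter> piece B1 2) + card B0 * hdim 3"
    using strand_dim[OF gen1 v, of 2] K1p[of 3] piece_dim(2)[OF B0, of 3] by simp
  have s3: "card B2 = vdim K (Free B1) (?K2 \<inter> piece B1 1)"
    using strand_dim[OF gen2 w, of 0] K3p hdim_0 vdim_zero(2)[OF K_field free_module_K, of B2] by simp
  have s4: "card B2 * hdim 1 = vdim K (Free B2) (?K3 \<inter> piece B2 1) +
      vdim K (Free B1) (?K2 \<inter> piece B1 2)"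
    using strand_dim[OF gen2 w, of 1] by (simp add: numeral_2_eq_2)
  show ?thesis
  proof (rule dimension_inequality[OF s1 s2 s3 s4])
    show "vdim K (Free B2) (?K3 \<inter> piece B2 1) \<le> card B3"
      by (rule linear_syzygies_bound[OF gen3 t B2])
    show "card B1 * dN \<le> card B1 * dP + card B0 * dP"
      by (rule rank_upper[OF S1 _ vI]) (rule min_relations_I_1[OF F min1])
    show "card B2 * dP + card B1 * dP \<le> card B2 * dN"
      by (rule rank_lower[OF S1 vI gen2 wI])
    show "card B3 * dN \<le> card B3 * dP + card B2 * dP"
      by (rule rank_upper[OF S3 _ t]) (rule min_relations_I_1[OF F min3])
  qed (use dP_less g0 in auto)
qed

lemma maximal_cube: "\<mm> \<cdot> \<mm> \<cdot> \<mm> = {\<zero>}"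
proof (rule cube_zero)
  show "G 3 = {\<zero>}"
    using vdim_eq_0[OF K_field RM_module G_fin_dim, of 3] hdim_3 by (simp add: hdim_def)
qed

end

theorem theorem5p4:
  fixes R :: "('a, 'r) ring_scheme" (structure)
    and \<mm> :: "'a set"
    and M :: "('a, 'm, 'x) module_scheme"
    and N :: "('a, 'n, 'y) module_scheme"
  assumes "artinian_local_ring R \<mm>"
    and "standard_graded R \<mm>"
    and "fin_gen_module R M" and "\<not> zero_module M"
    and "fin_gen_module R N" and "\<not> zero_module N"
    and "ideal_smult R (\<mm> \<cdot> \<mm>) M = {\<zero>\<^bsub>M\<^esub>}"
    and "ideal_smult R (\<mm> \<cdot> \<mm>) N = {\<zero>\<^bsub>N\<^esub>}"
    and "\<And>i. i > 0 \<Longrightarrow> zero_module (Tor R M N i)"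
  shows "\<mm> \<cdot> \<mm> \<cdot> \<mm> = {\<zero>}"
proof -
  interpret artinian_local_ring R \<mm> by fact
  \<comment> \<open>The locale parameters are the witnesses hidden in
    \<open>standard_graded\<close>.\<close>
  have "\<exists>h G. standard_graded_ring_axioms R \<mm> h G"
    using assms(2) by (simp add: standard_graded_def standard_graded_ring_axioms_def Ball_def)
  then obtain h G where "standard_graded_ring_axioms R \<mm> h G" by blast
  then interpret standard_graded_ring R \<mm> h G
    by (intro standard_graded_ring.intro assms(1))
  interpret tor_vanishing R \<mm> h G M N
    by unfold_locales (fact assms)+
  show ?thesis by (rule maximal_cube)
qed

end
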